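(* Let $0<\alpha<1$ and let $\theta(x,t)$, $x\in\mathbb{R}^d$, $t\ge0$, be a smooth solution, periodic in $x$, of the active scalar equation $\theta_t=(u\cdot\nabla)\theta-(-\Delta)^\alpha\theta$, where $u$ is determined from $\theta$. Suppose that $\omega(\xi,t)$ is continuous in $(\xi,t)$, piecewise $C^1$ in $t$ for each fixed $\xi$, that for every $t\ge0$ the function $\omega(\cdot,t)$ is a modulus of continuity, and that $\partial^2_{\xi\xi}\omega(0,t)=-\infty$ for all $t\ge0$. Let $t_1>0$ and $x\ne y$ be such that $\theta(\cdot,t)$ obeys $\omega(\cdot,t)$ for all $t<t_1$ and $\theta(x,t_1)-\theta(y,t_1)=\omega(\xi,t_1)$, where $\xi=|x-y|$. Then $$-(-\Delta)^\alpha\theta(x,t_1)+(-\Delta)^\alpha\theta(y,t_1)\le D_{\alpha,\omega}(\xi,t_1).$$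
   Context: A modulus of continuity is a function $\omega:\mathbb{R}^+\to\mathbb{R}^+$ with $\omega(0)=0$ that is continuous, increasing, concave, and piecewise $C^1$ on $(0,\infty)$ (its derivative is continuous except perhaps at finitely many points, where one-sided derivatives exist but may differ). A function $f$ obeys $\omega$ if $|f(x)-f(y)|<\omega(|x-y|)$ for all $x\ne y$. The condition $\partial^2_{\xi\xi}\omega(0,t)=-\infty$ means that $\partial^2_{\xi\xi}\omega(\xi,t)\to-\infty$ as $\xi\to0^+$. Dissipation term: $D_{\alpha,\omega}(\xi,t)$ is, for $\omega=\omega(\cdot,t)$, $$D_{\alpha,\omega}(\xi)=c_\alpha\left(\int_0^{\xi/2}\frac{\omega(\xi+2\eta)+\omega(\xi-2\eta)-2\omega(\xi)}{\eta^{1+2\alpha}}\,d\eta+\int_{\xi/2}^\infty\frac{\omega(2\eta+\xi)-\omega(2\eta-\xi)-2\omega(\xi)}{\eta^{1+2\alpha}}\,d\eta\right),$$ where both integrands are nonpositive by concavity. Here $0<c_\alpha<1$ is a fixed constant such that the kernel $\Phi^\alpha_{1,t}$ of $e^{-t(-\Delta)^\alpha}$ on $\mathbb{R}$ satisfies $c_\alpha\min\left(t^{-1/(2\alpha)},\,t|x|^{-1-2\alpha}\right)\le\Phi^\alpha_{1,t}(x)\le c_\alpha^{-1}\min\left(t^{-1/(2\alpha)},\,t|x|^{-1-2\alpha}\right)$ for all $x\in\mathbb{R}$, $t>0$. *)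

theory Defs
  imports "HOL-Analysis.Analysis"
begin

section \<open>Moduli of continuity\<close>

text \<open>On \<open>S = {0..}\<close> the left-hand derivative required at an exceptional point \<open>0\<close> is
  relative to the empty set, hence no condition.\<close>

definition piecewise_C1_on :: "real set \<Rightarrow> (real \<Rightarrow> real) \<Rightarrow> bool" where
  "piecewise_C1_on S w \<longleftrightarrow>
     (\<exists>F w'. finite F \<and> continuous_on (S - F) w' \<and>
        (\<forall>x\<in>S - F. (w has_real_derivative w' x) (at x within S)) \<and>
        (\<forall>x\<in>S \<inter> F. (\<exists>l. (w has_real_derivative l) (at x within S \<inter> {..<x})) \<and>
                     (\<exists>r. (w has_real_derivative r) (at x within S \<inter> {x<..}))))"

definition modulus_of_continuity :: "(real \<Rightarrow> real) \<Rightarrow> bool" where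
  "modulus_of_continuity w \<longleftrightarrow>
     w 0 = 0 \<and> (\<forall>\<xi>\<ge>0. w \<xi> \<ge> 0) \<and> continuous_on {0..} w \<and> mono_on {0..} w \<and>
     concave_on {0..} w \<and> piecewise_C1_on {0<..} w"

definition obeys :: "('a::real_normed_vector \<Rightarrow> real) \<Rightarrow> (real \<Rightarrow> real) \<Rightarrow> bool" where
  "obeys f w \<longleftrightarrow> (\<forall>x y. x \<noteq> y \<longrightarrow> \<bar>f x - f y\<bar> < w (norm (x - y)))"

definition second_deriv_at_0_neg_infinity :: "(real \<Rightarrow> real) \<Rightarrow> bool" where
  "second_deriv_at_0_neg_infinity w \<longleftrightarrow>
     (\<forall>\<^sub>F \<xi> in at_right 0. w field_differentiable at \<xi> \<and> deriv w field_differentiable at \<xi>) \<and>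
     filterlim (deriv (deriv w)) at_bot (at_right 0)"


section \<open>The fractional Laplacian on periodic functions and its heat kernel on the line\<close>

text \<open>The period lattice is spanned by the columns of an invertible matrix \<open>B\<close>, i.e. it
  is \<open>B \<int>\<^sup>d\<close>; the characters of the torus are \<open>y \<mapsto> exp (i \<kappa> \<bullet> y)\<close> with \<open>\<kappa>\<close> in the
  dual lattice \<open>2 \<pi> B\<^sup>-\<^sup>T \<int>\<^sup>d\<close>.\<close>

definition lattice_periodic :: "real^'n^'n \<Rightarrow> (real^'n \<Rightarrow> 'b) \<Rightarrow> bool" where
  "lattice_periodic B f \<longleftrightarrow> (\<forall>x i. f (x + column i B) = f x)"

definition wave_vector :: "real^'n^'n \<Rightarrow> int^'n \<Rightarrow> real^'n" where
  "wave_vector B k = (2 * pi) *\<^sub>R (transpose (matrix_inv B) *v (\<chi> i. real_of_int (k $ i)))"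

text \<open>The mean over the period cell, parametrised by the unit cube via \<open>s \<mapsto> B s\<close>.\<close>

definition fourier_coeff :: "real^'n^'n \<Rightarrow> (real^'n \<Rightarrow> real) \<Rightarrow> int^'n \<Rightarrow> complex" where
  "fourier_coeff B f k =
     integral (cbox 0 1) (\<lambda>s. complex_of_real (f (B *v s)) * cis (- (wave_vector B k \<bullet> (B *v s))))"

text \<open>\<open>(-\<Delta>)\<^sup>\<alpha>\<close> is the Fourier multiplier with symbol \<open>\<bar>\<kappa>\<bar>\<^sup>2\<^sup>\<alpha>\<close>. For real-valued smooth
  \<open>f\<close> the series converges absolutely and its sum is real.\<close>

definition frac_laplacian :: "real^'n^'n \<Rightarrow> real \<Rightarrow> (real^'n \<Rightarrow> real) \<Rightarrow> real^'n \<Rightarrow> real" where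
  "frac_laplacian B \<alpha> f x =
     Re (\<Sum>\<^sub>\<infinity>k. complex_of_real (norm (wave_vector B k) powr (2 * \<alpha>)) *
                fourier_coeff B f k * cis (wave_vector B k \<bullet> x))"

text \<open>The convolution kernel of \<open>exp (- t (-\<Delta>)\<^sup>\<alpha>)\<close> on the real line: the inverse Fourier
  transform of \<open>exp (- t \<bar>\<kappa>\<bar>\<^sup>2\<^sup>\<alpha>)\<close>.\<close>

definition frac_heat_kernel :: "real \<Rightarrow> real \<Rightarrow> real \<Rightarrow> real" where
  "frac_heat_kernel \<alpha> t x =
     Re (LINT \<kappa>|lborel. complex_of_real (exp (- t * \<bar>\<kappa>\<bar> powr (2 * \<alpha>))) * cis (\<kappa> * x)) / (2 * pi)"

text \<open>At \<open>x = 0\<close> the second argument of the minimum is to be read as \<open>+\<infinity>\<close>, whereas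
  \<open>0 powr a = 0\<close>.\<close>

definition heat_kernel_profile :: "real \<Rightarrow> real \<Rightarrow> real \<Rightarrow> real" where
  "heat_kernel_profile \<alpha> t x =
     (if x = 0 then t powr (- 1 / (2 * \<alpha>))
      else min (t powr (- 1 / (2 * \<alpha>))) (t * \<bar>x\<bar> powr (- 1 - 2 * \<alpha>)))"

definition heat_kernel_constant :: "real \<Rightarrow> real \<Rightarrow> bool" where
  "heat_kernel_constant \<alpha> c \<longleftrightarrow> 0 < c \<and> c < 1 \<and>
     (\<forall>x. \<forall>t>0. c * heat_kernel_profile \<alpha> t x \<le> frac_heat_kernel \<alpha> t x \<and>
                frac_heat_kernel \<alpha> t x \<le> inverse c * heat_kernel_profile \<alpha> t x)"


section \<open>The dissipation term\<close>

definition dissip_near :: "real \<Rightarrow> (real \<Rightarrow> real) \<Rightarrow> real \<Rightarrow> real \<Rightarrow> real" where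
  "dissip_near \<alpha> w \<xi> \<eta> = (w (\<xi> + 2 * \<eta>) + w (\<xi> - 2 * \<eta>) - 2 * w \<xi>) / \<eta> powr (1 + 2 * \<alpha>)"

definition dissip_far :: "real \<Rightarrow> (real \<Rightarrow> real) \<Rightarrow> real \<Rightarrow> real \<Rightarrow> real" where
  "dissip_far \<alpha> w \<xi> \<eta> = (w (2 * \<eta> + \<xi>) - w (2 * \<eta> - \<xi>) - 2 * w \<xi>) / \<eta> powr (1 + 2 * \<alpha>)"

text \<open>Both integrands are nonpositive, so the integrals always exist in \<open>[-\<infinity>, 0]\<close>; the value
  \<open>-\<infinity>\<close> is possible a priori (for instance at a kink of \<open>w\<close> when \<open>\<alpha> \<ge> 1/2\<close>). Hence the
  term is extended-real-valued, the integrals being negated nonnegative Lebesgue integrals.\<close>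

definition dissipation :: "real \<Rightarrow> real \<Rightarrow> (real \<Rightarrow> real) \<Rightarrow> real \<Rightarrow> ereal" where
  "dissipation c \<alpha> w \<xi> =
     ereal c * (- enn2ereal (\<integral>\<^sup>+\<eta>\<in>{0<..<\<xi>/2}. ennreal (- dissip_near \<alpha> w \<xi> \<eta>) \<partial>lborel)
                - enn2ereal (\<integral>\<^sup>+\<eta>\<in>{\<xi>/2<..}. ennreal (- dissip_far \<alpha> w \<xi> \<eta>) \<partial>lborel))"

lemma dissip_near_nonpos:
  assumes "modulus_of_continuity w" "0 < \<eta>" "\<eta> < \<xi> / 2"
  shows "dissip_near \<alpha> w \<xi> \<eta> \<le> 0"
proof -
  have "concave_on {0..} w"
    using assms(1) by (simp add: modulus_of_continuity_def)
  moreover have "(1/2) *\<^sub>R (\<xi> + 2 * \<eta>) + (1/2) *\<^sub>R (\<xi> - 2 * \<eta>) = \<xi>"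
    by (simp add: field_simps)
  moreover have "\<xi> + 2 * \<eta> \<in> {0..}" "\<xi> - 2 * \<eta> \<in> {0..}"
    using assms by auto
  ultimately have "(1/2) * w (\<xi> + 2 * \<eta>) + (1/2) * w (\<xi> - 2 * \<eta>) \<le> w \<xi>"
    unfolding concave_on_iff by (metis add_divide_distrib divide_self_if field_sum_of_halves
        half_gt_zero_iff less_eq_real_def zero_less_one)
  then show ?thesis
    unfolding dissip_near_def by (intro divide_nonpos_nonneg) auto
qed

lemma modulus_of_continuity_subadd:
  assumes w: "modulus_of_continuity w" and "0 < a" "0 < b"
  shows "w (a + b) \<le> w a + w b"
proof -
  have *: "w p \<ge> p / (a + b) * w (a + b)" if "p + q = a + b" "0 < p" "0 < q" for p q
  proof -
    have "p / (a + b) * w (a + b) + q / (a + b) * w 0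
            \<le> w ((p / (a + b)) *\<^sub>R (a + b) + (q / (a + b)) *\<^sub>R 0)"
    proof -
      have c: "concave_on {0..} w"
        using w by (simp add: modulus_of_continuity_def)
      have "p / (a + b) + q / (a + b) = 1"
        using that assms by (simp add: add_divide_distrib[symmetric])
      moreover have "a + b \<in> {0..}" "0 \<in> {0::real..}" "p / (a + b) \<ge> 0" "q / (a + b) \<ge> 0"
        using that assms by auto
      ultimately show ?thesis
        using c unfolding concave_on_iff by blast
    qed
    then show ?thesis
      using w assms by (simp add: modulus_of_continuity_def)
  qed
  have "a / (a + b) * w (a + b) + b / (a + b) * w (a + b) = w (a + b)"
    using assms by (simp add: distrib_right[symmetric] add_divide_distrib[symmetric]
        del: times_divide_eq_left)
  then show ?thesis
    using *[of a b] *[of b a] assms by linarith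
qed

lemma dissip_far_nonpos:
  assumes "modulus_of_continuity w" "0 < \<xi>" "\<xi> / 2 < \<eta>"
  shows "dissip_far \<alpha> w \<xi> \<eta> \<le> 0"
proof -
  have "2 * \<eta> + \<xi> = (2 * \<eta> - \<xi>) + (\<xi> + \<xi>)"
    by simp
  then have "w (2 * \<eta> + \<xi>) \<le> w (2 * \<eta> - \<xi>) + w (\<xi> + \<xi>)"
    using modulus_of_continuity_subadd[OF assms(1), of "2 * \<eta> - \<xi>" "\<xi> + \<xi>"] assms
    by (simp add: add.commute)
  then have "w (2 * \<eta> + \<xi>) - w (2 * \<eta> - \<xi>) - 2 * w \<xi> \<le> 0"
    using modulus_of_continuity_subadd[OF assms(1), of \<xi> \<xi>] assms by linarith
  then show ?thesis
    unfolding dissip_far_def by (intro divide_nonpos_nonneg) auto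
qed


section \<open>Smooth periodic solutions of the active scalar equation\<close>

primrec Ck_on :: "nat \<Rightarrow> 'a::real_normed_vector set \<Rightarrow> ('a \<Rightarrow> real) \<Rightarrow> bool" where
  "Ck_on 0 S f \<longleftrightarrow> continuous_on S f"
| "Ck_on (Suc k) S f \<longleftrightarrow>
     (\<exists>f'. (\<forall>x\<in>S. (f has_derivative f' x) (at x within S)) \<and> (\<forall>h. Ck_on k S (\<lambda>x. f' x h)))"

definition smooth_on :: "'a::real_normed_vector set \<Rightarrow> ('a \<Rightarrow> real) \<Rightarrow> bool" where
  "smooth_on S f \<longleftrightarrow> (\<forall>k. Ck_on k S f)"

text \<open>\<open>U\<close> is the law, left arbitrary, that determines the velocity from \<open>\<theta>\<close>. The transport
  term \<open>(u \<bullet> \<nabla>)\<theta>\<close> is the derivative of \<open>\<theta>\<close> in space applied to \<open>u\<close>.\<close>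

definition smooth_periodic_solution ::
  "real \<Rightarrow> real^'n^'n \<Rightarrow> ((real^'n \<Rightarrow> real \<Rightarrow> real) \<Rightarrow> real^'n \<Rightarrow> real \<Rightarrow> real^'n)
     \<Rightarrow> (real^'n \<Rightarrow> real \<Rightarrow> real) \<Rightarrow> bool" where
  "smooth_periodic_solution \<alpha> B U \<theta> \<longleftrightarrow>
     smooth_on (UNIV \<times> {0..}) (\<lambda>(x, t). \<theta> x t) \<and>
     (\<forall>t\<ge>0. lattice_periodic B (\<lambda>x. \<theta> x t)) \<and>
     (\<forall>x. \<forall>t>0. ((\<lambda>s. \<theta> x s) has_real_derivative
        (frechet_derivative (\<lambda>z. \<theta> z t) (at x) (U \<theta> x t)
           - frac_laplacian B \<alpha> (\<lambda>z. \<theta> z t) x)) (at t))"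

end

theory Submission
  imports Defs "HOL-Probability.Characteristic_Functions"
begin

text \<open>The fractional Laplacian is an average of Gaussian averages: up to the constant
  \<open>symbol_mass \<alpha>\<close>, the symbol \<open>\<bar>\<kappa>\<bar> powr (2 * \<alpha>)\<close> is the integral of
  \<open>1 - exp (- (\<sigma> * \<bar>\<kappa>\<bar>)\<^sup>2 / 2)\<close> against \<open>\<sigma> powr (- 1 - 2 * \<alpha>)\<close> over \<open>\<sigma> > 0\<close>. A Gaussian
  average of \<open>\<theta>\<close> in the directions orthogonal to \<open>x - y\<close> keeps the modulus of continuity \<open>w\<close>,
  so only the average along the line through \<open>x\<close> and \<open>y\<close> matters. There, reflecting at the
  midpoint bounds the increment by the one in which \<open>\<theta>\<close> is replaced by the odd function
  \<open>s \<mapsto> w (2 * s)\<close>. Integrating in \<open>\<sigma>\<close> turns the Gaussian density at \<open>\<eta>\<close> into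
  \<open>kernel_mass \<alpha>\<close> times \<open>\<bar>\<eta>\<bar> powr (- 1 - 2 * \<alpha>)\<close> and yields the dissipation term with the constant
  \<open>kernel_mass \<alpha> / symbol_mass \<alpha>\<close>. That \<open>c\<close> is at most this constant follows by testing the
  lower heat kernel bound against \<open>1 - cos x\<close> and letting \<open>t\<close> tend to \<open>0\<close>.\<close>

section \<open>Gaussian averages\<close>

text \<open>Two features shape the route. \<open>frac_laplacian\<close> sees \<open>\<theta>\<close>
  only through its Fourier coefficients, so every average is computed as a multiplier on
  coefficients, and absolute summability with Fourier inversion ties this to pointwise values. And
  \<open>dissipation\<close> may a priori be \<open>-\<infinity>\<close>, so the comparison is made
  between nonnegative extended integrals, where Tonelli asks for no integrability; finiteness
  emerges at the end, from a bound by a real number.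

  Gaussians are used in place of the heat kernel because they factor over an orthonormal basis:
  \<open>exp (- (\<sigma> * norm \<kappa>)\<^sup>2 / 2)\<close> is a product of one-dimensional
  factors, so averaging over the whole space becomes a succession of averages along lines. They are
  also visibly even and decreasing away from the centre, which is what the reflection uses.

  The ratio \<open>kernel_mass \<alpha> / symbol_mass \<alpha>\<close> is the classical normalising
  constant of the singular integral for the fractional Laplacian on the line. An upper bound for
  \<open>c\<close> is the direction wanted: the dissipation term is nonpositive, so a smaller
  constant weakens the claim.\<close>

lemma infsum_integral_swap:
  fixes g :: "'k::countable \<Rightarrow> 'b \<Rightarrow> complex"
  assumes M: "sigma_finite_measure M"
    and int: "\<And>k. integrable M (g k)"
    and sum: "(\<lambda>k. LINT \<omega>|M. norm (g k \<omega>)) summable_on UNIV"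
    and pt: "\<And>\<omega>. \<omega> \<in> space M \<Longrightarrow> (\<lambda>k. norm (g k \<omega>)) summable_on UNIV"
  shows "integrable M (\<lambda>\<omega>. \<Sum>\<^sub>\<infinity>k. g k \<omega>)"
    and "(LINT \<omega>|M. (\<Sum>\<^sub>\<infinity>k. g k \<omega>)) = (\<Sum>\<^sub>\<infinity>k. LINT \<omega>|M. g k \<omega>)"
proof -
  \<comment> \<open>Sums are integrals against the counting measure, so the claim is Fubini on
    \<open>?C \<Otimes>\<^sub>M M\<close>.\<close>
  let ?C = "count_space (UNIV :: 'k set)"
  interpret M: sigma_finite_measure M by fact
  interpret C: sigma_finite_measure ?C
    by (rule sigma_finite_measure_count_space_countable) simp
  interpret P: pair_sigma_finite ?C M ..
  have gm [measurable]: "g k \<in> borel_measurable M" for k using int by auto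
  have meas: "case_prod g \<in> borel_measurable (?C \<Otimes>\<^sub>M M)"
    by (rule measurable_pair_measure_countable1) (auto simp: gm)
  have abs_int: "integrable ?C f \<longleftrightarrow> (\<lambda>k. norm (f k)) summable_on UNIV" for f :: "'k \<Rightarrow> complex"
    using abs_summable_equivalent[of f UNIV] by (simp add: abs_summable_on_def)
  have abs_int_r: "integrable ?C f" if "f summable_on UNIV" "\<And>k. f k \<ge> 0" for f :: "'k \<Rightarrow> real"
    using abs_summable_equivalent[of f UNIV] that by (simp add: abs_summable_on_def)
  have infsum_eq: "(LINT k|?C. f k) = infsum f UNIV" if "(\<lambda>k. norm (f k)) summable_on UNIV" for f :: "'k \<Rightarrow> complex"
    using infsetsum_infsum[of f UNIV] that by (simp add: abs_summable_equivalent infsetsum_def)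
  have pair: "integrable (?C \<Otimes>\<^sub>M M) (case_prod g)"
  proof (rule P.Fubini_integrable[OF meas])
    show "integrable ?C (\<lambda>k. LINT \<omega>|M. norm (case_prod g (k, \<omega>)))"
      using abs_int_r[OF sum] by simp
    show "AE k in ?C. integrable M (\<lambda>\<omega>. case_prod g (k, \<omega>))"
      using int by simp
  qed
  have pair': "integrable (?C \<Otimes>\<^sub>M M) (\<lambda>(k, \<omega>). g k \<omega>)" using pair .
  \<comment> \<open>Fubini alone would give convergence only almost everywhere; \<open>pt\<close>
    makes the two sums agree at every point of the space.\<close>
  have eq: "(LINT k|?C. g k \<omega>) = (\<Sum>\<^sub>\<infinity>k. g k \<omega>)" if "\<omega> \<in> space M" for \<omega>
    using infsum_eq[OF pt[OF that]] .
  show "integrable M (\<lambda>\<omega>. \<Sum>\<^sub>\<infinity>k. g k \<omega>)"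
    using P.integrable_snd[OF pair'] by (subst Bochner_Integration.integrable_cong[OF refl eq[symmetric]]) auto
  have s2: "(\<lambda>k. norm (LINT \<omega>|M. g k \<omega>)) summable_on UNIV"
    by (rule summable_on_comparison_test[OF sum]) (auto intro: integral_norm_bound)
  have "(LINT \<omega>|M. (\<Sum>\<^sub>\<infinity>k. g k \<omega>)) = (LINT \<omega>|M. LINT k|?C. g k \<omega>)"
    by (rule Bochner_Integration.integral_cong) (auto simp: eq)
  also have "\<dots> = (LINT k|?C. LINT \<omega>|M. g k \<omega>)"
    using P.Fubini_integral[OF pair'] by simp
  also have "\<dots> = (\<Sum>\<^sub>\<infinity>k. LINT \<omega>|M. g k \<omega>)"
    by (rule infsum_eq[OF s2])
  finally show "(LINT \<omega>|M. (\<Sum>\<^sub>\<infinity>k. g k \<omega>)) = (\<Sum>\<^sub>\<infinity>k. LINT \<omega>|M. g k \<omega>)" .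
qed

lemma borel_measurable_cis [measurable]: "cis \<in> borel_measurable borel"
  by (intro borel_measurable_continuous_onI continuous_intros)

lemma normal_density_scale:
  "\<sigma> > 0 \<Longrightarrow> \<sigma> * normal_density m \<sigma> (m + \<sigma> * x) = std_normal_density x"
  by (simp add: normal_density_def field_simps power_mult_distrib real_sqrt_mult)

lemma normal_density_char:
  assumes "\<sigma> > 0"
  shows "integrable lborel (\<lambda>\<eta>. complex_of_real (normal_density 0 \<sigma> \<eta>) * cis (a * \<eta>))"
    and "(LINT \<eta>|lborel. complex_of_real (normal_density 0 \<sigma> \<eta>) * cis (a * \<eta>))
          = complex_of_real (exp (- (\<sigma> * a)\<^sup>2 / 2))"
proof -
  show "integrable lborel (\<lambda>\<eta>. complex_of_real (normal_density 0 \<sigma> \<eta>) * cis (a * \<eta>))"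
    by (rule Bochner_Integration.integrable_bound[OF integrable_normal_density[OF assms]])
       (auto simp: norm_mult)
  have "(LINT \<eta>|lborel. complex_of_real (normal_density 0 \<sigma> \<eta>) * cis (a * \<eta>))
        = \<sigma> *\<^sub>R (LINT x|lborel. complex_of_real (normal_density 0 \<sigma> (\<sigma> * x)) * cis (a * (\<sigma> * x)))"
    using lborel_integral_real_affine[of \<sigma> "\<lambda>\<eta>. complex_of_real (normal_density 0 \<sigma> \<eta>) * cis (a * \<eta>)" 0] assms
    by simp
  also have "\<dots> = (LINT x|lborel. std_normal_density x *\<^sub>R cis (\<sigma> * a * x))"
    by (subst Bochner_Integration.integral_scaleR_right[symmetric])
       (auto simp: normal_density_scale[OF assms, of 0, symmetric] scaleR_conv_of_real mult_ac intro!: Bochner_Integration.integral_cong)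
  also have "\<dots> = char std_normal_distribution (\<sigma> * a)"
    unfolding char_def by (subst integral_density) (auto simp: cis_conv_exp)
  also have "\<dots> = complex_of_real (exp (- (\<sigma> * a)\<^sup>2 / 2))"
    by (simp add: char_std_normal_distribution)
  finally show "(LINT \<eta>|lborel. complex_of_real (normal_density 0 \<sigma> \<eta>) * cis (a * \<eta>))
          = complex_of_real (exp (- (\<sigma> * a)\<^sup>2 / 2))" .
qed

lemma normal_density_cos:
  assumes "\<sigma> > 0"
  shows "integrable lborel (\<lambda>\<eta>. normal_density 0 \<sigma> \<eta> * cos (a * \<eta>))"
    and "(LINT \<eta>|lborel. normal_density 0 \<sigma> \<eta> * cos (a * \<eta>)) = exp (- (\<sigma> * a)\<^sup>2 / 2)"
  using normal_density_char[OF assms, of a] integral_Re[of lborel "\<lambda>\<eta>. complex_of_real (normal_density 0 \<sigma> \<eta>) * cis (a * \<eta>)"]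
    integrable_Re[of lborel "\<lambda>\<eta>. complex_of_real (normal_density 0 \<sigma> \<eta>) * cis (a * \<eta>)"]
  by auto

section \<open>The constant of the heat kernel\<close>

text \<open>Approximate identity: after substituting \<open>x = a + e n * z\<close> the weight no
  longer depends on \<open>n\<close>, and dominated convergence applies with the standard density as
  majorant.\<close>

lemma normal_density_average_tendsto:
  fixes k :: "real \<Rightarrow> real"
  assumes [measurable]: "k \<in> borel_measurable borel" and bd: "\<And>x. \<bar>k x\<bar> \<le> 1" and cont: "isCont k a"
    and e: "\<And>n. e n > 0" "e \<longlonglongrightarrow> 0"
  shows "(\<lambda>n. LINT x|lborel. k x * normal_density a (e n) x) \<longlonglongrightarrow> k a"
proof -
  have eq: "(LINT x|lborel. k x * normal_density a (e n) x) = (LINT z|lborel. k (a + e n * z) * std_normal_density z)" for n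
  proof -
    have "(LINT x|lborel. k x * normal_density a (e n) x)
       = e n *\<^sub>R (LINT z|lborel. k (a + e n * z) * normal_density a (e n) (a + e n * z))"
      using lborel_integral_real_affine[of "e n" "\<lambda>x. k x * normal_density a (e n) x" a] e(1)[of n] by simp
    also have "\<dots> = (LINT z|lborel. k (a + e n * z) * std_normal_density z)"
      by (subst Bochner_Integration.integral_scaleR_right[symmetric], intro Bochner_Integration.integral_cong refl)
         (simp add: normal_density_scale[OF e(1)[of n], of a, symmetric])
    finally show ?thesis .
  qed
  have "(\<lambda>n. LINT z|lborel. k (a + e n * z) * std_normal_density z) \<longlonglongrightarrow> (LINT z|lborel. k a * std_normal_density z)"
  proof (rule integral_dominated_convergence[where w = std_normal_density])
    show "AE z in lborel. (\<lambda>n. k (a + e n * z) * std_normal_density z) \<longlonglongrightarrow> k a * std_normal_density z"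
    proof (intro AE_I2 tendsto_mult tendsto_const)
      fix z :: real
      have "(\<lambda>n. a + e n * z) \<longlonglongrightarrow> a + 0 * z" by (intro tendsto_intros e)
      then show "(\<lambda>n. k (a + e n * z)) \<longlonglongrightarrow> k a"
        using isCont_tendsto_compose[OF cont] by simp
    qed
    show "AE z in lborel. norm (k (a + e n * z) * std_normal_density z) \<le> std_normal_density z" for n
      using bd by (auto simp: abs_mult intro!: mult_left_le_one_le)
  qed auto
  then show ?thesis by (simp add: eq)
qed

text \<open>The integral of a non-integrable function is \<open>0\<close> by convention, whereas the
  lower kernel bound at \<open>x = 0\<close> is positive. Integrability is thus read off from the
  hypothesis on \<open>c\<close>, without a tail estimate.\<close>

lemma heat_symbol_integrable:
  assumes "heat_kernel_constant \<alpha> c" "t > 0"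
  shows "integrable lborel (\<lambda>\<kappa>. exp (- t * \<bar>\<kappa>\<bar> powr (2 * \<alpha>)))"
proof -
  have "0 < c * heat_kernel_profile \<alpha> t 0"
    using assms by (auto simp: heat_kernel_constant_def heat_kernel_profile_def)
  also have "\<dots> \<le> frac_heat_kernel \<alpha> t 0"
    using assms by (auto simp: heat_kernel_constant_def)
  finally have "frac_heat_kernel \<alpha> t 0 \<noteq> 0" by simp
  then have "integrable lborel (\<lambda>\<kappa>. complex_of_real (exp (- t * \<bar>\<kappa>\<bar> powr (2 * \<alpha>))) * cis (\<kappa> * 0))"
    unfolding frac_heat_kernel_def using not_integrable_integral_eq by fastforce
  from integrable_Re[OF this] show ?thesis by simp
qed

lemma frac_heat_kernel_real:
  assumes "heat_kernel_constant \<alpha> c" "t > 0"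
  shows "frac_heat_kernel \<alpha> t x = (LINT \<kappa>|lborel. exp (- t * \<bar>\<kappa>\<bar> powr (2 * \<alpha>)) * cos (\<kappa> * x)) / (2 * pi)"
proof -
  have "integrable lborel (\<lambda>\<kappa>. complex_of_real (exp (- t * \<bar>\<kappa>\<bar> powr (2 * \<alpha>))) * cis (\<kappa> * x))"
    by (rule Bochner_Integration.integrable_bound[OF heat_symbol_integrable[OF assms]]) (auto simp: norm_mult)
  from integral_Re[OF this] show ?thesis unfolding frac_heat_kernel_def by simp
qed

text \<open>Fourier inversion with a Gaussian regulariser. The damping makes the double integral in
  \<open>x\<close> and \<open>\<kappa>\<close> absolutely convergent; Fubini then moves the
  transform onto the Gaussian, and the cosine moves the centre of the resulting density to
  \<open>a\<close> and \<open>- a\<close>.\<close>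

lemma frac_heat_kernel_gaussian_pairing:
  assumes hk: "heat_kernel_constant \<alpha> c" "t > 0" and e: "\<epsilon> > 0"
  defines "k \<equiv> \<lambda>\<kappa>. exp (- t * \<bar>\<kappa>\<bar> powr (2 * \<alpha>))"
  shows "integrable lborel (\<lambda>x. frac_heat_kernel \<alpha> t x * (exp (- (\<epsilon> * x)\<^sup>2 / 2) * cos (a * x)))" (is ?A)
    and "(LINT x|lborel. frac_heat_kernel \<alpha> t x * (exp (- (\<epsilon> * x)\<^sup>2 / 2) * cos (a * x)))
        = ((LINT \<kappa>|lborel. k \<kappa> * normal_density a \<epsilon> \<kappa>) + (LINT \<kappa>|lborel. k \<kappa> * normal_density (- a) \<epsilon> \<kappa>)) / 2" (is ?B)
proof -
  let ?g = "\<lambda>x. exp (- (\<epsilon> * x)\<^sup>2 / 2)"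
  let ?K = "sqrt (2 * pi) / \<epsilon>"
  have gn: "?g x = ?K * normal_density 0 (1 / \<epsilon>) x" for x
    using e by (simp add: normal_density_def power_mult_distrib real_sqrt_mult real_sqrt_divide field_simps)
  have gi: "integrable lborel ?g"
    unfolding gn using e by auto
  have ki: "integrable lborel k"
    unfolding k_def by (rule heat_symbol_integrable[OF hk])
  have km [measurable]: "k \<in> borel_measurable borel" unfolding k_def by measurable
  have k0: "k x \<ge> 0" and k1: "k x \<le> 1" for x using hk(2) by (simp_all add: k_def)
  let ?F = "\<lambda>(x, \<kappa>). k \<kappa> * cos (\<kappa> * x) * (?g x * cos (a * x))"
  have Fi: "integrable (lborel \<Otimes>\<^sub>M lborel) ?F"
  proof -
    have "integrable (lborel \<Otimes>\<^sub>M lborel) (\<lambda>(x, \<kappa>). ?g x * k \<kappa>)"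
    proof (rule lborel_pair.Fubini_integrable)
      show "integrable lborel (\<lambda>x. LINT \<kappa>|lborel. norm (case (x, \<kappa>) of (x, \<kappa>) \<Rightarrow> ?g x * k \<kappa>))"
        using gi by (simp add: abs_mult)
      show "AE x in lborel. integrable lborel (\<lambda>\<kappa>. case (x, \<kappa>) of (x, \<kappa>) \<Rightarrow> ?g x * k \<kappa>)"
        using ki by simp
    qed measurable
    then show ?thesis
    proof (rule Bochner_Integration.integrable_bound)
      show "AE z in lborel \<Otimes>\<^sub>M lborel. norm (?F z) \<le> norm (case z of (x, \<kappa>) \<Rightarrow> ?g x * k \<kappa>)"
      proof (intro AE_I2, clarify)
        fix x \<kappa> :: real
        have "\<bar>cos (\<kappa> * x)\<bar> * \<bar>cos (a * x)\<bar> \<le> 1 * 1" by (intro mult_mono) auto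
        then have "(?g x * k \<kappa>) * (\<bar>cos (\<kappa> * x)\<bar> * \<bar>cos (a * x)\<bar>) \<le> (?g x * k \<kappa>) * 1"
          by (intro mult_left_mono) (auto simp: k0)
        then show "norm (k \<kappa> * cos (\<kappa> * x) * (?g x * cos (a * x))) \<le> norm (?g x * k \<kappa>)"
          by (simp add: abs_mult k0 mult_ac)
      qed
    qed measurable
  qed
  have inner1: "(LINT \<kappa>|lborel. ?F (x, \<kappa>)) = 2 * pi * (frac_heat_kernel \<alpha> t x * (?g x * cos (a * x)))" for x
    unfolding frac_heat_kernel_real[OF hk] k_def by simp
  \<comment> \<open>A Gaussian of width \<open>1 / \<epsilon>\<close> in \<open>x\<close> transforms
    into one of width \<open>\<epsilon>\<close> in \<open>\<kappa>\<close>; \<open>?K\<close>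
    supplies its normalisation.\<close>
  have nd: "?K * exp (- ((b - m) / \<epsilon>)\<^sup>2 / 2) = 2 * pi * normal_density m \<epsilon> b" for m b
    using e by (simp add: normal_density_def power_mult_distrib real_sqrt_mult power_divide field_simps)
  have inner2: "(LINT x|lborel. ?F (x, \<kappa>)) = pi * (k \<kappa> * normal_density a \<epsilon> \<kappa> + k \<kappa> * normal_density (- a) \<epsilon> \<kappa>)" for \<kappa>
  proof -
    let ?n = "normal_density 0 (1 / \<epsilon>)"
    have "(LINT x|lborel. ?F (x, \<kappa>)) = (LINT x|lborel. (k \<kappa> * ?K / 2) * (?n x * cos ((\<kappa> - a) * x) + ?n x * cos ((\<kappa> + a) * x)))"
    proof (intro Bochner_Integration.integral_cong refl)
      fix x
      have "cos (\<kappa> * x) * cos (a * x) = (cos ((\<kappa> - a) * x) + cos ((\<kappa> + a) * x)) / 2"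
        by (simp add: cos_times_cos algebra_simps)
      then have "k \<kappa> * ?K * ?n x * (cos (\<kappa> * x) * cos (a * x))
          = k \<kappa> * ?K * ?n x * ((cos ((\<kappa> - a) * x) + cos ((\<kappa> + a) * x)) / 2)" by (rule arg_cong)
      then show "?F (x, \<kappa>) = (k \<kappa> * ?K / 2) * (?n x * cos ((\<kappa> - a) * x) + ?n x * cos ((\<kappa> + a) * x))"
        unfolding gn by (simp add: mult_ac distrib_left add_divide_distrib)
    qed
    also have "\<dots> = (k \<kappa> * ?K / 2) * (exp (- ((\<kappa> - a) / \<epsilon>)\<^sup>2 / 2) + exp (- ((\<kappa> + a) / \<epsilon>)\<^sup>2 / 2))"
      using normal_density_cos[of "1 / \<epsilon>" "\<kappa> - a"] normal_density_cos[of "1 / \<epsilon>" "\<kappa> + a"] e by simp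
    also have "\<dots> = k \<kappa> / 2 * (?K * exp (- ((\<kappa> - a) / \<epsilon>)\<^sup>2 / 2) + ?K * exp (- ((\<kappa> - (- a)) / \<epsilon>)\<^sup>2 / 2))"
      by (simp add: algebra_simps)
    also have "\<dots> = pi * (k \<kappa> * normal_density a \<epsilon> \<kappa> + k \<kappa> * normal_density (- a) \<epsilon> \<kappa>)"
      unfolding nd by (simp add: algebra_simps)
    finally show ?thesis .
  qed
  have "integrable lborel (\<lambda>x. 2 * pi * (frac_heat_kernel \<alpha> t x * (?g x * cos (a * x))))"
    using lborel_pair.integrable_fst[of "\<lambda>x \<kappa>. ?F (x, \<kappa>)"] Fi unfolding inner1 by simp
  then have "integrable lborel (\<lambda>x. 1 / (2 * pi) * (2 * pi * (frac_heat_kernel \<alpha> t x * (?g x * cos (a * x)))))"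
    by (rule integrable_mult_right)
  then show A: ?A by simp
  have kn: "integrable lborel (\<lambda>\<kappa>. k \<kappa> * normal_density m \<epsilon> \<kappa>)" for m
    using e k0 k1 by (intro Bochner_Integration.integrable_bound[OF integrable_normal_density[of \<epsilon> m]])
       (auto simp: abs_mult intro!: mult_left_le_one_le)
  have "2 * pi * (LINT x|lborel. frac_heat_kernel \<alpha> t x * (?g x * cos (a * x))) = (LINT x|lborel. LINT \<kappa>|lborel. ?F (x, \<kappa>))"
    unfolding inner1 by simp
  also have "\<dots> = (LINT \<kappa>|lborel. LINT x|lborel. ?F (x, \<kappa>))"
    using lborel_pair.Fubini_integral[of "\<lambda>x \<kappa>. ?F (x, \<kappa>)"] Fi by simp
  also have "\<dots> = pi * ((LINT \<kappa>|lborel. k \<kappa> * normal_density a \<epsilon> \<kappa>) + (LINT \<kappa>|lborel. k \<kappa> * normal_density (- a) \<epsilon> \<kappa>))"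
    unfolding inner2 using kn by simp
  finally have "pi * (2 * (LINT x|lborel. frac_heat_kernel \<alpha> t x * (?g x * cos (a * x))))
      = pi * ((LINT \<kappa>|lborel. k \<kappa> * normal_density a \<epsilon> \<kappa>) + (LINT \<kappa>|lborel. k \<kappa> * normal_density (- a) \<epsilon> \<kappa>))"
    by (simp only: mult_ac)
  moreover have "u = v / 2" if "pi * (2 * u) = pi * v" for u v :: real using that by simp
  ultimately show ?B by blast
qed

section \<open>Masses of the scale mixture of Gaussians\<close>

definition symbol_mass :: "real \<Rightarrow> ennreal" where
  "symbol_mass \<alpha> = (\<integral>\<^sup>+\<sigma>\<in>{0<..}. ennreal ((1 - exp (- \<sigma>\<^sup>2 / 2)) * \<sigma> powr (- 1 - 2 * \<alpha>)) \<partial>lborel)"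

text \<open>The mixture density at the point \<open>1\<close>; homogeneity gives it at every other
  nonzero point. Like \<open>symbol_mass\<close> it is extended nonnegative, so it can be scaled and
  exchanged with other integrals before anything is known to be finite.\<close>

definition kernel_mass :: "real \<Rightarrow> ennreal" where
  "kernel_mass \<alpha> = (\<integral>\<^sup>+\<sigma>\<in>{0<..}. ennreal (normal_density 0 \<sigma> 1 * \<sigma> powr (- 1 - 2 * \<alpha>)) \<partial>lborel)"

lemma nn_integral_half_line_scale:
  fixes f :: "real \<Rightarrow> ennreal"
  assumes [measurable]: "f \<in> borel_measurable borel" and a: "a > 0"
  shows "(\<integral>\<^sup>+\<sigma>\<in>{0<..}. f \<sigma> \<partial>lborel) = ennreal a * (\<integral>\<^sup>+\<sigma>\<in>{0<..}. f (a * \<sigma>) \<partial>lborel)"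
proof -
  have "indicator {0<..} (a * \<sigma>) = (indicator {0<..} \<sigma> :: ennreal)" for \<sigma>
    using a by (auto simp: indicator_def zero_less_mult_iff)
  then show ?thesis
    using nn_integral_real_affine[of "\<lambda>\<sigma>. f \<sigma> * indicator {0<..} \<sigma>" a 0] a by simp
qed

text \<open>Substituting \<open>\<bar>a\<bar> * \<sigma>\<close> for \<open>\<sigma>\<close> in
  \<open>symbol_mass\<close> brings out the power, as the weight is homogeneous. For
  \<open>a = 0\<close> both sides vanish, in agreement with \<open>0 powr _ = 0\<close>.\<close>

lemma symbol_mass_scale:
  "(\<integral>\<^sup>+\<sigma>\<in>{0<..}. ennreal ((1 - exp (- (\<sigma> * a)\<^sup>2 / 2)) * \<sigma> powr (- 1 - 2 * \<alpha>)) \<partial>lborel)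
     = ennreal (\<bar>a\<bar> powr (2 * \<alpha>)) * symbol_mass \<alpha>"
proof (cases "a = 0")
  case False
  let ?b = "\<bar>a\<bar>"
  have b: "?b > 0" using False by simp
  have "symbol_mass \<alpha> = ennreal ?b * (\<integral>\<^sup>+\<sigma>\<in>{0<..}. ennreal ((1 - exp (- (?b * \<sigma>)\<^sup>2 / 2)) * (?b * \<sigma>) powr (- 1 - 2 * \<alpha>)) \<partial>lborel)"
    unfolding symbol_mass_def by (rule nn_integral_half_line_scale[OF _ b]) measurable
  also have "(\<integral>\<^sup>+\<sigma>\<in>{0<..}. ennreal ((1 - exp (- (?b * \<sigma>)\<^sup>2 / 2)) * (?b * \<sigma>) powr (- 1 - 2 * \<alpha>)) \<partial>lborel)
    = (\<integral>\<^sup>+\<sigma>. ennreal (?b powr (- 1 - 2 * \<alpha>)) * (ennreal ((1 - exp (- (\<sigma> * a)\<^sup>2 / 2)) * \<sigma> powr (- 1 - 2 * \<alpha>)) * indicator {0<..} \<sigma>) \<partial>lborel)"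
    by (intro nn_integral_cong) (auto simp: indicator_def powr_mult power_mult_distrib ennreal_mult[symmetric] mult_ac)
  also have "\<dots> = ennreal (?b powr (- 1 - 2 * \<alpha>)) * (\<integral>\<^sup>+\<sigma>\<in>{0<..}. ennreal ((1 - exp (- (\<sigma> * a)\<^sup>2 / 2)) * \<sigma> powr (- 1 - 2 * \<alpha>)) \<partial>lborel)"
    (is "_ = _ * ?I") by (rule nn_integral_cmult) measurable
  finally have "ennreal (?b powr (2 * \<alpha>)) * symbol_mass \<alpha> = ennreal (?b powr (2 * \<alpha>) * (?b * ?b powr (- 1 - 2 * \<alpha>))) * ?I"
    by (simp add: ennreal_mult mult.assoc)
  also have "?b powr (2 * \<alpha>) * (?b * ?b powr (- 1 - 2 * \<alpha>)) = 1"
  proof -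
    have "?b * ?b powr (- 1 - 2 * \<alpha>) = ?b powr (- 2 * \<alpha>)"
      using powr_add[of ?b 1 "- 1 - 2 * \<alpha>"] b by simp
    then show ?thesis using powr_add[of ?b "2 * \<alpha>" "- 2 * \<alpha>"] b by simp
  qed
  finally show ?thesis by simp
qed simp

text \<open>The normal density is homogeneous of degree \<open>-1\<close> jointly in width and
  argument, so a mixture with a power weight is again a power. At \<open>\<eta> = 0\<close> the left
  side is infinite while \<open>0 powr _ = 0\<close>, hence the exclusion.\<close>

lemma kernel_mass_scale:
  assumes "\<eta> \<noteq> 0"
  shows "(\<integral>\<^sup>+\<sigma>\<in>{0<..}. ennreal (normal_density 0 \<sigma> \<eta> * \<sigma> powr (- 1 - 2 * \<alpha>)) \<partial>lborel)
     = ennreal (\<bar>\<eta>\<bar> powr (- 1 - 2 * \<alpha>)) * kernel_mass \<alpha>"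
proof -
  let ?b = "\<bar>\<eta>\<bar>"
  have b: "?b > 0" using assms by simp
  have nd: "?b * normal_density 0 (?b * \<sigma>) \<eta> = normal_density 0 \<sigma> 1" if "\<sigma> > 0" for \<sigma>
    using that b assms by (simp add: normal_density_def power_mult_distrib real_sqrt_mult field_simps)
  have "(\<integral>\<^sup>+\<sigma>\<in>{0<..}. ennreal (normal_density 0 \<sigma> \<eta> * \<sigma> powr (- 1 - 2 * \<alpha>)) \<partial>lborel)
     = ennreal ?b * (\<integral>\<^sup>+\<sigma>\<in>{0<..}. ennreal (normal_density 0 (?b * \<sigma>) \<eta> * (?b * \<sigma>) powr (- 1 - 2 * \<alpha>)) \<partial>lborel)"
    by (rule nn_integral_half_line_scale[OF _ b]) (unfold normal_density_def, measurable)
  also have "\<dots> = (\<integral>\<^sup>+\<sigma>. ennreal ?b * (ennreal (normal_density 0 (?b * \<sigma>) \<eta> * (?b * \<sigma>) powr (- 1 - 2 * \<alpha>)) * indicator {0<..} \<sigma>) \<partial>lborel)"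
    by (rule nn_integral_cmult[symmetric]) (unfold normal_density_def, measurable)
  also have "\<dots> = (\<integral>\<^sup>+\<sigma>. ennreal (?b powr (- 1 - 2 * \<alpha>)) * (ennreal (normal_density 0 \<sigma> 1 * \<sigma> powr (- 1 - 2 * \<alpha>)) * indicator {0<..} \<sigma>) \<partial>lborel)"
    by (intro nn_integral_cong)
       (auto simp: indicator_def powr_mult ennreal_mult[symmetric] nd[symmetric] mult_ac)
  also have "\<dots> = ennreal (?b powr (- 1 - 2 * \<alpha>)) * kernel_mass \<alpha>"
    unfolding kernel_mass_def by (rule nn_integral_cmult) (unfold normal_density_def, measurable)
  finally show ?thesis .
qed

text \<open>Both bounds on \<open>\<alpha>\<close> enter here: near \<open>0\<close> the integrand
  is at most \<open>\<sigma> powr (1 - 2 * \<alpha>)\<close>, integrable as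
  \<open>\<alpha> < 1\<close>, and at infinity at most
  \<open>\<sigma> powr (- 1 - 2 * \<alpha>)\<close>, integrable as
  \<open>\<alpha> > 0\<close>.\<close>

lemma symbol_mass_finite:
  assumes "0 < \<alpha>" "\<alpha> < 1"
  shows "symbol_mass \<alpha> < \<infinity>"
proof -
  let ?u = "\<lambda>\<sigma>. \<sigma> powr (1 - 2 * \<alpha>)" and ?v = "\<lambda>\<sigma>::real. \<sigma> powr (- 1 - 2 * \<alpha>)"
  have ind: "ennreal (indicat_real A x * y) = ennreal y * indicator A x" for A :: "real set" and x y
    by (simp add: indicator_def)
  have u: "(\<integral>\<^sup>+\<sigma>. ennreal (?u \<sigma>) * indicator {0..1} \<sigma> \<partial>lborel) < \<infinity>"
    using nn_integral_has_integral_lebesgue[OF _ has_integral_powr_from_0[of "1 - 2 * \<alpha>" 1]] assms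
    by (simp add: nn_integral_completion ind)
  have v: "(\<integral>\<^sup>+\<sigma>. ennreal (?v \<sigma>) * indicator {1..} \<sigma> \<partial>lborel) < \<infinity>"
    using nn_integral_has_integral_lebesgue[OF _ has_integral_powr_to_inf[of "- 1 - 2 * \<alpha>" 1]] assms
    by (simp add: nn_integral_completion ind)
  have "symbol_mass \<alpha> \<le> (\<integral>\<^sup>+\<sigma>. ennreal (?u \<sigma>) * indicator {0..1} \<sigma> + ennreal (?v \<sigma>) * indicator {1..} \<sigma> \<partial>lborel)"
    unfolding symbol_mass_def
  proof (rule nn_integral_mono)
    fix \<sigma> :: real
    show "ennreal ((1 - exp (- \<sigma>\<^sup>2 / 2)) * ?v \<sigma>) * indicator {0<..} \<sigma> \<le> ennreal (?u \<sigma>) * indicator {0..1} \<sigma> + ennreal (?v \<sigma>) * indicator {1..} \<sigma>"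
    proof (cases "\<sigma> > 0")
      case True
      have "1 - exp (- \<sigma>\<^sup>2 / 2) \<le> \<sigma>\<^sup>2"
        using exp_ge_add_one_self[of "- \<sigma>\<^sup>2 / 2"] by (simp add: field_simps) (smt (verit) zero_le_power2)
      then have "(1 - exp (- \<sigma>\<^sup>2 / 2)) * ?v \<sigma> \<le> \<sigma>\<^sup>2 * ?v \<sigma>" by (intro mult_right_mono) auto
      also have "\<sigma>\<^sup>2 * ?v \<sigma> = ?u \<sigma>"
        using powr_add[of \<sigma> 2 "- 1 - 2 * \<alpha>"] True by simp
      finally have 1: "(1 - exp (- \<sigma>\<^sup>2 / 2)) * ?v \<sigma> \<le> ?u \<sigma>" .
      have 2: "(1 - exp (- \<sigma>\<^sup>2 / 2)) * ?v \<sigma> \<le> ?v \<sigma>"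
        by (intro mult_left_le_one_le) auto
      show ?thesis
      proof (cases "\<sigma> \<le> 1")
        case le: True
        have "ennreal ((1 - exp (- \<sigma>\<^sup>2 / 2)) * ?v \<sigma>) * indicator {0<..} \<sigma> \<le> ennreal (?u \<sigma>) * indicator {0..1} \<sigma>"
          using 1 True le by (simp add: ennreal_leI)
        then show ?thesis by (rule order_trans) simp
      next
        case False
        then show ?thesis using 2 True by (simp add: ennreal_leI)
      qed
    qed simp
  qed
  also have "\<dots> = (\<integral>\<^sup>+\<sigma>. ennreal (?u \<sigma>) * indicator {0..1} \<sigma> \<partial>lborel) + (\<integral>\<^sup>+\<sigma>. ennreal (?v \<sigma>) * indicator {1..} \<sigma> \<partial>lborel)"
    by (rule nn_integral_add) auto
  also have "\<dots> < \<infinity>" using u v by simp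
  finally show ?thesis .
qed

lemma symbol_mass_pos: "symbol_mass \<alpha> > 0"
proof (rule ccontr)
  assume "\<not> 0 < symbol_mass \<alpha>"
  then have "symbol_mass \<alpha> = 0" by (simp add: zero_less_iff_neq_zero)
  then have "AE \<sigma> in lborel. ennreal ((1 - exp (- \<sigma>\<^sup>2 / 2)) * \<sigma> powr (- 1 - 2 * \<alpha>)) * indicator {0<..} \<sigma> = 0"
    unfolding symbol_mass_def by (subst (asm) nn_integral_0_iff_AE) measurable
  then have "AE \<sigma> in lborel. \<not> \<sigma> \<in> {0<..<1::real}"
    by (rule AE_mp) (auto simp: indicator_def)
  then have "emeasure lborel {0<..<1::real} = 0"
    by (subst (asm) AE_iff_measurable[of "{0<..<1}"]) auto
  then show False by simp
qed

text \<open>\<open>1 - exp (- \<sigma>\<^sup>2 / 2)\<close> is the Gaussian average of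
  \<open>1 - cos \<eta>\<close>; Tonelli then performs the integration in \<open>\<sigma>\<close>
  first.\<close>

lemma symbol_mass_eq_kernel_mass:
  "symbol_mass \<alpha> = kernel_mass \<alpha> * (\<integral>\<^sup>+\<eta>. ennreal ((1 - cos \<eta>) * \<bar>\<eta>\<bar> powr (- 1 - 2 * \<alpha>)) \<partial>lborel)"
proof -
  let ?s = "\<lambda>\<sigma>::real. \<sigma> powr (- 1 - 2 * \<alpha>)"
  have avg: "ennreal (1 - exp (- \<sigma>\<^sup>2 / 2)) = (\<integral>\<^sup>+\<eta>. ennreal (normal_density 0 \<sigma> \<eta> * (1 - cos \<eta>)) \<partial>lborel)" if "\<sigma> > 0" for \<sigma>
  proof -
    have "(LINT \<eta>|lborel. normal_density 0 \<sigma> \<eta> * (1 - cos \<eta>)) = 1 - exp (- \<sigma>\<^sup>2 / 2)"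
      "integrable lborel (\<lambda>\<eta>. normal_density 0 \<sigma> \<eta> * (1 - cos \<eta>))"
      using normal_density_cos[OF that, of 1] that by (simp_all add: right_diff_distrib)
    then show ?thesis by (subst nn_integral_eq_integral) auto
  qed
  have "symbol_mass \<alpha> = (\<integral>\<^sup>+\<sigma>. \<integral>\<^sup>+\<eta>. ennreal (normal_density 0 \<sigma> \<eta> * ?s \<sigma>) * indicator {0<..} \<sigma> * ennreal (1 - cos \<eta>) \<partial>lborel \<partial>lborel)"
    unfolding symbol_mass_def
  proof (rule nn_integral_cong)
    fix \<sigma> :: real
    show "ennreal ((1 - exp (- \<sigma>\<^sup>2 / 2)) * ?s \<sigma>) * indicator {0<..} \<sigma>
       = (\<integral>\<^sup>+\<eta>. ennreal (normal_density 0 \<sigma> \<eta> * ?s \<sigma>) * indicator {0<..} \<sigma> * ennreal (1 - cos \<eta>) \<partial>lborel)"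
    proof (cases "\<sigma> > 0")
      case True
      have "ennreal ((1 - exp (- \<sigma>\<^sup>2 / 2)) * ?s \<sigma>) = ennreal (?s \<sigma>) * (\<integral>\<^sup>+\<eta>. ennreal (normal_density 0 \<sigma> \<eta> * (1 - cos \<eta>)) \<partial>lborel)"
        unfolding avg[OF True, symmetric] by (simp add: ennreal_mult mult.commute)
      also have "\<dots> = (\<integral>\<^sup>+\<eta>. ennreal (?s \<sigma>) * ennreal (normal_density 0 \<sigma> \<eta> * (1 - cos \<eta>)) \<partial>lborel)"
        by (rule nn_integral_cmult[symmetric]) measurable
      also have "\<dots> = (\<integral>\<^sup>+\<eta>. ennreal (normal_density 0 \<sigma> \<eta> * ?s \<sigma>) * indicator {0<..} \<sigma> * ennreal (1 - cos \<eta>) \<partial>lborel)"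
        using True by (intro nn_integral_cong) (auto simp: ennreal_mult[symmetric] mult_ac)
      finally show ?thesis using True by simp
    qed simp
  qed
  also have "\<dots> = (\<integral>\<^sup>+\<eta>. \<integral>\<^sup>+\<sigma>. ennreal (normal_density 0 \<sigma> \<eta> * ?s \<sigma>) * indicator {0<..} \<sigma> * ennreal (1 - cos \<eta>) \<partial>lborel \<partial>lborel)"
    by (rule lborel_pair.Fubini') (unfold normal_density_def, measurable)
  also have "\<dots> = (\<integral>\<^sup>+\<eta>. kernel_mass \<alpha> * ennreal ((1 - cos \<eta>) * \<bar>\<eta>\<bar> powr (- 1 - 2 * \<alpha>)) \<partial>lborel)"
  proof (rule nn_integral_cong)
    fix \<eta> :: real
    have "(\<integral>\<^sup>+\<sigma>. ennreal (normal_density 0 \<sigma> \<eta> * ?s \<sigma>) * indicator {0<..} \<sigma> * ennreal (1 - cos \<eta>) \<partial>lborel)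
       = (\<integral>\<^sup>+\<sigma>\<in>{0<..}. ennreal (normal_density 0 \<sigma> \<eta> * ?s \<sigma>) \<partial>lborel) * ennreal (1 - cos \<eta>)"
      by (rule nn_integral_multc) (unfold normal_density_def, measurable)
    also have "\<dots> = kernel_mass \<alpha> * ennreal ((1 - cos \<eta>) * \<bar>\<eta>\<bar> powr (- 1 - 2 * \<alpha>))"
    \<comment> \<open>The point excluded from \<open>kernel_mass_scale\<close> is harmless because
      \<open>1 - cos 0 = 0\<close>.\<close>
    proof (cases "\<eta> = 0")
      case False
      show ?thesis unfolding kernel_mass_scale[OF False] by (simp add: ennreal_mult mult_ac)
    qed simp
    finally show "(\<integral>\<^sup>+\<sigma>. ennreal (normal_density 0 \<sigma> \<eta> * ?s \<sigma>) * indicator {0<..} \<sigma> * ennreal (1 - cos \<eta>) \<partial>lborel)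
       = kernel_mass \<alpha> * ennreal ((1 - cos \<eta>) * \<bar>\<eta>\<bar> powr (- 1 - 2 * \<alpha>))" .
  qed
  also have "\<dots> = kernel_mass \<alpha> * (\<integral>\<^sup>+\<eta>. ennreal ((1 - cos \<eta>) * \<bar>\<eta>\<bar> powr (- 1 - 2 * \<alpha>)) \<partial>lborel)"
    by (rule nn_integral_cmult) measurable
  finally show ?thesis .
qed


text \<open>Formally the heat kernel has transform
  \<open>exp (- t * \<bar>\<kappa>\<bar> powr (2 * \<alpha>))\<close>, so its integral against
  \<open>1 - cos x\<close> is \<open>1 - exp (- t)\<close>, at most \<open>t\<close>. The Gaussian
  damping of width \<open>1 / e n\<close> makes this rigorous, and Fatou removes it again.\<close>

lemma heat_kernel_profile_cos_bound:
  assumes hk: "heat_kernel_constant \<alpha> c" and t: "t > 0"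
  shows "(\<integral>\<^sup>+x. ennreal (c * heat_kernel_profile \<alpha> t x * (1 - cos x)) \<partial>lborel) \<le> ennreal t"
proof -
  define e :: "nat \<Rightarrow> real" where "e n = 1 / real (Suc n)" for n
  have e0: "e n > 0" for n by (simp add: e_def)
  have elim: "e \<longlonglongrightarrow> 0" unfolding e_def by (rule LIMSEQ_Suc[OF lim_const_over_n])
  define k where "k = (\<lambda>\<kappa>. exp (- t * \<bar>\<kappa>\<bar> powr (2 * \<alpha>)))"
  have k_eq: "exp (- t * \<bar>\<kappa>\<bar> powr (2 * \<alpha>)) = k \<kappa>" for \<kappa> by (simp add: k_def)
  have k_meas [measurable]: "k \<in> borel_measurable borel" unfolding k_def by measurable
  have k_le: "k \<kappa> \<le> 1" and k_ge: "0 \<le> k \<kappa>" for \<kappa> using t by (simp_all add: k_def)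
  let ?g = "\<lambda>n x. exp (- (e n * x)\<^sup>2 / 2)"
  let ?J = "\<lambda>m n. LINT \<kappa>|lborel. k \<kappa> * normal_density m (e n) \<kappa>"
  let ?u = "\<lambda>n x. ennreal (c * heat_kernel_profile \<alpha> t x * ((1 - cos x) * ?g n x))"
  have [measurable]: "heat_kernel_profile \<alpha> t \<in> borel_measurable borel"
    unfolding heat_kernel_profile_def[abs_def] by measurable
  have J: "?J m \<longlonglongrightarrow> exp (- t)" if "\<bar>m\<bar> = 1" for m
  proof -
    have "isCont k m" unfolding k_def using that by (intro continuous_intros) auto
    then have "?J m \<longlonglongrightarrow> k m"
      using k_le k_ge by (intro normal_density_average_tendsto e0 elim k_meas) auto
    then show ?thesis using that by (simp add: k_def)
  qed
  have le: "integral\<^sup>N lborel (?u n) \<le> ennreal (1 - (?J 1 n + ?J (- 1) n) / 2)" for n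
  proof -
    note P = frac_heat_kernel_gaussian_pairing[OF hk t e0[of n], unfolded k_eq]
    have int: "integrable lborel (\<lambda>x. frac_heat_kernel \<alpha> t x * ((1 - cos x) * ?g n x))"
      using Bochner_Integration.integrable_diff[OF P(1)[of 0] P(1)[of 1]] by (simp add: algebra_simps)
    have "?u n x \<le> ennreal (frac_heat_kernel \<alpha> t x * ((1 - cos x) * ?g n x))" for x
      using hk t by (intro ennreal_leI mult_right_mono) (auto simp: heat_kernel_constant_def)
    then have "integral\<^sup>N lborel (?u n) \<le> (\<integral>\<^sup>+x. ennreal (frac_heat_kernel \<alpha> t x * ((1 - cos x) * ?g n x)) \<partial>lborel)"
      by (rule nn_integral_mono)
    also have "\<dots> = ennreal (LINT x|lborel. frac_heat_kernel \<alpha> t x * ((1 - cos x) * ?g n x))"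
    proof (rule nn_integral_eq_integral[OF int], rule AE_I2)
      fix x
      have "0 \<le> c * heat_kernel_profile \<alpha> t x" using hk t
        by (auto simp: heat_kernel_constant_def heat_kernel_profile_def)
      also have "\<dots> \<le> frac_heat_kernel \<alpha> t x" using hk t by (auto simp: heat_kernel_constant_def)
      finally show "0 \<le> frac_heat_kernel \<alpha> t x * ((1 - cos x) * ?g n x)" by simp
    qed
    also have "(LINT x|lborel. frac_heat_kernel \<alpha> t x * ((1 - cos x) * ?g n x)) = ?J 0 n - (?J 1 n + ?J (- 1) n) / 2"
    proof -
      have "(LINT x|lborel. frac_heat_kernel \<alpha> t x * ((1 - cos x) * ?g n x))
         = (LINT x|lborel. frac_heat_kernel \<alpha> t x * (?g n x * cos (0 * x)) - frac_heat_kernel \<alpha> t x * (?g n x * cos (1 * x)))"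
        by (intro Bochner_Integration.integral_cong refl) (simp add: algebra_simps)
      also have "\<dots> = ?J 0 n - (?J 1 n + ?J (- 1) n) / 2"
        unfolding Bochner_Integration.integral_diff[OF P(1) P(1)] P(2) by simp
      finally show ?thesis .
    qed
    \<comment> \<open>Only an upper bound is sought, so at frequency \<open>0\<close> the estimate
      \<open>k \<le> 1\<close> replaces a limit; at the frequencies \<open>1\<close> and
      \<open>-1\<close> the limit \<open>J\<close> is taken.\<close>
    also have "?J 0 n \<le> (LINT \<kappa>|lborel. normal_density 0 (e n) \<kappa>)"
    proof (rule integral_mono)
      show "integrable lborel (\<lambda>\<kappa>. k \<kappa> * normal_density 0 (e n) \<kappa>)"
        by (rule Bochner_Integration.integrable_bound[OF integrable_normal_density[OF e0[of n], of 0]])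
           (use k_le k_ge in \<open>auto simp: abs_mult intro!: mult_left_le_one_le\<close>)
    qed (use k_le k_ge e0 in \<open>auto intro!: mult_left_le_one_le\<close>)
    finally show ?thesis using e0[of n] by (simp add: ennreal_leI)
  qed
  have "(\<integral>\<^sup>+x. ennreal (c * heat_kernel_profile \<alpha> t x * (1 - cos x)) \<partial>lborel) = (\<integral>\<^sup>+x. liminf (\<lambda>n. ?u n x) \<partial>lborel)"
  proof (rule nn_integral_cong)
    fix x
    have "(\<lambda>n. ?u n x) \<longlonglongrightarrow> ennreal (c * heat_kernel_profile \<alpha> t x * ((1 - cos x) * exp (- (0 * x)\<^sup>2 / 2)))"
      by (intro tendsto_intros tendsto_ennrealI elim) auto
    from lim_imp_Liminf[OF _ this]
    show "ennreal (c * heat_kernel_profile \<alpha> t x * (1 - cos x)) = liminf (\<lambda>n. ?u n x)" by simp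
  qed
  also have "\<dots> \<le> liminf (\<lambda>n. integral\<^sup>N lborel (?u n))"
    by (rule nn_integral_liminf) measurable
  also have "\<dots> \<le> liminf (\<lambda>n. ennreal (1 - (?J 1 n + ?J (- 1) n) / 2))"
    using le by (intro Liminf_mono) auto
  also have "\<dots> = ennreal (1 - (exp (- t) + exp (- t)) / 2)"
    by (intro lim_imp_Liminf tendsto_ennrealI tendsto_intros J) auto
  also have "\<dots> \<le> ennreal t"
    using exp_ge_add_one_self[of "- t"] by (intro ennreal_leI) simp
  finally show ?thesis .
qed

text \<open>Divided by \<open>t\<close>, the profile tends to the power law as \<open>t\<close>
  tends to \<open>0\<close>, and Fatou carries the bound to the limit.\<close>

lemma heat_kernel_constant_cos_bound:
  assumes \<alpha>: "0 < \<alpha>" and hk: "heat_kernel_constant \<alpha> c"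
  shows "ennreal c * (\<integral>\<^sup>+x. ennreal ((1 - cos x) * \<bar>x\<bar> powr (- 1 - 2 * \<alpha>)) \<partial>lborel) \<le> 1"
proof -
  have c: "c > 0" using hk by (simp add: heat_kernel_constant_def)
  define t :: "nat \<Rightarrow> real" where "t n = 1 / real (Suc n)" for n
  have t0: "t n > 0" for n by (simp add: t_def)
  have t1: "t n \<le> 1" for n by (simp add: t_def)
  let ?u = "\<lambda>n x. ennreal (1 / t n) * ennreal (c * heat_kernel_profile \<alpha> (t n) x * (1 - cos x))"
  have [measurable]: "heat_kernel_profile \<alpha> s \<in> borel_measurable borel" for s
    unfolding heat_kernel_profile_def[abs_def] by measurable
  have le: "integral\<^sup>N lborel (?u n) \<le> 1" for n
  proof -
    have "integral\<^sup>N lborel (?u n) = ennreal (1 / t n) * (\<integral>\<^sup>+x. ennreal (c * heat_kernel_profile \<alpha> (t n) x * (1 - cos x)) \<partial>lborel)"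
      by (rule nn_integral_cmult) measurable
    also have "\<dots> \<le> ennreal (1 / t n) * ennreal (t n)"
      by (intro mult_left_mono heat_kernel_profile_cos_bound[OF hk t0]) auto
    also have "\<dots> = 1" using t0[of n] by (simp add: ennreal_mult[symmetric])
    finally show ?thesis .
  qed
  have ev: "liminf (\<lambda>n. ?u n x) = ennreal c * ennreal ((1 - cos x) * \<bar>x\<bar> powr (- 1 - 2 * \<alpha>))" for x
  proof (cases "x = 0")
    case False
    have "filterlim (\<lambda>n. real (Suc n) powr (1 / (2 * \<alpha>))) at_top sequentially"
      using \<alpha> by (intro filterlim_compose[OF real_powr_at_top] filterlim_compose[OF filterlim_real_sequentially] filterlim_Suc) auto
    then have "\<forall>\<^sub>F n in sequentially. \<bar>x\<bar> powr (- 1 - 2 * \<alpha>) \<le> real (Suc n) powr (1 / (2 * \<alpha>))"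
      by (simp add: filterlim_at_top)
    \<comment> \<open>For fixed \<open>x \<noteq> 0\<close> the minimum in the profile is eventually
      its second argument, so the factor \<open>t n\<close> cancels and the sequence is eventually
      constant.\<close>
    then have "\<forall>\<^sub>F n in sequentially. ?u n x = ennreal c * ennreal ((1 - cos x) * \<bar>x\<bar> powr (- 1 - 2 * \<alpha>))"
    proof eventually_elim
      case (elim n)
      have "t n * \<bar>x\<bar> powr (- 1 - 2 * \<alpha>) \<le> 1 * \<bar>x\<bar> powr (- 1 - 2 * \<alpha>)"
        using t1 by (intro mult_right_mono) auto
      also have "\<dots> \<le> real (Suc n) powr (1 / (2 * \<alpha>))" using elim by simp
      also have "\<dots> = t n powr (- 1 / (2 * \<alpha>))"
        by (simp add: t_def powr_minus powr_divide)
      finally have "heat_kernel_profile \<alpha> (t n) x = t n * \<bar>x\<bar> powr (- 1 - 2 * \<alpha>)"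
        using False by (simp add: heat_kernel_profile_def)
      then show ?case using t0[of n] c by (simp add: ennreal_mult[symmetric] mult_ac)
    qed
    then have "(\<lambda>n. ?u n x) \<longlonglongrightarrow> ennreal c * ennreal ((1 - cos x) * \<bar>x\<bar> powr (- 1 - 2 * \<alpha>))"
      by (rule tendsto_eventually)
    then show ?thesis by (rule lim_imp_Liminf[rotated]) simp
  qed (simp add: Liminf_const)
  have "ennreal c * (\<integral>\<^sup>+x. ennreal ((1 - cos x) * \<bar>x\<bar> powr (- 1 - 2 * \<alpha>)) \<partial>lborel) = (\<integral>\<^sup>+x. liminf (\<lambda>n. ?u n x) \<partial>lborel)"
    unfolding ev by (rule nn_integral_cmult[symmetric]) measurable
  also have "\<dots> \<le> liminf (\<lambda>n. integral\<^sup>N lborel (?u n))"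
    by (rule nn_integral_liminf) measurable
  also have "\<dots> \<le> liminf (\<lambda>n. 1)"
    using le by (intro Liminf_mono) auto
  also have "\<dots> = 1" by (simp add: Liminf_const)
  finally show ?thesis .
qed

lemma heat_kernel_constant_le:
  assumes "0 < \<alpha>" "heat_kernel_constant \<alpha> c"
  shows "ennreal c * symbol_mass \<alpha> \<le> kernel_mass \<alpha>"
  using mult_left_mono[OF heat_kernel_constant_cos_bound[OF assms], of "kernel_mass \<alpha>"]
  unfolding symbol_mass_eq_kernel_mass by (simp add: mult_ac)

section \<open>The one-dimensional reflection estimate\<close>

text \<open>The factor \<open>2\<close> is there because \<open>s\<close> and \<open>- s\<close> are
  at distance \<open>2 * s\<close>. The form with \<open>max\<close> evaluates \<open>w\<close> only
  at nonnegative points, the only ones where a modulus is constrained; one of the two terms is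
  always \<open>w 0 = 0\<close>.\<close>

definition odd_modulus :: "(real \<Rightarrow> real) \<Rightarrow> real \<Rightarrow> real" where
  "odd_modulus w s = w (2 * max s 0) - w (2 * max (- s) 0)"

text \<open>The negated second difference of \<open>odd_modulus w\<close> about
  \<open>\<xi> / 2\<close>, where its value is \<open>w \<xi>\<close>. One formula covers the
  numerators of both dissipation integrands.\<close>

definition modulus_gap :: "(real \<Rightarrow> real) \<Rightarrow> real \<Rightarrow> real \<Rightarrow> real" where
  "modulus_gap w \<xi> \<eta> = 2 * w \<xi> - odd_modulus w (\<xi> / 2 + \<eta>) - odd_modulus w (\<xi> / 2 - \<eta>)"

lemma odd_modulus_minus: "odd_modulus w (- s) = - odd_modulus w s"
  by (simp add: odd_modulus_def)

lemma odd_modulus_nonneg_arg: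
  "modulus_of_continuity w \<Longrightarrow> s \<ge> 0 \<Longrightarrow> odd_modulus w s = w (2 * s)"
  by (simp add: odd_modulus_def modulus_of_continuity_def)

lemma modulus_gap_minus: "modulus_gap w \<xi> (- \<eta>) = modulus_gap w \<xi> \<eta>"
  by (simp add: modulus_gap_def)

lemma continuous_odd_modulus:
  assumes "modulus_of_continuity w"
  shows "continuous_on UNIV (odd_modulus w)"
proof -
  have c: "continuous_on {0..} w" using assms by (simp add: modulus_of_continuity_def)
  show ?thesis unfolding odd_modulus_def[abs_def]
    by (intro continuous_intros continuous_on_compose2[OF c]) auto
qed

lemma borel_measurable_odd_modulus:
  "modulus_of_continuity w \<Longrightarrow> odd_modulus w \<in> borel_measurable borel"
  by (intro borel_measurable_continuous_onI continuous_odd_modulus)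

text \<open>For \<open>u > 1\<close> the point \<open>1\<close> lies between \<open>0\<close> and
  \<open>u\<close>, so concavity and \<open>w 0 = 0\<close> give \<open>w u / u \<le> w 1\<close>.
  Linear growth is what makes Gaussian averages of the modulus finite.\<close>

lemma modulus_linear_bound:
  assumes w: "modulus_of_continuity w" and u: "u \<ge> 0"
  shows "w u \<le> w 1 * (1 + u)"
proof (cases "u \<le> 1")
  case True
  have "w u \<le> w 1" using w u True by (auto simp: modulus_of_continuity_def mono_on_def)
  moreover have "w 1 * 1 \<le> w 1 * (1 + u)" using w u by (intro mult_left_mono) (auto simp: modulus_of_continuity_def)
  ultimately show ?thesis by simp
next
  case False
  have "concave_on {0..} w" using w by (simp add: modulus_of_continuity_def)
  moreover have "u \<in> {0..}" "0 \<in> {0::real..}" "0 \<le> 1 / u" "0 \<le> 1 - 1 / u" "1 / u + (1 - 1 / u) = 1" using False by auto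
  ultimately have "(1 / u) * w u + (1 - 1 / u) * w 0 \<le> w ((1 / u) *\<^sub>R u + (1 - 1 / u) *\<^sub>R 0)"
    unfolding concave_on_iff by blast
  then have "w u / u \<le> w 1" using w False by (simp add: modulus_of_continuity_def)
  then have "w u \<le> w 1 * u" using False by (simp add: field_simps)
  moreover have "w 1 \<ge> 0" using w by (simp add: modulus_of_continuity_def)
  ultimately show ?thesis by (simp add: algebra_simps)
qed

lemma odd_modulus_linear_bound:
  assumes w: "modulus_of_continuity w"
  shows "\<bar>odd_modulus w s\<bar> \<le> w 1 * (1 + 2 * \<bar>s\<bar>)"
proof -
  have *: "\<bar>odd_modulus w s\<bar> \<le> w 1 * (1 + 2 * \<bar>s\<bar>)" if "s \<ge> 0" for s
    using modulus_linear_bound[OF w, of "2 * s"] that w odd_modulus_nonneg_arg[OF w that]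
    by (simp add: modulus_of_continuity_def)
  show ?thesis using *[of s] *[of "- s"] by (cases "s \<ge> 0") (auto simp: odd_modulus_minus)
qed

lemma modulus_gap_near:
  assumes w: "modulus_of_continuity w" and "0 < \<eta>" "\<eta> < \<xi> / 2"
  shows "- dissip_near \<alpha> w \<xi> \<eta> = modulus_gap w \<xi> \<eta> * \<bar>\<eta>\<bar> powr (- 1 - 2 * \<alpha>)"
proof -
  have "modulus_gap w \<xi> \<eta> = - (w (\<xi> + 2 * \<eta>) + w (\<xi> - 2 * \<eta>) - 2 * w \<xi>)"
    using assms by (simp add: modulus_gap_def odd_modulus_nonneg_arg algebra_simps)
  moreover have "\<bar>\<eta>\<bar> powr (- 1 - 2 * \<alpha>) = 1 / \<eta> powr (1 + 2 * \<alpha>)"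
    using assms powr_minus_divide[of \<eta> "1 + 2 * \<alpha>"] by simp
  ultimately show ?thesis unfolding dissip_near_def by (simp add: minus_divide_left)
qed

lemma modulus_gap_far:
  assumes w: "modulus_of_continuity w" and "0 < \<xi>" "\<xi> / 2 < \<eta>"
  shows "- dissip_far \<alpha> w \<xi> \<eta> = modulus_gap w \<xi> \<eta> * \<bar>\<eta>\<bar> powr (- 1 - 2 * \<alpha>)"
proof -
  have "odd_modulus w (\<xi> / 2 - \<eta>) = - w (2 * \<eta> - \<xi>)"
    using odd_modulus_minus[of w "\<eta> - \<xi> / 2"] odd_modulus_nonneg_arg[OF w, of "\<eta> - \<xi> / 2"] assms
    by (simp add: algebra_simps)
  then have "modulus_gap w \<xi> \<eta> = - (w (2 * \<eta> + \<xi>) - w (2 * \<eta> - \<xi>) - 2 * w \<xi>)"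
    using assms by (simp add: modulus_gap_def odd_modulus_nonneg_arg algebra_simps)
  moreover have "\<bar>\<eta>\<bar> powr (- 1 - 2 * \<alpha>) = 1 / \<eta> powr (1 + 2 * \<alpha>)"
    using assms powr_minus_divide[of \<eta> "1 + 2 * \<alpha>"] by simp
  ultimately show ?thesis unfolding dissip_far_def by (simp add: minus_divide_left)
qed

lemma modulus_gap_nonneg:
  assumes w: "modulus_of_continuity w" and \<xi>: "0 < \<xi>"
  shows "modulus_gap w \<xi> \<eta> \<ge> 0"
proof -
  have *: "modulus_gap w \<xi> \<eta> \<ge> 0" if "\<eta> > 0" for \<eta>
  proof -
    consider "\<eta> < \<xi> / 2" | "\<eta> = \<xi> / 2" | "\<xi> / 2 < \<eta>" by linarith
    then show ?thesis
    proof cases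
      case 1
      \<comment> \<open>With \<open>- 1 / 2\<close> for \<open>\<alpha>\<close> the weight has
        exponent \<open>0\<close> and equals \<open>1\<close>, so the sign of the integrand is the
        sign of the gap itself.\<close>
      then show ?thesis using dissip_near_nonpos[OF w that, of \<xi> "- 1 / 2"] modulus_gap_near[OF w that, of \<xi> "- 1 / 2"] that
        by simp
    next
      case 2
      \<comment> \<open>At the junction neither integrand applies; the gap is
        \<open>2 * w \<xi> - w (2 * \<xi>)\<close>, nonnegative by subadditivity.\<close>
      then have eq: "\<xi> / 2 - \<eta> = 0" "\<xi> / 2 + \<eta> = \<xi>" by auto
      show ?thesis
        using modulus_of_continuity_subadd[OF w \<xi> \<xi>] odd_modulus_nonneg_arg[OF w, of \<xi>] \<xi>
        unfolding modulus_gap_def eq by (simp add: odd_modulus_def[of w 0])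
    next
      case 3
      then show ?thesis using dissip_far_nonpos[OF w \<xi>, of \<eta> "- 1 / 2"] modulus_gap_far[OF w \<xi>, of \<eta> "- 1 / 2"] that
        by simp
    qed
  qed
  consider "\<eta> > 0" | "\<eta> = 0" | "\<eta> < 0" by linarith
  then show ?thesis
  proof cases
    case 2
    then show ?thesis using odd_modulus_nonneg_arg[OF w, of "\<xi> / 2"] \<xi> by (simp add: modulus_gap_def)
  next
    case 3
    then show ?thesis using *[of "- \<eta>"] by (simp add: modulus_gap_minus)
  qed (rule *)
qed

text \<open>The gap is even in \<open>\<eta>\<close>, so half of it over the line is all of it over
  the half line, where the two integrands cover everything except one point.\<close>

lemma dissipation_integrals_le:
  assumes w: "modulus_of_continuity w" and \<xi>: "0 < \<xi>"
  shows "(\<integral>\<^sup>+\<eta>\<in>{0<..<\<xi>/2}. ennreal (- dissip_near \<alpha> w \<xi> \<eta>) \<partial>lborel) + (\<integral>\<^sup>+\<eta>\<in>{\<xi>/2<..}. ennreal (- dissip_far \<alpha> w \<xi> \<eta>) \<partial>lborel)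
    \<le> (\<integral>\<^sup>+\<eta>. ennreal (modulus_gap w \<xi> \<eta> / 2 * \<bar>\<eta>\<bar> powr (- 1 - 2 * \<alpha>)) \<partial>lborel)"
proof -
  let ?p = "\<lambda>\<eta>. \<bar>\<eta>\<bar> powr (- 1 - 2 * \<alpha>)"
  let ?G = "\<lambda>\<eta>. ennreal (modulus_gap w \<xi> \<eta> / 2 * ?p \<eta>)"
  let ?H = "\<lambda>\<eta>. ennreal (modulus_gap w \<xi> \<eta> * ?p \<eta>)"
  note [measurable] = borel_measurable_odd_modulus[OF w]
  have [measurable]: "modulus_gap w \<xi> \<in> borel_measurable borel"
    unfolding modulus_gap_def[abs_def] by measurable
  have "(\<integral>\<^sup>+\<eta>\<in>{0<..<\<xi>/2}. ennreal (- dissip_near \<alpha> w \<xi> \<eta>) \<partial>lborel) = (\<integral>\<^sup>+\<eta>\<in>{0<..<\<xi>/2}. ?H \<eta> \<partial>lborel)"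
    by (intro nn_integral_cong) (auto simp: indicator_def modulus_gap_near[OF w])
  moreover have "(\<integral>\<^sup>+\<eta>\<in>{\<xi>/2<..}. ennreal (- dissip_far \<alpha> w \<xi> \<eta>) \<partial>lborel) = (\<integral>\<^sup>+\<eta>\<in>{\<xi>/2<..}. ?H \<eta> \<partial>lborel)"
    by (intro nn_integral_cong) (auto simp: indicator_def modulus_gap_far[OF w \<xi>])
  moreover have "(\<integral>\<^sup>+\<eta>\<in>{0<..<\<xi>/2}. ?H \<eta> \<partial>lborel) + (\<integral>\<^sup>+\<eta>\<in>{\<xi>/2<..}. ?H \<eta> \<partial>lborel)
     = (\<integral>\<^sup>+\<eta>. ?H \<eta> * indicator {0<..<\<xi>/2} \<eta> + ?H \<eta> * indicator {\<xi>/2<..} \<eta> \<partial>lborel)"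
    by (rule nn_integral_add[symmetric]) measurable
  moreover have "\<dots> \<le> (\<integral>\<^sup>+\<eta>. ?G \<eta> * indicator {0<..} \<eta> + ?G \<eta> * indicator {0<..} \<eta> \<partial>lborel)"
    using \<xi> modulus_gap_nonneg[OF w \<xi>] by (intro nn_integral_mono) (auto simp: indicator_def ennreal_plus[symmetric] simp del: ennreal_plus)
  moreover have "\<dots> = (\<integral>\<^sup>+\<eta>\<in>{0<..}. ?G \<eta> \<partial>lborel) + (\<integral>\<^sup>+\<eta>\<in>{0<..}. ?G \<eta> \<partial>lborel)"
    by (rule nn_integral_add) measurable
  moreover have "(\<integral>\<^sup>+\<eta>\<in>{..<0}. ?G \<eta> \<partial>lborel) = (\<integral>\<^sup>+\<eta>\<in>{0<..}. ?G \<eta> \<partial>lborel)"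
    using nn_integral_real_affine[of "\<lambda>\<eta>. ?G \<eta> * indicator {..<0} \<eta>" "- 1" 0]
    by (simp add: modulus_gap_minus indicator_def)
  moreover have "(\<integral>\<^sup>+\<eta>\<in>{0<..}. ?G \<eta> \<partial>lborel) + (\<integral>\<^sup>+\<eta>\<in>{..<0}. ?G \<eta> \<partial>lborel)
     = (\<integral>\<^sup>+\<eta>. ?G \<eta> * indicator {0<..} \<eta> + ?G \<eta> * indicator {..<0} \<eta> \<partial>lborel)"
    by (rule nn_integral_add[symmetric]) measurable
  moreover have "\<dots> \<le> (\<integral>\<^sup>+\<eta>. ?G \<eta> \<partial>lborel)"
    by (intro nn_integral_mono) (auto simp: indicator_def)
  ultimately show ?thesis by simp
qed

text \<open>Reflection: for odd \<open>D\<close> the Gaussian centred at \<open>b > 0\<close> sees \<open>D\<close> through the odd weight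
  \<open>g (s - b) - g (s + b)\<close>, which is nonnegative for \<open>s \<ge> 0\<close>.\<close>

lemma normal_average_odd_nonneg:
  fixes D :: "real \<Rightarrow> real"
  assumes \<sigma>: "\<sigma> > 0" and b: "b \<ge> 0" and odd: "\<And>s. D (- s) = - D s" and pos: "\<And>s. s \<ge> 0 \<Longrightarrow> D s \<ge> 0"
    and int: "integrable lborel (\<lambda>\<eta>. normal_density 0 \<sigma> \<eta> * D (b + \<eta>))"
  shows "(LINT \<eta>|lborel. normal_density 0 \<sigma> \<eta> * D (b + \<eta>)) \<ge> 0"
proof -
  let ?g = "normal_density 0 \<sigma>"
  let ?f = "\<lambda>\<eta>. ?g \<eta> * D (b + \<eta>)"
  have gm: "?g (- s) = ?g s" for s by (simp add: normal_density_def)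
  have i1: "integrable lborel (\<lambda>s. ?g (s - b) * D s)"
    using lborel_integrable_real_affine[OF int, of 1 "- b"] by simp
  have e1: "integral\<^sup>L lborel ?f = (LINT s|lborel. ?g (s - b) * D s)"
    using lborel_integral_real_affine[of 1 ?f "- b"] by simp
  have eq: "?f (- b + - 1 * s) = - (?g (s + b) * D s)" for s
    using gm[of "s + b"] odd[of s] by (simp add: add.commute)
  have i2: "integrable lborel (\<lambda>s. ?g (s + b) * D s)"
    using lborel_integrable_real_affine[OF int, of "- 1" "- b"] unfolding eq by simp
  have e2: "integral\<^sup>L lborel ?f = - (LINT s|lborel. ?g (s + b) * D s)"
    using lborel_integral_real_affine[of "- 1" ?f "- b"] unfolding eq by simp
  \<comment> \<open>By \<open>e1\<close> and \<open>e2\<close> this integral is twice the average.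
    Its integrand is even, as a product of two odd functions, so the sign for
    \<open>s \<ge> 0\<close> decides.\<close>
  have "0 \<le> (LINT s|lborel. ?g (s - b) * D s - ?g (s + b) * D s)"
  proof (rule integral_nonneg_AE, rule AE_I2)
    fix s
    have mono: "?g (s + b) \<le> ?g (s - b)" if "s \<ge> 0" for s
      using that b \<sigma> by (auto simp: normal_density_def power2_eq_square algebra_simps intro!: divide_right_mono)
    have *: "0 \<le> (?g (s - b) - ?g (s + b)) * D s" if "s \<ge> 0" for s
      using mono[OF that] pos[OF that] by simp
    have "0 \<le> (?g (s - b) - ?g (s + b)) * D s"
      using *[of s] *[of "- s"] gm[of "s - b"] gm[of "- s - b"] odd[of s]
      by (cases "s \<ge> 0") (auto simp: algebra_simps)
    then show "0 \<le> ?g (s - b) * D s - ?g (s + b) * D s" by (simp add: algebra_simps)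
  qed
  then show ?thesis using e1 e2 i1 i2 by simp
qed

text \<open>The odd part \<open>u s = h s - h (- s)\<close> lies below \<open>odd_modulus w\<close>
  for \<open>s \<ge> 0\<close>, and the Gaussian averages of \<open>h\<close> at the two points
  differ by the average of \<open>u\<close> at \<open>\<xi> / 2\<close>. The reflection lemma
  applied to \<open>odd_modulus w - u\<close> compares the two averages.\<close>

lemma normal_average_modulus_gap:
  fixes h :: "real \<Rightarrow> real"
  assumes w: "modulus_of_continuity w" and \<xi>: "0 < \<xi>" and \<sigma>: "0 < \<sigma>"
    and hm [measurable]: "h \<in> borel_measurable borel" and bd: "\<And>s. \<bar>h s\<bar> \<le> C"
    and mod: "\<And>a b. h a - h b \<le> w \<bar>a - b\<bar>"
  shows "(\<integral>\<^sup>+\<eta>. ennreal (normal_density 0 \<sigma> \<eta> * (modulus_gap w \<xi> \<eta> / 2)) \<partial>lborel)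
    \<le> ennreal (w \<xi> - ((LINT \<eta>|lborel. normal_density 0 \<sigma> \<eta> * h (\<xi> / 2 + \<eta>)) - (LINT \<eta>|lborel. normal_density 0 \<sigma> \<eta> * h (- \<xi> / 2 + \<eta>))))"
proof -
  let ?g = "normal_density 0 \<sigma>"
  let ?W = "odd_modulus w"
  let ?b = "\<xi> / 2"
  note [measurable] = borel_measurable_odd_modulus[OF w]
  have gm: "?g (- s) = ?g s" for s by (simp add: normal_density_def)
  \<comment> \<open>\<open>?W\<close> grows at most linearly, so the mass and the first absolute
    moment of the Gaussian provide a majorant.\<close>
  have Wi: "integrable lborel (\<lambda>\<eta>. ?g \<eta> * ?W (b + \<eta>))" for b
  proof (rule Bochner_Integration.integrable_bound)
    show "integrable lborel (\<lambda>\<eta>. w 1 * (1 + 2 * \<bar>b\<bar>) * ?g \<eta> + 2 * w 1 * (?g \<eta> * \<bar>\<eta> - 0\<bar> ^ 1))"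
      using \<sigma> integrable_normal_moment_abs[OF \<sigma>, of 0 1] by simp
    have "\<bar>?g \<eta> * ?W (b + \<eta>)\<bar> \<le> \<bar>w 1 * (1 + 2 * \<bar>b\<bar>) * ?g \<eta> + 2 * w 1 * (?g \<eta> * \<bar>\<eta>\<bar>)\<bar>" for \<eta>
    proof -
      have w1: "w 1 \<ge> 0" using w by (simp add: modulus_of_continuity_def)
      have "\<bar>?W (b + \<eta>)\<bar> \<le> w 1 * (1 + 2 * \<bar>b + \<eta>\<bar>)" by (rule odd_modulus_linear_bound[OF w])
      also have "\<dots> \<le> w 1 * (1 + 2 * \<bar>b\<bar> + 2 * \<bar>\<eta>\<bar>)" using w1 abs_triangle_ineq[of b \<eta>] by (intro mult_left_mono) auto
      finally have "?g \<eta> * \<bar>?W (b + \<eta>)\<bar> \<le> ?g \<eta> * (w 1 * (1 + 2 * \<bar>b\<bar> + 2 * \<bar>\<eta>\<bar>))" by (intro mult_left_mono) auto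
      also have "\<dots> = w 1 * (1 + 2 * \<bar>b\<bar>) * ?g \<eta> + 2 * w 1 * (?g \<eta> * \<bar>\<eta>\<bar>)" by (simp add: algebra_simps)
      finally show ?thesis by (simp add: abs_mult)
    qed
    then show "AE \<eta> in lborel. norm (?g \<eta> * ?W (b + \<eta>)) \<le> norm (w 1 * (1 + 2 * \<bar>b\<bar>) * ?g \<eta> + 2 * w 1 * (?g \<eta> * \<bar>\<eta> - 0\<bar> ^ 1))"
      by simp
  qed measurable
  have hi: "integrable lborel (\<lambda>\<eta>. ?g \<eta> * h (f \<eta>))" if [measurable]: "f \<in> borel_measurable borel" for f
  proof (rule Bochner_Integration.integrable_bound[OF integrable_mult_right[of C, OF integrable_normal_density[OF \<sigma>, of 0]]])
    show "AE x in lborel. norm (?g x * h (f x)) \<le> norm (C * ?g x)"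
    proof (rule AE_I2)
      fix x
      have "\<bar>h (f x)\<bar> * ?g x \<le> C * ?g x" using bd by (intro mult_right_mono) auto
      also have "\<dots> \<le> \<bar>C * ?g x\<bar>" by simp
      finally show "norm (?g x * h (f x)) \<le> norm (C * ?g x)" by (simp add: abs_mult mult.commute)
    qed
  qed measurable
  define u where "u s = h s - h (- s)" for s
  have uW: "u s \<le> ?W s" if "s \<ge> 0" for s
    using mod[of s "- s"] that by (simp add: u_def odd_modulus_nonneg_arg[OF w])
  have ui: "integrable lborel (\<lambda>\<eta>. ?g \<eta> * u (?b + \<eta>))"
    using hi[of "\<lambda>\<eta>. ?b + \<eta>"] hi[of "\<lambda>\<eta>. - (?b + \<eta>)"] by (simp add: u_def right_diff_distrib)
  have "0 \<le> (LINT \<eta>|lborel. ?g \<eta> * (?W (?b + \<eta>) - u (?b + \<eta>)))"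
    by (rule normal_average_odd_nonneg[OF \<sigma>, where D = "\<lambda>s. ?W s - u s"])
       (use \<xi> uW Wi[of ?b] ui in \<open>auto simp: odd_modulus_minus u_def right_diff_distrib\<close>)
  also have "\<dots> = (LINT \<eta>|lborel. ?g \<eta> * ?W (?b + \<eta>)) - (LINT \<eta>|lborel. ?g \<eta> * u (?b + \<eta>))"
    using Wi[of ?b] ui by (simp add: right_diff_distrib)
  also have "(LINT \<eta>|lborel. ?g \<eta> * u (?b + \<eta>)) = (LINT \<eta>|lborel. ?g \<eta> * h (?b + \<eta>)) - (LINT \<eta>|lborel. ?g \<eta> * h (- (?b + \<eta>)))"
    using hi[of "\<lambda>\<eta>. ?b + \<eta>"] hi[of "\<lambda>\<eta>. - (?b + \<eta>)"] by (simp add: u_def right_diff_distrib)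
  also have "(LINT \<eta>|lborel. ?g \<eta> * h (- (?b + \<eta>))) = (LINT \<eta>|lborel. ?g \<eta> * h (- ?b + \<eta>))"
    using lborel_integral_real_affine[of "- 1" "\<lambda>\<eta>. ?g \<eta> * h (- (?b + \<eta>))" 0] by (simp add: gm)
  finally have key: "(LINT \<eta>|lborel. ?g \<eta> * h (?b + \<eta>)) - (LINT \<eta>|lborel. ?g \<eta> * h (- ?b + \<eta>)) \<le> (LINT \<eta>|lborel. ?g \<eta> * ?W (?b + \<eta>))"
    by simp
  have Wi': "integrable lborel (\<lambda>\<eta>. ?g \<eta> * ?W (?b - \<eta>))"
    using lborel_integrable_real_affine[OF Wi[of ?b], of "- 1" 0] by (simp add: gm)
  \<comment> \<open>Evenness of the Gaussian makes both shifted terms of the gap have the same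
    average, which is where the division by \<open>2\<close> goes.\<close>
  have W': "(LINT \<eta>|lborel. ?g \<eta> * ?W (?b - \<eta>)) = (LINT \<eta>|lborel. ?g \<eta> * ?W (?b + \<eta>))"
    using lborel_integral_real_affine[of "- 1" "\<lambda>\<eta>. ?g \<eta> * ?W (?b - \<eta>)" 0] by (simp add: gm)
  have gap: "?g \<eta> * (modulus_gap w \<xi> \<eta> / 2) = w \<xi> * ?g \<eta> - (?g \<eta> * ?W (?b + \<eta>)) / 2 - (?g \<eta> * ?W (?b - \<eta>)) / 2" for \<eta>
    unfolding modulus_gap_def by (simp add: field_simps)
  have "(\<integral>\<^sup>+\<eta>. ennreal (?g \<eta> * (modulus_gap w \<xi> \<eta> / 2)) \<partial>lborel) = ennreal (LINT \<eta>|lborel. ?g \<eta> * (modulus_gap w \<xi> \<eta> / 2))"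
  proof (rule nn_integral_eq_integral)
    show "integrable lborel (\<lambda>\<eta>. ?g \<eta> * (modulus_gap w \<xi> \<eta> / 2))"
      unfolding gap using Wi[of ?b] Wi' \<sigma> by simp
  qed (use modulus_gap_nonneg[OF w \<xi>] in auto)
  also have "(LINT \<eta>|lborel. ?g \<eta> * (modulus_gap w \<xi> \<eta> / 2)) = w \<xi> - (LINT \<eta>|lborel. ?g \<eta> * ?W (?b + \<eta>))"
    unfolding gap using Wi[of ?b] Wi' \<sigma> by (simp add: W')
  finally show ?thesis using key by (simp add: ennreal_leI)
qed

section \<open>Trigonometric series and subordination\<close>

definition trig_series :: "('k \<Rightarrow> 'a::euclidean_space) \<Rightarrow> ('k \<Rightarrow> complex) \<Rightarrow> 'a \<Rightarrow> complex" where
  "trig_series \<kappa> a x = (\<Sum>\<^sub>\<infinity>k. a k * cis (\<kappa> k \<bullet> x))"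

lemma infsum_minus_distrib:
  fixes f g :: "'k \<Rightarrow> 'b::real_normed_vector"
  assumes "f summable_on A" "g summable_on A"
  shows "(\<lambda>k. f k - g k) summable_on A" "(\<Sum>\<^sub>\<infinity>k\<in>A. f k - g k) = infsum f A - infsum g A"
  using summable_on_add[OF assms(1) summable_on_uminus[THEN iffD2, OF assms(2)]]
    infsum_add[OF assms(1) summable_on_uminus[THEN iffD2, OF assms(2)]]
  by (simp_all add: infsum_uminus)

lemma trig_series_summable:
  assumes "(\<lambda>k. norm (a k)) summable_on UNIV"
  shows "(\<lambda>k. norm (a k * cis (\<kappa> k \<bullet> x))) summable_on UNIV" "(\<lambda>k. a k * cis (\<kappa> k \<bullet> x)) summable_on UNIV"
proof -
  show "(\<lambda>k. norm (a k * cis (\<kappa> k \<bullet> x))) summable_on UNIV" using assms by (simp add: norm_mult)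
  then show "(\<lambda>k. a k * cis (\<kappa> k \<bullet> x)) summable_on UNIV" by (rule abs_summable_summable)
qed

lemma norm_trig_series_le:
  assumes "(\<lambda>k. norm (a k)) summable_on UNIV"
  shows "norm (trig_series \<kappa> a x) \<le> (\<Sum>\<^sub>\<infinity>k. norm (a k))"
  unfolding trig_series_def
  using norm_infsum_bound[OF trig_series_summable(1)[OF assms, of \<kappa> x]] by (simp add: norm_mult)

lemma continuous_trig_series:
  fixes a :: "'k \<Rightarrow> complex"
  assumes "(\<lambda>k. norm (a k)) summable_on UNIV"
  shows "continuous_on UNIV (trig_series \<kappa> a)"
  unfolding trig_series_def[abs_def]
proof (rule uniform_limit_theorem)
  show "uniform_limit UNIV (\<lambda>X x. \<Sum>k\<in>X. a k * cis (\<kappa> k \<bullet> x)) (\<lambda>x. \<Sum>\<^sub>\<infinity>k. a k * cis (\<kappa> k \<bullet> x)) (finite_subsets_at_top UNIV)"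
    by (rule Weierstrass_m_test_general[where M = "\<lambda>k. norm (a k)"]) (auto simp: norm_mult assms)
qed (auto intro!: always_eventually continuous_intros)

text \<open>Each character is an eigenfunction of averaging along \<open>v\<close>, with the
  characteristic function of the Gaussian as eigenvalue.\<close>

lemma trig_series_normal_average:
  fixes \<kappa> :: "'k::countable \<Rightarrow> 'a::euclidean_space"
  assumes a: "(\<lambda>k. norm (a k)) summable_on UNIV" and \<sigma>: "\<sigma> > 0"
  shows "integrable lborel (\<lambda>\<eta>. normal_density 0 \<sigma> \<eta> * Re (trig_series \<kappa> a (x + \<eta> *\<^sub>R v)))"
    and "(LINT \<eta>|lborel. normal_density 0 \<sigma> \<eta> * Re (trig_series \<kappa> a (x + \<eta> *\<^sub>R v)))
       = Re (trig_series \<kappa> (\<lambda>k. a k * complex_of_real (exp (- (\<sigma> * (\<kappa> k \<bullet> v))\<^sup>2 / 2))) x)"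
proof -
  let ?n = "\<lambda>\<eta>. complex_of_real (normal_density 0 \<sigma> \<eta>)"
  define g where "g k \<eta> = ?n \<eta> * (a k * cis (\<kappa> k \<bullet> (x + \<eta> *\<^sub>R v)))" for k \<eta>
  have g: "g k = (\<lambda>\<eta>. a k * cis (\<kappa> k \<bullet> x) * (?n \<eta> * cis ((\<kappa> k \<bullet> v) * \<eta>)))" for k
    by (auto simp: g_def fun_eq_iff inner_add_right cis_mult[symmetric] mult_ac)
  have gi: "integrable lborel (g k)" for k
    unfolding g by (rule integrable_mult_right[OF normal_density_char(1)[OF \<sigma>]])
  have gs: "(LINT \<eta>|lborel. g k \<eta>) = a k * complex_of_real (exp (- (\<sigma> * (\<kappa> k \<bullet> v))\<^sup>2 / 2)) * cis (\<kappa> k \<bullet> x)" for k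
    unfolding g integral_mult_right_zero normal_density_char(2)[OF \<sigma>] by (simp add: mult_ac)
  have gn: "(LINT \<eta>|lborel. norm (g k \<eta>)) = norm (a k)" for k
    using \<sigma> by (simp add: g_def norm_mult)
  have pt: "(\<lambda>k. norm (g k \<eta>)) summable_on UNIV" for \<eta>
    unfolding g_def norm_mult[of "?n \<eta>"] by (intro summable_on_cmult_right trig_series_summable(1) a)
  have sum: "(\<Sum>\<^sub>\<infinity>k. g k \<eta>) = ?n \<eta> * trig_series \<kappa> a (x + \<eta> *\<^sub>R v)" for \<eta>
    unfolding g_def trig_series_def by (rule infsum_cmult_right) (rule trig_series_summable(2)[OF a])
  note S = infsum_integral_swap[OF sigma_finite_lborel gi _ pt, unfolded gn gs sum, OF a]
  show "integrable lborel (\<lambda>\<eta>. normal_density 0 \<sigma> \<eta> * Re (trig_series \<kappa> a (x + \<eta> *\<^sub>R v)))"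
    using integrable_Re[OF S(1)] by simp
  show "(LINT \<eta>|lborel. normal_density 0 \<sigma> \<eta> * Re (trig_series \<kappa> a (x + \<eta> *\<^sub>R v)))
       = Re (trig_series \<kappa> (\<lambda>k. a k * complex_of_real (exp (- (\<sigma> * (\<kappa> k \<bullet> v))\<^sup>2 / 2))) x)"
    using integral_Re[OF S(1)] S(2) by (simp add: trig_series_def)
qed

lemma summable_damped:
  assumes "(\<lambda>k. norm (a k)) summable_on UNIV" "\<And>k. \<bar>m k\<bar> \<le> 1"
  shows "(\<lambda>k. norm (a k * complex_of_real (m k))) summable_on UNIV"
  by (rule summable_on_comparison_test[OF assms(1)])
     (use assms(2) in \<open>auto simp: norm_mult intro!: mult_right_le_one_le\<close>)

text \<open>Translating both points by the same vector leaves \<open>z - z'\<close> unchanged, so an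
  average over translates obeys the same bound. The induction averages along one direction of
  \<open>V\<close> at a time, the damping factors multiplying.\<close>

lemma normal_average_keeps_modulus:
  fixes \<kappa> :: "'k::countable \<Rightarrow> 'a::euclidean_space"
  assumes a: "(\<lambda>k. norm (a k)) summable_on UNIV" and \<sigma>: "\<sigma> > 0"
    and mod: "\<And>z z'. Re (trig_series \<kappa> a z) - Re (trig_series \<kappa> a z') \<le> w (norm (z - z'))"
    and V: "finite V"
  shows "Re (trig_series \<kappa> (\<lambda>k. a k * complex_of_real (\<Prod>v\<in>V. exp (- (\<sigma> * (\<kappa> k \<bullet> v))\<^sup>2 / 2))) z)
       - Re (trig_series \<kappa> (\<lambda>k. a k * complex_of_real (\<Prod>v\<in>V. exp (- (\<sigma> * (\<kappa> k \<bullet> v))\<^sup>2 / 2))) z') \<le> w (norm (z - z'))"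
  using V
proof (induction V arbitrary: z z' rule: finite_induct)
  case empty
  then show ?case using mod by simp
next
  case (insert v V)
  let ?a = "\<lambda>k. a k * complex_of_real (\<Prod>v\<in>V. exp (- (\<sigma> * (\<kappa> k \<bullet> v))\<^sup>2 / 2))"
  let ?g = "normal_density 0 \<sigma>"
  have s: "(\<lambda>k. norm (?a k)) summable_on UNIV"
    by (rule summable_damped[OF a]) (auto simp: abs_prod intro!: prod_le_1)
  note A = trig_series_normal_average[OF s \<sigma>, of \<kappa> _ v]
  have eq: "a k * complex_of_real (\<Prod>v\<in>insert v V. exp (- (\<sigma> * (\<kappa> k \<bullet> v))\<^sup>2 / 2))
      = ?a k * complex_of_real (exp (- (\<sigma> * (\<kappa> k \<bullet> v))\<^sup>2 / 2))" for k
    using insert.hyps by (simp add: mult_ac)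
  have "(LINT \<eta>|lborel. ?g \<eta> * Re (trig_series \<kappa> ?a (z + \<eta> *\<^sub>R v))) - (LINT \<eta>|lborel. ?g \<eta> * Re (trig_series \<kappa> ?a (z' + \<eta> *\<^sub>R v)))
     = (LINT \<eta>|lborel. ?g \<eta> * Re (trig_series \<kappa> ?a (z + \<eta> *\<^sub>R v)) - ?g \<eta> * Re (trig_series \<kappa> ?a (z' + \<eta> *\<^sub>R v)))"
    by (rule Bochner_Integration.integral_diff[OF A(1) A(1), symmetric])
  also have "\<dots> \<le> (LINT \<eta>|lborel. ?g \<eta> * w (norm (z - z')))"
  proof (rule integral_mono)
    show "integrable lborel (\<lambda>\<eta>. ?g \<eta> * Re (trig_series \<kappa> ?a (z + \<eta> *\<^sub>R v)) - ?g \<eta> * Re (trig_series \<kappa> ?a (z' + \<eta> *\<^sub>R v)))"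
      by (rule Bochner_Integration.integrable_diff[OF A(1) A(1)])
    show "integrable lborel (\<lambda>\<eta>. ?g \<eta> * w (norm (z - z')))" using \<sigma> by simp
    show "?g \<eta> * Re (trig_series \<kappa> ?a (z + \<eta> *\<^sub>R v)) - ?g \<eta> * Re (trig_series \<kappa> ?a (z' + \<eta> *\<^sub>R v)) \<le> ?g \<eta> * w (norm (z - z'))" for \<eta>
      using mult_left_mono[OF insert.IH[of "z + \<eta> *\<^sub>R v" "z' + \<eta> *\<^sub>R v"], of "?g \<eta>"] by (simp add: right_diff_distrib)
  qed
  also have "\<dots> = w (norm (z - z'))" using \<sigma> by simp
  finally show ?case unfolding A(2) eq .
qed

lemma norm_sq_orthonormal_basis:
  fixes x :: "'a::euclidean_space"
  assumes "pairwise orthogonal S" "\<And>v. v \<in> S \<Longrightarrow> norm v = 1" "span S = UNIV" "finite S"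
  shows "(\<Sum>v\<in>S. (x \<bullet> v)\<^sup>2) = (norm x)\<^sup>2"
proof -
  have "(\<Sum>v\<in>S. (x \<bullet> v) *\<^sub>R v) = x"
    by (rule orthonormal_basis_expand) (use assms in auto)
  then have "x \<bullet> x = x \<bullet> (\<Sum>v\<in>S. (x \<bullet> v) *\<^sub>R v)" by simp
  also have "\<dots> = (\<Sum>v\<in>S. (x \<bullet> v)\<^sup>2)" by (simp add: inner_sum_right power2_eq_square)
  finally show ?thesis by (simp add: power2_norm_eq_inner)
qed

text \<open>The unit vector \<open>e\<close> from \<open>y\<close> to \<open>x\<close> is completed
  to an orthonormal basis \<open>S\<close>, over which the Gaussian factor splits. Averaging along
  \<open>S - {e}\<close> keeps the modulus and leaves a function of one variable on the line through
  \<open>x\<close> and \<open>y\<close>, to which the one-dimensional estimate applies.\<close>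

lemma gaussian_average_modulus_gap:
  fixes \<kappa> :: "'k::countable \<Rightarrow> 'a::euclidean_space"
  assumes w: "modulus_of_continuity w"
    and a: "(\<lambda>k. norm (a k)) summable_on UNIV" and \<sigma>: "\<sigma> > 0"
    and mod: "\<And>z z'. Re (trig_series \<kappa> a z) - Re (trig_series \<kappa> a z') \<le> w (norm (z - z'))"
    and xy: "x \<noteq> y"
  defines "G \<equiv> \<lambda>z. Re (trig_series \<kappa> (\<lambda>k. a k * complex_of_real (exp (- (\<sigma> * norm (\<kappa> k))\<^sup>2 / 2))) z)"
  shows "G x - G y \<le> w (norm (x - y))"
    and "(\<integral>\<^sup>+\<eta>. ennreal (normal_density 0 \<sigma> \<eta> * (modulus_gap w (norm (x - y)) \<eta> / 2)) \<partial>lborel)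
         \<le> ennreal (w (norm (x - y)) - (G x - G y))"
proof -
  define \<xi> where "\<xi> = norm (x - y)"
  define e where "e = (x - y) /\<^sub>R \<xi>"
  have \<xi>: "\<xi> > 0" using xy by (simp add: \<xi>_def)
  have e1: "norm e = 1" using \<xi> by (simp add: e_def \<xi>_def)
  obtain S where S: "e \<in> S" "pairwise orthogonal S" "\<And>v. v \<in> S \<Longrightarrow> norm v = 1" "independent S" "span S = UNIV"
    using vector_in_orthonormal_basis[OF e1] by metis
  have finS: "finite S" using S(4) by (rule independent_imp_finite)
  let ?m = "\<lambda>V k. \<Prod>v\<in>V. exp (- (\<sigma> * (\<kappa> k \<bullet> v))\<^sup>2 / 2)"
  have full: "?m S k = exp (- (\<sigma> * norm (\<kappa> k))\<^sup>2 / 2)" for k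
  proof -
    have "?m S k = exp (\<Sum>v\<in>S. - (\<sigma> * (\<kappa> k \<bullet> v))\<^sup>2 / 2)" by (rule exp_sum[OF finS, symmetric])
    also have "(\<Sum>v\<in>S. - (\<sigma> * (\<kappa> k \<bullet> v))\<^sup>2 / 2) = - (\<sigma>\<^sup>2 * (\<Sum>v\<in>S. (\<kappa> k \<bullet> v)\<^sup>2)) / 2"
      by (simp add: sum_negf sum_divide_distrib sum_distrib_left power_mult_distrib)
    also have "\<dots> = - (\<sigma> * norm (\<kappa> k))\<^sup>2 / 2"
      by (simp add: norm_sq_orthonormal_basis[OF S(2,3,5) finS] power_mult_distrib)
    finally show ?thesis .
  qed
  show "G x - G y \<le> w (norm (x - y))"
    using normal_average_keeps_modulus[OF a \<sigma> mod finS, of x y] unfolding full G_def .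
  let ?V = "S - {e}"
  let ?a = "\<lambda>k. a k * complex_of_real (?m ?V k)"
  have s: "(\<lambda>k. norm (?a k)) summable_on UNIV"
    by (rule summable_damped[OF a]) (auto simp: abs_prod intro!: prod_le_1)
  have fin: "?a k * complex_of_real (exp (- (\<sigma> * (\<kappa> k \<bullet> e))\<^sup>2 / 2)) = a k * complex_of_real (exp (- (\<sigma> * norm (\<kappa> k))\<^sup>2 / 2))" for k
    unfolding full[symmetric] prod.remove[OF finS S(1)] by (simp add: mult_ac)
  \<comment> \<open>The midpoint is the origin of the line, so \<open>x\<close> and \<open>y\<close>
    are the parameters \<open>\<xi> / 2\<close> and \<open>- \<xi> / 2\<close> of
    \<open>h\<close>.\<close>
  define c where "c = (1 / 2) *\<^sub>R (x + y)"
  define h where "h s = Re (trig_series \<kappa> ?a (c + s *\<^sub>R e))" for s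
  have "\<xi> *\<^sub>R e = x - y" using \<xi> by (simp add: e_def)
  then have half: "(\<xi> / 2) *\<^sub>R e = (1 / 2) *\<^sub>R (x - y)"
    by (metis (no_types) scaleR_scaleR mult.commute times_divide_eq_right mult.right_neutral)
  have cx: "c + (\<xi> / 2) *\<^sub>R e = x"
  proof -
    have "c + (\<xi> / 2) *\<^sub>R e = (1 / 2) *\<^sub>R (x + x)" unfolding c_def half by (simp add: scaleR_right_distrib[symmetric])
    then show ?thesis by (simp add: scaleR_2[symmetric] del: scaleR_right_distrib)
  qed
  have cy: "c + (- \<xi> / 2) *\<^sub>R e = y"
  proof -
    have "c + (- \<xi> / 2) *\<^sub>R e = (1 / 2) *\<^sub>R (y + y)" using half unfolding c_def by (simp add: algebra_simps)
    then show ?thesis by (simp add: scaleR_2[symmetric] del: scaleR_right_distrib)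
  qed
  have avg: "(LINT \<eta>|lborel. normal_density 0 \<sigma> \<eta> * h (b + \<eta>)) = G (c + b *\<^sub>R e)" for b
    using trig_series_normal_average(2)[OF s \<sigma>, of \<kappa> "c + b *\<^sub>R e" e] unfolding fin G_def h_def
    by (simp add: scaleR_left_distrib add.assoc)
  have hc: "continuous_on UNIV h"
    unfolding h_def by (intro continuous_intros continuous_on_compose2[OF continuous_trig_series[OF s]]) auto
  have "(\<integral>\<^sup>+\<eta>. ennreal (normal_density 0 \<sigma> \<eta> * (modulus_gap w \<xi> \<eta> / 2)) \<partial>lborel)
    \<le> ennreal (w \<xi> - ((LINT \<eta>|lborel. normal_density 0 \<sigma> \<eta> * h (\<xi> / 2 + \<eta>)) - (LINT \<eta>|lborel. normal_density 0 \<sigma> \<eta> * h (- \<xi> / 2 + \<eta>))))"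
  proof (rule normal_average_modulus_gap[OF w \<xi> \<sigma>])
    show "h \<in> borel_measurable borel" using hc by (rule borel_measurable_continuous_onI)
    show "\<bar>h s\<bar> \<le> (\<Sum>\<^sub>\<infinity>k. norm (?a k))" for s
      unfolding h_def by (rule order_trans[OF abs_Re_le_cmod norm_trig_series_le[OF s]])
    show "h r - h r' \<le> w \<bar>r - r'\<bar>" for r r'
      using normal_average_keeps_modulus[OF a \<sigma> mod, of ?V "c + r *\<^sub>R e" "c + r' *\<^sub>R e"] finS e1
      unfolding h_def by (simp add: scaleR_left_diff_distrib[symmetric])
  qed
  then show "(\<integral>\<^sup>+\<eta>. ennreal (normal_density 0 \<sigma> \<eta> * (modulus_gap w (norm (x - y)) \<eta> / 2)) \<partial>lborel)
         \<le> ennreal (w (norm (x - y)) - (G x - G y))"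
    unfolding avg cx cy unfolding \<xi>_def .
qed

section \<open>Integration over the scale of the Gaussians\<close>

lemma modulus_gap_zero:
  "modulus_of_continuity w \<Longrightarrow> \<xi> > 0 \<Longrightarrow> modulus_gap w \<xi> 0 = 0"
  by (simp add: modulus_gap_def odd_modulus_nonneg_arg)

lemma kernel_mass_modulus_gap:
  assumes w: "modulus_of_continuity w" and \<xi>: "\<xi> > 0"
  shows "kernel_mass \<alpha> * (\<integral>\<^sup>+\<eta>. ennreal (modulus_gap w \<xi> \<eta> / 2 * \<bar>\<eta>\<bar> powr (- 1 - 2 * \<alpha>)) \<partial>lborel)
    = (\<integral>\<^sup>+\<sigma>. ennreal (\<sigma> powr (- 1 - 2 * \<alpha>)) * indicator {0<..} \<sigma> *
        (\<integral>\<^sup>+\<eta>. ennreal (normal_density 0 \<sigma> \<eta> * (modulus_gap w \<xi> \<eta> / 2)) \<partial>lborel) \<partial>lborel)"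
proof -
  let ?s = "\<lambda>\<sigma>::real. \<sigma> powr (- 1 - 2 * \<alpha>)"
  let ?h = "\<lambda>\<eta>. modulus_gap w \<xi> \<eta> / 2"
  note [measurable] = borel_measurable_odd_modulus[OF w]
  have [measurable]: "modulus_gap w \<xi> \<in> borel_measurable borel"
    unfolding modulus_gap_def[abs_def] by measurable
  have h0: "?h \<eta> \<ge> 0" for \<eta> using modulus_gap_nonneg[OF w \<xi>] by simp
  have "(\<integral>\<^sup>+\<sigma>. ennreal (?s \<sigma>) * indicator {0<..} \<sigma> * (\<integral>\<^sup>+\<eta>. ennreal (normal_density 0 \<sigma> \<eta> * ?h \<eta>) \<partial>lborel) \<partial>lborel)
    = (\<integral>\<^sup>+\<sigma>. \<integral>\<^sup>+\<eta>. ennreal (?s \<sigma>) * indicator {0<..} \<sigma> * ennreal (normal_density 0 \<sigma> \<eta> * ?h \<eta>) \<partial>lborel \<partial>lborel)"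
    by (intro nn_integral_cong nn_integral_cmult[symmetric]) measurable
  also have "\<dots> = (\<integral>\<^sup>+\<eta>. \<integral>\<^sup>+\<sigma>. ennreal (?s \<sigma>) * indicator {0<..} \<sigma> * ennreal (normal_density 0 \<sigma> \<eta> * ?h \<eta>) \<partial>lborel \<partial>lborel)"
    by (rule lborel_pair.Fubini') (unfold normal_density_def, measurable)
  also have "\<dots> = (\<integral>\<^sup>+\<eta>. kernel_mass \<alpha> * ennreal (?h \<eta> * \<bar>\<eta>\<bar> powr (- 1 - 2 * \<alpha>)) \<partial>lborel)"
  proof (rule nn_integral_cong)
    fix \<eta> :: real
    have "(\<integral>\<^sup>+\<sigma>. ennreal (?s \<sigma>) * indicator {0<..} \<sigma> * ennreal (normal_density 0 \<sigma> \<eta> * ?h \<eta>) \<partial>lborel)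
      = (\<integral>\<^sup>+\<sigma>. (ennreal (normal_density 0 \<sigma> \<eta> * ?s \<sigma>) * indicator {0<..} \<sigma>) * ennreal (?h \<eta>) \<partial>lborel)"
      using h0[of \<eta>] by (intro nn_integral_cong) (auto simp: indicator_def ennreal_mult[symmetric] mult_ac)
    also have "\<dots> = (\<integral>\<^sup>+\<sigma>\<in>{0<..}. ennreal (normal_density 0 \<sigma> \<eta> * ?s \<sigma>) \<partial>lborel) * ennreal (?h \<eta>)"
      by (rule nn_integral_multc) (unfold normal_density_def, measurable)
    also have "\<dots> = kernel_mass \<alpha> * ennreal (?h \<eta> * \<bar>\<eta>\<bar> powr (- 1 - 2 * \<alpha>))"
    \<comment> \<open>At the point excluded from \<open>kernel_mass_scale\<close> the gap
      vanishes.\<close>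
    proof (cases "\<eta> = 0")
      case True
      then show ?thesis by (simp add: modulus_gap_zero[OF w \<xi>])
    next
      case False
      show ?thesis unfolding kernel_mass_scale[OF False] ennreal_mult[OF h0 powr_ge_zero] by (simp only: mult_ac)
    qed
    finally show "(\<integral>\<^sup>+\<sigma>. ennreal (?s \<sigma>) * indicator {0<..} \<sigma> * ennreal (normal_density 0 \<sigma> \<eta> * ?h \<eta>) \<partial>lborel)
       = kernel_mass \<alpha> * ennreal (?h \<eta> * \<bar>\<eta>\<bar> powr (- 1 - 2 * \<alpha>))" .
  qed
  also have "\<dots> = kernel_mass \<alpha> * (\<integral>\<^sup>+\<eta>. ennreal (?h \<eta> * \<bar>\<eta>\<bar> powr (- 1 - 2 * \<alpha>)) \<partial>lborel)"
    by (rule nn_integral_cmult) measurable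
  finally show ?thesis by simp
qed

text \<open>Termwise, \<open>symbol_mass_scale\<close> integrates the damping deficit to the symbol.
  The two summability hypotheses serve the two sides of the exchange: \<open>a\<close> gives
  convergence at fixed \<open>\<sigma>\<close>, \<open>a2\<close> convergence after integration in
  \<open>\<sigma>\<close>.\<close>

lemma trig_series_subordination:
  fixes \<kappa> :: "'k::countable \<Rightarrow> 'a::euclidean_space" and x y :: 'a
  assumes \<alpha>: "0 < \<alpha>" "\<alpha> < 1"
    and a: "(\<lambda>k. norm (a k)) summable_on UNIV"
    and a2: "(\<lambda>k. norm (complex_of_real (norm (\<kappa> k) powr (2 * \<alpha>)) * a k)) summable_on UNIV"
  defines "\<Delta> \<equiv> \<lambda>b. Re (trig_series \<kappa> b x) - Re (trig_series \<kappa> b y)"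
  defines "F \<equiv> \<lambda>\<sigma>. \<sigma> powr (- 1 - 2 * \<alpha>) * indicator {0<..} \<sigma> *
      (\<Delta> a - \<Delta> (\<lambda>k. a k * complex_of_real (exp (- (\<sigma> * norm (\<kappa> k))\<^sup>2 / 2))))"
  shows "integrable lborel F"
    and "integral\<^sup>L lborel F = enn2real (symbol_mass \<alpha>) * \<Delta> (\<lambda>k. complex_of_real (norm (\<kappa> k) powr (2 * \<alpha>)) * a k)"
proof -
  let ?N = "enn2real (symbol_mass \<alpha>)"
  let ?m = "\<lambda>\<sigma> k. exp (- (\<sigma> * norm (\<kappa> k))\<^sup>2 / 2)"
  let ?s = "\<lambda>\<sigma>::real. \<sigma> powr (- 1 - 2 * \<alpha>) * indicator {0<..} \<sigma>"
  let ?d = "\<lambda>k. cis (\<kappa> k \<bullet> x) - cis (\<kappa> k \<bullet> y)"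
  let ?p = "\<lambda>k. norm (\<kappa> k) powr (2 * \<alpha>)"
  define r where "r k \<sigma> = ?s \<sigma> * (1 - ?m \<sigma> k)" for k \<sigma>
  define g where "g k \<sigma> = complex_of_real (r k \<sigma>) * (a k * ?d k)" for k \<sigma>
  have r0: "r k \<sigma> \<ge> 0" for k \<sigma> by (simp add: r_def)
  have [measurable]: "r k \<in> borel_measurable borel" for k unfolding r_def[abs_def] by measurable
  have N: "symbol_mass \<alpha> = ennreal ?N"
    using symbol_mass_finite[OF \<alpha>] by (simp add: less_top)
  have rn: "(\<integral>\<^sup>+\<sigma>. ennreal (r k \<sigma>) \<partial>lborel) = ennreal (?p k * ?N)" for k
  proof -
    have "(\<integral>\<^sup>+\<sigma>. ennreal (r k \<sigma>) \<partial>lborel) = (\<integral>\<^sup>+\<sigma>\<in>{0<..}. ennreal ((1 - ?m \<sigma> k) * \<sigma> powr (- 1 - 2 * \<alpha>)) \<partial>lborel)"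
      by (intro nn_integral_cong) (auto simp: r_def indicator_def mult_ac)
    then show ?thesis unfolding symbol_mass_scale by (subst (asm) N) (simp add: ennreal_mult)
  qed
  have ri: "integrable lborel (r k)" "integral\<^sup>L lborel (r k) = ?p k * ?N" for k
  proof -
    have "has_bochner_integral lborel (r k) (?p k * ?N)"
      by (rule has_bochner_integral_nn_integral) (auto simp: r0 rn)
    then show "integrable lborel (r k)" "integral\<^sup>L lborel (r k) = ?p k * ?N"
      by (auto simp: has_bochner_integral_iff)
  qed
  have d2: "norm (?d k) \<le> 2" for k
    using norm_triangle_ineq4[of "cis (\<kappa> k \<bullet> x)" "cis (\<kappa> k \<bullet> y)"] by simp
  have gi: "integrable lborel (g k)" for k
    unfolding g_def by (intro integrable_mult_left integrable_of_real ri)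
  have gs: "(LINT \<sigma>|lborel. g k \<sigma>) = complex_of_real ?N * (complex_of_real (?p k) * a k * ?d k)" for k
    unfolding g_def using ri[of k] by (simp add: mult_ac)
  have gn: "(LINT \<sigma>|lborel. norm (g k \<sigma>)) = ?p k * ?N * norm (a k) * norm (?d k)" for k
    using ri[of k] by (simp add: g_def norm_mult r0)
  have s1: "(\<lambda>k. LINT \<sigma>|lborel. norm (g k \<sigma>)) summable_on UNIV"
  proof (rule summable_on_comparison_test[OF summable_on_cmult_right[OF a2, of "2 * ?N"]])
    show "(LINT \<sigma>|lborel. norm (g k \<sigma>)) \<le> 2 * ?N * norm (complex_of_real (?p k) * a k)" for k
      using mult_left_mono[OF d2[of k], of "?p k * ?N * norm (a k)"] unfolding gn by (simp add: norm_mult mult_ac)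
  qed auto
  have pt: "(\<lambda>k. norm (g k \<sigma>)) summable_on UNIV" for \<sigma>
  proof (rule summable_on_comparison_test[OF summable_on_cmult_right[OF a, of "2 * ?s \<sigma>"]])
    fix k
    have "norm (g k \<sigma>) = ?s \<sigma> * (1 - ?m \<sigma> k) * (norm (a k) * norm (?d k))"
      using r0[of k \<sigma>] by (simp add: g_def norm_mult) (simp add: r_def)
    also have "\<dots> \<le> ?s \<sigma> * 1 * (norm (a k) * 2)"
      by (intro mult_mono d2) auto
    finally show "norm (g k \<sigma>) \<le> 2 * ?s \<sigma> * norm (a k)" by (simp add: mult_ac)
  qed auto
  have diff: "Re (trig_series \<kappa> b x - trig_series \<kappa> b y) = \<Delta> b" for b by (simp add: \<Delta>_def)
  have dsum: "(\<Sum>\<^sub>\<infinity>k. b k * ?d k) = trig_series \<kappa> b x - trig_series \<kappa> b y" "(\<lambda>k. b k * ?d k) summable_on UNIV"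
    if "(\<lambda>k. norm (b k)) summable_on UNIV" for b
  proof -
    note t = trig_series_summable(2)[OF that]
    show "(\<Sum>\<^sub>\<infinity>k. b k * ?d k) = trig_series \<kappa> b x - trig_series \<kappa> b y"
      unfolding right_diff_distrib trig_series_def by (rule infsum_minus_distrib(2)[OF t t])
    show "(\<lambda>k. b k * ?d k) summable_on UNIV"
      unfolding right_diff_distrib by (rule infsum_minus_distrib(1)[OF t t])
  qed
  have am: "(\<lambda>k. norm (a k * complex_of_real (?m \<sigma> k))) summable_on UNIV" for \<sigma>
    by (rule summable_damped[OF a]) simp
  have sum: "Re (\<Sum>\<^sub>\<infinity>k. g k \<sigma>) = F \<sigma>" for \<sigma>
  proof -
    have "(\<Sum>\<^sub>\<infinity>k. g k \<sigma>) = (\<Sum>\<^sub>\<infinity>k. complex_of_real (?s \<sigma>) * (a k * ?d k - a k * complex_of_real (?m \<sigma> k) * ?d k))"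
      by (intro infsum_cong) (simp add: g_def r_def algebra_simps)
    also have "\<dots> = complex_of_real (?s \<sigma>) * (\<Sum>\<^sub>\<infinity>k. a k * ?d k - a k * complex_of_real (?m \<sigma> k) * ?d k)"
      by (intro infsum_cmult_right infsum_minus_distrib(1) dsum a am)
    also have "(\<Sum>\<^sub>\<infinity>k. a k * ?d k - a k * complex_of_real (?m \<sigma> k) * ?d k)
      = (trig_series \<kappa> a x - trig_series \<kappa> a y) - (trig_series \<kappa> (\<lambda>k. a k * complex_of_real (?m \<sigma> k)) x - trig_series \<kappa> (\<lambda>k. a k * complex_of_real (?m \<sigma> k)) y)"
      using infsum_minus_distrib(2)[OF dsum(2)[OF a] dsum(2)[OF am]] dsum(1)[OF a] dsum(1)[OF am] by simp
    finally show ?thesis by (simp add: F_def \<Delta>_def)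
  qed
  note S = infsum_integral_swap[OF sigma_finite_lborel gi s1 pt]
  show "integrable lborel F"
    using integrable_Re[OF S(1)] unfolding sum .
  have "integral\<^sup>L lborel F = Re (LINT \<sigma>|lborel. (\<Sum>\<^sub>\<infinity>k. g k \<sigma>))"
    using integral_Re[OF S(1)] unfolding sum by simp
  also have "\<dots> = Re (\<Sum>\<^sub>\<infinity>k. complex_of_real ?N * (complex_of_real (?p k) * a k * ?d k))"
    unfolding S(2) gs ..
  also have "\<dots> = Re (complex_of_real ?N * (\<Sum>\<^sub>\<infinity>k. complex_of_real (?p k) * a k * ?d k))"
    by (subst infsum_cmult_right[OF dsum(2)[OF a2]]) simp
  also have "\<dots> = ?N * \<Delta> (\<lambda>k. complex_of_real (?p k) * a k)"
    unfolding dsum(1)[OF a2] by (simp add: \<Delta>_def)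
  finally show "integral\<^sup>L lborel F = ?N * \<Delta> (\<lambda>k. complex_of_real (?p k) * a k)" .
qed

text \<open>All estimates meet in one chain: \<open>c\<close> times
  \<open>symbol_mass \<alpha>\<close> times the dissipation integrals lies below the mixture over
  \<open>\<sigma>\<close> of averaged gaps, and that below the mixture of the deficits
  \<open>?F\<close>, which subordination evaluates as \<open>symbol_mass \<alpha>\<close> times
  \<open>A x - A y\<close>. The mass is positive and finite, hence cancels.\<close>

lemma trig_series_dissipation_bound:
  fixes \<kappa> :: "'k::countable \<Rightarrow> 'a::euclidean_space"
  assumes \<alpha>: "0 < \<alpha>" "\<alpha> < 1" and hk: "heat_kernel_constant \<alpha> c"
    and w: "modulus_of_continuity w"
    and a: "(\<lambda>k. norm (a k)) summable_on UNIV"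
    and a2: "(\<lambda>k. norm (complex_of_real (norm (\<kappa> k) powr (2 * \<alpha>)) * a k)) summable_on UNIV"
    and mod: "\<And>z z'. Re (trig_series \<kappa> a z) - Re (trig_series \<kappa> a z') \<le> w (norm (z - z'))"
    and xy: "x \<noteq> y" and touch: "Re (trig_series \<kappa> a x) - Re (trig_series \<kappa> a y) = w (norm (x - y))"
  defines "A \<equiv> \<lambda>z. Re (trig_series \<kappa> (\<lambda>k. complex_of_real (norm (\<kappa> k) powr (2 * \<alpha>)) * a k) z)"
  shows "ereal (- A x + A y) \<le> dissipation c \<alpha> w (norm (x - y))"
proof -
  let ?\<xi> = "norm (x - y)"
  let ?N = "enn2real (symbol_mass \<alpha>)"
  let ?G = "\<lambda>\<sigma> z. Re (trig_series \<kappa> (\<lambda>k. a k * complex_of_real (exp (- (\<sigma> * norm (\<kappa> k))\<^sup>2 / 2))) z)"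
  let ?F = "\<lambda>\<sigma>. \<sigma> powr (- 1 - 2 * \<alpha>) * indicator {0<..} \<sigma> * (w ?\<xi> - (?G \<sigma> x - ?G \<sigma> y))"
  have \<xi>: "?\<xi> > 0" using xy by simp
  have c: "c > 0" using hk by (simp add: heat_kernel_constant_def)
  have N: "symbol_mass \<alpha> = ennreal ?N"
    using symbol_mass_finite[OF \<alpha>] by (simp add: less_top)
  have Npos: "?N > 0" using symbol_mass_pos[of \<alpha>] N by (metis ennreal_0 enn2real_nonneg less_irrefl order_le_less)
  \<comment> \<open>Contact enters here: \<open>touch\<close> replaces the undamped increment by
    \<open>w ?\<xi>\<close>, which makes the integrand a deficit and so nonnegative.\<close>
  note S = trig_series_subordination[OF \<alpha> a a2, of x y, unfolded touch]
  note G = gaussian_average_modulus_gap[OF w a _ mod xy]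
  have F0: "?F \<sigma> \<ge> 0" for \<sigma>
    using G(1)[of \<sigma>] by (cases "\<sigma> > 0") auto
  define I1 where "I1 = (\<integral>\<^sup>+\<eta>\<in>{0<..<?\<xi>/2}. ennreal (- dissip_near \<alpha> w ?\<xi> \<eta>) \<partial>lborel)"
  define I2 where "I2 = (\<integral>\<^sup>+\<eta>\<in>{?\<xi>/2<..}. ennreal (- dissip_far \<alpha> w ?\<xi> \<eta>) \<partial>lborel)"
  have "ennreal c * symbol_mass \<alpha> * (I1 + I2) \<le> kernel_mass \<alpha> * (\<integral>\<^sup>+\<eta>. ennreal (modulus_gap w ?\<xi> \<eta> / 2 * \<bar>\<eta>\<bar> powr (- 1 - 2 * \<alpha>)) \<partial>lborel)"
    unfolding I1_def I2_def by (intro mult_mono heat_kernel_constant_le[OF \<alpha>(1) hk] dissipation_integrals_le[OF w \<xi>]) auto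
  also have "\<dots> = (\<integral>\<^sup>+\<sigma>. ennreal (\<sigma> powr (- 1 - 2 * \<alpha>)) * indicator {0<..} \<sigma> *
        (\<integral>\<^sup>+\<eta>. ennreal (normal_density 0 \<sigma> \<eta> * (modulus_gap w ?\<xi> \<eta> / 2)) \<partial>lborel) \<partial>lborel)"
    by (rule kernel_mass_modulus_gap[OF w \<xi>])
  also have "\<dots> \<le> (\<integral>\<^sup>+\<sigma>. ennreal (?F \<sigma>) \<partial>lborel)"
  proof (rule nn_integral_mono)
    fix \<sigma> :: real
    show "ennreal (\<sigma> powr (- 1 - 2 * \<alpha>)) * indicator {0<..} \<sigma> *
        (\<integral>\<^sup>+\<eta>. ennreal (normal_density 0 \<sigma> \<eta> * (modulus_gap w ?\<xi> \<eta> / 2)) \<partial>lborel) \<le> ennreal (?F \<sigma>)"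
    proof (cases "\<sigma> > 0")
      case True
      then show ?thesis
        using mult_left_mono[OF G(2)[OF True], of "ennreal (\<sigma> powr (- 1 - 2 * \<alpha>))"] G(1)[OF True]
        by (simp add: ennreal_mult)
    qed simp
  qed
  also have "\<dots> = ennreal (?N * (A x - A y))"
    unfolding A_def S(2)[symmetric] by (rule nn_integral_eq_integral[OF S(1)]) (rule AE_I2, rule F0)
  finally have "ennreal ?N * (ennreal c * (I1 + I2)) \<le> ennreal (?N * (A x - A y))"
    unfolding N[symmetric] by (simp add: mult_ac)
  also have "\<dots> = ennreal ?N * ennreal (A x - A y)" using Npos by (subst ennreal_mult') auto
  finally have le: "ennreal c * (I1 + I2) \<le> ennreal (A x - A y)"
    using Npos by (simp add: ennreal_mult_le_mult_iff)
  \<comment> \<open>\<open>ennreal\<close> truncates negative reals to \<open>0\<close>, so the sign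
    of \<open>A x - A y\<close> is needed before \<open>le\<close> can be read in the reals.\<close>
  have "0 \<le> integral\<^sup>L lborel ?F" using F0 by (intro integral_nonneg_AE) auto
  then have "0 \<le> ?N * (A x - A y)" unfolding S(2) A_def .
  then have Apos: "0 \<le> A x - A y" using Npos by (simp add: zero_le_mult_iff)
  \<comment> \<open>A positive multiple of the sum lies below a real number; this excludes the value
    \<open>-\<infinity>\<close> of the dissipation term.\<close>
  have fin: "I1 + I2 < \<infinity>"
  proof (rule ccontr)
    assume "\<not> ?thesis"
    then have inf: "I1 + I2 = \<infinity>" by (metis infinity_ennreal_def top.not_eq_extremum)
    show False using le c unfolding inf by (simp add: ennreal_mult_top top_unique)
  qed
  then obtain r1 r2 where r: "I1 = ennreal r1" "I2 = ennreal r2" "r1 \<ge> 0" "r2 \<ge> 0"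
    by (cases I1; cases I2) auto
  have "ennreal (c * (r1 + r2)) \<le> ennreal (A x - A y)"
    using le r c by (simp add: ennreal_mult)
  then have "c * (r1 + r2) \<le> A x - A y" using Apos by simp
  moreover have "dissipation c \<alpha> w ?\<xi> = ereal (c * (- r1 - r2))"
    unfolding dissipation_def I1_def[symmetric] I2_def[symmetric] r using r(3,4) by (simp add: enn2ereal_ennreal)
  ultimately show ?thesis by (simp add: algebra_simps)
qed

section \<open>Fourier series of smooth periodic functions\<close>

abbreviation unit_cube :: "(real^'n) set" where "unit_cube \<equiv> cbox 0 1"

abbreviation int_vec :: "int^'n \<Rightarrow> real^'n" where "int_vec k \<equiv> (\<chi> i. real_of_int (k $ i))"

text \<open>The shifted cube is cut at height \<open>1\<close> in direction \<open>i\<close>, and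
  the overhanging slab is moved back by one period.\<close>

lemma integral_shift_unit_cube:
  fixes G :: "real^'n \<Rightarrow> complex"
  assumes G: "continuous_on UNIV G" and per: "\<And>s. G (s + axis i 1) = G s" and h: "0 \<le> h" "h \<le> 1"
  shows "integral unit_cube (\<lambda>s. G (s + h *\<^sub>R axis i 1)) = integral unit_cube G"
proof -
  let ?e = "axis i 1 :: real^'n"
  let ?b = "1 - (1 - h) *\<^sub>R ?e"
  have int: "G integrable_on cbox u v" for u v
    by (rule integrable_continuous[OF continuous_on_subset[OF G]]) simp
  have e: "?e \<in> Basis" by simp
  have nth: "?e $ j = (if j = i then 1 else 0)" for j by (simp add: axis_def)
  have inner: "s \<bullet> ?e = s $ i" for s by (simp add: inner_axis)
  have mem: "s \<in> cbox u v \<longleftrightarrow> u $ i \<le> s $ i \<and> s $ i \<le> v $ i \<and> (\<forall>j. j \<noteq> i \<longrightarrow> u $ j \<le> s $ j \<and> s $ j \<le> v $ j)" for s u v :: "real^'n"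
    unfolding mem_box_cart by metis
  have c1: "cbox 0 1 \<inter> {s. s \<bullet> ?e \<le> h} = cbox 0 ?b"
    using h by (intro set_eqI) (auto simp: mem nth inner)
  have c2: "cbox 0 1 \<inter> {s. s \<bullet> ?e \<ge> h} = cbox (h *\<^sub>R ?e) 1"
    using h by (intro set_eqI) (auto simp: mem nth inner)
  have c3: "cbox (h *\<^sub>R ?e) (1 + h *\<^sub>R ?e) \<inter> {s. s \<bullet> ?e \<le> 1} = cbox (h *\<^sub>R ?e) 1"
    using h by (intro set_eqI) (auto simp: mem nth inner)
  have c4: "cbox (h *\<^sub>R ?e) (1 + h *\<^sub>R ?e) \<inter> {s. s \<bullet> ?e \<ge> 1} = cbox ?e (1 + h *\<^sub>R ?e)"
    using h by (intro set_eqI) (auto simp: mem nth inner)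
  have "integral unit_cube (\<lambda>s. G (s + h *\<^sub>R ?e)) = integral (cbox (h *\<^sub>R ?e) (1 + h *\<^sub>R ?e)) G"
    using integral_shift_cbox[of "h *\<^sub>R ?e" "h *\<^sub>R ?e" "1 + h *\<^sub>R ?e" G] by simp
  also have "\<dots> = integral (cbox (h *\<^sub>R ?e) 1) G + integral (cbox ?e (1 + h *\<^sub>R ?e)) G"
    using integral_split[OF int e, of "h *\<^sub>R ?e" "1 + h *\<^sub>R ?e" 1] unfolding c3 c4 .
  also have "integral (cbox ?e (1 + h *\<^sub>R ?e)) G = integral (cbox 0 ?b) G"
    using integral_shift_cbox[of ?e ?e "1 + h *\<^sub>R ?e" G] by (simp add: per algebra_simps)
  also have "integral (cbox (h *\<^sub>R ?e) 1) G + integral (cbox 0 ?b) G = integral unit_cube G"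
    using integral_split[OF int e, of 0 1 h] unfolding c1 c2 by simp
  finally show ?thesis .
qed

text \<open>By periodicity the integral of \<open>G\<close> over the shifted cube is constant in the
  shift; differentiating under the integral gives the claim. The derivative is one-sided at
  \<open>0\<close>, since shifts are taken in the unit interval.\<close>

lemma integral_unit_cube_derivative:
  fixes G G' :: "real^'n \<Rightarrow> complex"
  assumes G: "continuous_on UNIV G" and G': "continuous_on UNIV G'"
    and per: "\<And>s. G (s + axis i 1) = G s"
    and der: "\<And>s h. ((\<lambda>h. G (s + h *\<^sub>R axis i 1)) has_vector_derivative G' (s + h *\<^sub>R axis i 1)) (at h)"
  shows "integral unit_cube G' = 0"
proof -
  let ?e = "axis i 1 :: real^'n"
  let ?I = "\<lambda>h. integral unit_cube (\<lambda>s. G (s + h *\<^sub>R ?e))"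
  have "(?I has_vector_derivative integral unit_cube (\<lambda>s. G' (s + 0 *\<^sub>R ?e))) (at 0 within cbox 0 1)"
  proof (rule leibniz_rule_vector_derivative)
    show "((\<lambda>h. G (s + h *\<^sub>R ?e)) has_vector_derivative G' (s + h *\<^sub>R ?e)) (at h within cbox 0 1)" for h s
      by (rule has_vector_derivative_at_within[OF der])
    show "(\<lambda>s. G (s + h *\<^sub>R ?e)) integrable_on unit_cube" for h
      by (intro integrable_continuous continuous_on_compose2[OF G] continuous_intros) auto
    show "continuous_on (cbox 0 1 \<times> unit_cube) (\<lambda>(h, s). G' (s + h *\<^sub>R ?e))"
      unfolding split_beta by (intro continuous_on_compose2[OF G'] continuous_intros) auto
  qed auto
  moreover have "(?I has_vector_derivative 0) (at 0 within cbox 0 1)"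
    by (rule has_vector_derivative_transform[of 0 "cbox 0 1" _ "\<lambda>h. integral unit_cube G"])
       (auto simp: integral_shift_unit_cube[OF G per])
  ultimately show ?thesis
    using vector_derivative_unique_within_closed_interval[of 0 1 "0::real" ?I] by simp
qed

lemma wave_vector_inner:
  assumes "invertible B"
  shows "wave_vector B k \<bullet> (B *v s) = 2 * pi * (int_vec k \<bullet> s)"
proof -
  have "matrix_inv B *v (B *v s) = s"
    using someI_ex[OF assms[unfolded invertible_def]] by (simp add: matrix_vector_mul_assoc matrix_inv_def)
  then show ?thesis
    unfolding wave_vector_def by (simp add: transpose_matrix_vector dot_lmul_matrix)
qed

lemma continuous_matrix_vector: "continuous_on S ((*v) (B :: real^'n^'m))"
  by (simp add: linear_continuous_on matrix_vector_mul_bounded_linear)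

lemma cis_2pi_int_vec_periodic: "cis (2 * pi * (int_vec k \<bullet> (s + axis i 1))) = cis (2 * pi * (int_vec k \<bullet> s))"
proof -
  have "2 * pi * (int_vec k \<bullet> (s + axis i 1)) = 2 * pi * (int_vec k \<bullet> s) + 2 * pi * real_of_int (k $ i)"
    by (simp add: inner_add_right inner_axis algebra_simps)
  then show ?thesis by (simp add: cis_mult[symmetric] cis_multiple_2pi)
qed

lemma lattice_periodic_matrix:
  "lattice_periodic B f \<Longrightarrow> f (B *v (s + axis i 1)) = f (B *v s)"
  by (simp add: lattice_periodic_def matrix_vector_right_distrib matrix_vector_mult_basis)

lemma has_vector_derivative_cis_affine:
  "((\<lambda>h. cis (c + h * b)) has_vector_derivative \<i> * of_real b * cis (c + h * b)) (at h)"
proof -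
  have "((\<lambda>z. exp (\<i> * (of_real c + z * of_real b))) has_field_derivative \<i> * of_real b * exp (\<i> * (of_real c + of_real h * of_real b))) (at (of_real h))"
    by (auto intro!: derivative_eq_intros)
  from has_vector_derivative_real_field[OF this] show ?thesis by (simp add: cis_conv_exp)
qed

text \<open>Integration by parts without boundary terms: the derivative of \<open>f\<close> times a
  character along \<open>column i B\<close> has integral \<open>0\<close> over the period
  cell.\<close>

lemma fourier_coeff_derivative:
  fixes B :: "real^'n^'n" and f :: "real^'n \<Rightarrow> real"
  assumes inv: "invertible B" and per: "lattice_periodic B f"
    and der: "\<And>x. (f has_derivative f' x) (at x)"
    and cont: "continuous_on UNIV (\<lambda>x. f' x (column i B))"
  shows "fourier_coeff B (\<lambda>x. f' x (column i B)) k = 2 * pi * \<i> * of_int (k $ i) * fourier_coeff B f k"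
proof -
  let ?e = "axis i 1 :: real^'n"
  let ?E = "\<lambda>s. cis (2 * pi * (int_vec (- k) \<bullet> s))"
  let ?G = "\<lambda>s. complex_of_real (f (B *v s)) * ?E s"
  let ?m = "- (2 * pi * \<i> * of_int (k $ i))"
  let ?H = "\<lambda>s. complex_of_real (f' (B *v s) (column i B)) * ?E s"
  let ?G' = "\<lambda>s. ?H s + ?m * ?G s"
  have fc: "continuous_on UNIV f"
    using der by (meson continuous_at_imp_continuous_on has_derivative_continuous)
  have neg: "cis (- (wave_vector B k \<bullet> (B *v s))) = ?E s" for s
    unfolding wave_vector_inner[OF inv] by (simp add: inner_vec_def sum_negf)
  have cG: "continuous_on UNIV ?G"
    by (intro continuous_intros continuous_on_compose2[OF fc continuous_matrix_vector]) auto
  have cH: "continuous_on UNIV ?H"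
    by (intro continuous_intros continuous_on_compose2[OF cont continuous_matrix_vector]) auto
  have "integral unit_cube ?G' = 0"
  proof (rule integral_unit_cube_derivative[where i = i, OF cG])
    show "continuous_on UNIV ?G'" by (rule continuous_on_add[OF cH continuous_on_mult[OF continuous_on_const cG]])
    show "?G (s + ?e) = ?G s" for s
      unfolding lattice_periodic_matrix[OF per] cis_2pi_int_vec_periodic ..
    fix s h
    have lin: "B *v (s + h *\<^sub>R ?e) = B *v s + h *\<^sub>R column i B" for h
      by (simp add: matrix_vector_right_distrib matrix_vector_mult_scaleR matrix_vector_mult_basis)
    have "((\<lambda>h. f (B *v s + h *\<^sub>R column i B)) has_derivative (\<lambda>t. f' (B *v s + h *\<^sub>R column i B) (t *\<^sub>R column i B))) (at h)"
      by (rule has_derivative_compose[OF _ der]) (auto intro!: derivative_eq_intros)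
    moreover have "f' y (t *\<^sub>R column i B) = f' y (column i B) * t" for y t
      using linear_scale[OF has_derivative_linear[OF der]] by simp
    ultimately have "((\<lambda>h. f (B *v (s + h *\<^sub>R ?e))) has_vector_derivative f' (B *v (s + h *\<^sub>R ?e)) (column i B)) (at h)"
      unfolding lin has_vector_derivative_def by (simp add: mult.commute)
    then have 1: "((\<lambda>h. complex_of_real (f (B *v (s + h *\<^sub>R ?e)))) has_vector_derivative complex_of_real (f' (B *v (s + h *\<^sub>R ?e)) (column i B))) (at h)"
      by (rule bounded_linear.has_vector_derivative[OF bounded_linear_of_real])
    have ph: "2 * pi * (int_vec (- k) \<bullet> (s + h *\<^sub>R ?e)) = 2 * pi * (int_vec (- k) \<bullet> s) + h * (- (2 * pi * real_of_int (k $ i)))" for h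
      by (simp add: inner_add_right inner_axis algebra_simps)
    have 2: "((\<lambda>h. ?E (s + h *\<^sub>R ?e)) has_vector_derivative ?m * ?E (s + h *\<^sub>R ?e)) (at h)"
      unfolding ph using has_vector_derivative_cis_affine[of _ "- (2 * pi * real_of_int (k $ i))" h] by (simp add: mult_ac)
    show "((\<lambda>h. ?G (s + h *\<^sub>R ?e)) has_vector_derivative ?G' (s + h *\<^sub>R ?e)) (at h)"
      using has_vector_derivative_mult[OF 1 2] by (simp add: algebra_simps)
  qed
  moreover have "integral unit_cube ?G' = integral unit_cube ?H + ?m * integral unit_cube ?G"
  proof -
    have "?H integrable_on unit_cube" "?G integrable_on unit_cube"
      by (rule integrable_continuous, rule continuous_on_subset[OF cH] continuous_on_subset[OF cG], simp)+
    then show ?thesis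
      using integral_add[of ?H unit_cube "\<lambda>s. ?m * ?G s"] integrable_on_mult_right[of ?G unit_cube ?m] by simp
  qed
  ultimately show ?thesis
    unfolding fourier_coeff_def neg by (simp add: algebra_simps)
qed

section \<open>Smooth periodic functions and the decay of their coefficients\<close>

lemma Ck_on_slice:
  fixes g :: "'a::real_normed_vector \<times> real \<Rightarrow> real"
  assumes "Ck_on k (UNIV \<times> T) g" "t \<in> T"
  shows "Ck_on k UNIV (\<lambda>x. g (x, t))"
  using assms
proof (induction k arbitrary: g)
  case 0
  then show ?case by (auto intro!: continuous_on_compose2[of "UNIV \<times> T" g] continuous_intros)
next
  case (Suc k)
  then obtain g' where g': "\<And>z. z \<in> UNIV \<times> T \<Longrightarrow> (g has_derivative g' z) (at z within UNIV \<times> T)"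
    and C: "\<And>h. Ck_on k (UNIV \<times> T) (\<lambda>z. g' z h)" by auto
  \<comment> \<open>The derivative within \<open>UNIV \<times> T\<close> restricts to the slice
    through \<open>t\<close> without any neighbourhood of \<open>t\<close> in
    \<open>T\<close>.\<close>
  have "((\<lambda>x. g (x, t)) has_derivative (\<lambda>h. g' (x, t) (h, 0))) (at x)" for x
  proof -
    have "(g has_derivative g' (x, t)) (at (x, t) within (\<lambda>x. (x, t)) ` UNIV)"
      by (rule has_derivative_subset[OF g']) (use Suc.prems in auto)
    moreover have "((\<lambda>x. (x, t)) has_derivative (\<lambda>h. (h, 0))) (at x)"
      by (auto intro!: derivative_eq_intros)
    ultimately show ?thesis
      using diff_chain_within[of "\<lambda>x. (x, t)" "\<lambda>h. (h, 0)" x UNIV g "g' (x, t)"] by (simp add: o_def)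
  qed
  moreover have "Ck_on k UNIV (\<lambda>x. g' (x, t) (h, 0))" for h
    using Suc.IH[OF C, of "(h, 0)"] Suc.prems by simp
  ultimately show ?case by (auto intro!: exI[of _ "\<lambda>x h. g' (x, t) (h, 0)"])
qed

lemma smooth_on_imp_continuous: "smooth_on S f \<Longrightarrow> continuous_on S f"
  unfolding smooth_on_def by (metis Ck_on.simps(1))

text \<open>\<open>Ck_on\<close> asserts a derivative for each order separately; uniqueness of
  derivatives on the whole space makes these a single \<open>f'\<close>, smooth to all
  orders.\<close>

lemma smooth_on_UNIV_derivative:
  assumes "smooth_on UNIV f"
  obtains f' where "\<And>x. (f has_derivative f' x) (at x)" "\<And>h. smooth_on UNIV (\<lambda>x. f' x h)"
proof -
  have C: "Ck_on (Suc k) UNIV f" for k using assms by (simp add: smooth_on_def del: Ck_on.simps)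
  obtain f' where f': "\<And>x. (f has_derivative f' x) (at x)" using C[of 0] by auto
  have "Ck_on k UNIV (\<lambda>x. f' x h)" for k h
  proof -
    obtain g where g: "\<And>x. (f has_derivative g x) (at x)" "\<And>h. Ck_on k UNIV (\<lambda>x. g x h)" using C[of k] by auto
    have "g x = f' x" for x by (rule has_derivative_unique[OF g(1) f'])
    then show ?thesis using g(2) by simp
  qed
  then show ?thesis using that[OF f'] by (simp add: smooth_on_def)
qed

lemma smooth_periodic_derivative:
  fixes B :: "real^'n^'n" and f :: "real^'n \<Rightarrow> real"
  assumes inv: "invertible B" and sm: "smooth_on UNIV f" and per: "lattice_periodic B f"
  obtains D where "smooth_on UNIV D" "lattice_periodic B D"
    "\<And>k. fourier_coeff B D k = 2 * pi * \<i> * of_int (k $ i) * fourier_coeff B f k"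
proof -
  obtain f' where f': "\<And>x. (f has_derivative f' x) (at x)" and s: "\<And>h. smooth_on UNIV (\<lambda>x. f' x h)"
    using smooth_on_UNIV_derivative[OF sm] by metis
  have "f' (x + column j B) = f' x" for x j
  proof -
    have "((\<lambda>x. f (x + column j B)) has_derivative f' (x + column j B)) (at x)"
      by (rule has_derivative_compose[OF _ f', of "\<lambda>x. x + column j B" "\<lambda>h. h"]) (auto intro!: derivative_eq_intros)
    moreover have "(\<lambda>x. f (x + column j B)) = f" using per by (auto simp: lattice_periodic_def)
    ultimately show ?thesis using has_derivative_unique f' by metis
  qed
  then have "lattice_periodic B (\<lambda>x. f' x (column i B))" by (simp add: lattice_periodic_def)
  then show ?thesis
    using that[of "\<lambda>x. f' x (column i B)"] s
      fourier_coeff_derivative[OF inv per f' smooth_on_imp_continuous[OF s]] by blast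
qed

lemma smooth_periodic_fourth_derivative:
  fixes B :: "real^'n^'n" and f :: "real^'n \<Rightarrow> real"
  assumes inv: "invertible B" and sm: "smooth_on UNIV f" and per: "lattice_periodic B f"
  obtains D where "smooth_on UNIV D" "lattice_periodic B D"
    "\<And>k. norm (fourier_coeff B D k) = (2 * pi * real_of_int (k $ i)) ^ 4 * norm (fourier_coeff B f k)"
proof -
  let ?P = "\<lambda>D. smooth_on UNIV D \<and> lattice_periodic B D"
  obtain D1 where D1: "?P D1" "\<And>k. fourier_coeff B D1 k = 2 * pi * \<i> * of_int (k $ i) * fourier_coeff B f k"
    using smooth_periodic_derivative[OF inv sm per, of i] by metis
  obtain D2 where D2: "?P D2" "\<And>k. fourier_coeff B D2 k = 2 * pi * \<i> * of_int (k $ i) * fourier_coeff B D1 k"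
    using smooth_periodic_derivative[OF inv, of D1 i] D1(1) by metis
  obtain D3 where D3: "?P D3" "\<And>k. fourier_coeff B D3 k = 2 * pi * \<i> * of_int (k $ i) * fourier_coeff B D2 k"
    using smooth_periodic_derivative[OF inv, of D2 i] D2(1) by metis
  obtain D4 where D4: "?P D4" "\<And>k. fourier_coeff B D4 k = 2 * pi * \<i> * of_int (k $ i) * fourier_coeff B D3 k"
    using smooth_periodic_derivative[OF inv, of D3 i] D3(1) by metis
  have "norm (fourier_coeff B D4 k) = \<bar>2 * pi * real_of_int (k $ i)\<bar> ^ 4 * norm (fourier_coeff B f k)" for k
    unfolding D4(2) D3(2) D2(2) D1(2) by (simp add: norm_mult abs_mult power4_eq_xxxx)
  then show ?thesis using that[of D4] D4(1) by (simp add: power_even_abs)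
qed

lemma fourier_coeff_bounded:
  fixes B :: "real^'n^'n" and f :: "real^'n \<Rightarrow> real"
  assumes "continuous_on UNIV f"
  obtains M where "M \<ge> 0" "\<And>k. norm (fourier_coeff B f k) \<le> M"
proof -
  have c: "continuous_on UNIV (\<lambda>s. f (B *v s))"
    by (rule continuous_on_compose2[OF assms continuous_matrix_vector]) auto
  have "compact ((\<lambda>s. f (B *v s)) ` unit_cube)"
    by (intro compact_continuous_image continuous_on_subset[OF c]) auto
  then obtain C where C: "\<And>s. s \<in> unit_cube \<Longrightarrow> \<bar>f (B *v s)\<bar> \<le> C" "C > 0"
    using compact_imp_bounded bounded_pos by (metis image_eqI real_norm_def)
  have "norm (fourier_coeff B f k) \<le> C * measure lborel (unit_cube :: (real^'n) set)" for k
    unfolding fourier_coeff_def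
  proof (rule integrable_bound)
    show "(\<lambda>s. complex_of_real (f (B *v s)) * cis (- (wave_vector B k \<bullet> (B *v s)))) integrable_on unit_cube"
      by (intro integrable_continuous continuous_intros continuous_on_subset[OF c] continuous_on_compose2[OF continuous_matrix_vector[of UNIV B]]) auto
  qed (use C in \<open>auto simp: norm_mult\<close>)
  then show ?thesis using that[of "C * measure lborel (unit_cube :: (real^'n) set)"] C(2) by simp
qed

text \<open>One coordinate at a time, with \<open>f\<close> general since the induction hypothesis
  is also applied to the fourth derivative. Of the two factors \<open>1 + k\<^sub>i\<^sup>2\<close>,
  one is later spent on the symbol and the other on summability over the lattice.\<close>

lemma fourier_coeff_decay:
  fixes B :: "real^'n^'n" and f :: "real^'n \<Rightarrow> real"
  assumes inv: "invertible B" and "finite I" and "smooth_on UNIV f" "lattice_periodic B f"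
  shows "\<exists>M\<ge>0. \<forall>k. norm (fourier_coeff B f k) * (\<Prod>i\<in>I. (1 + (real_of_int (k $ i))\<^sup>2)\<^sup>2) \<le> M"
  using assms(2-)
proof (induction I arbitrary: f rule: finite_induct)
  case empty
  obtain M where "M \<ge> 0" "\<And>k. norm (fourier_coeff B f k) \<le> M"
    using fourier_coeff_bounded[OF smooth_on_imp_continuous[OF empty.prems(1)], of B] by metis
  then show ?case by auto
next
  case (insert i I)
  obtain D where D: "smooth_on UNIV D" "lattice_periodic B D"
    "\<And>k. norm (fourier_coeff B D k) = (2 * pi * real_of_int (k $ i)) ^ 4 * norm (fourier_coeff B f k)"
    using smooth_periodic_fourth_derivative[OF inv insert.prems, of i] by metis
  let ?P = "\<lambda>k. \<Prod>i\<in>I. (1 + (real_of_int (k $ i))\<^sup>2)\<^sup>2"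
  obtain M where M: "M \<ge> 0" "\<And>k. norm (fourier_coeff B f k) * ?P k \<le> M" using insert.IH[OF insert.prems] by auto
  obtain M' where M': "M' \<ge> 0" "\<And>k. norm (fourier_coeff B D k) * ?P k \<le> M'" using insert.IH[OF D(1,2)] by auto
  \<comment> \<open>The outer \<open>2\<close> comes from
    \<open>(1 + j\<^sup>2)\<^sup>2 \<le> 2 * (1 + j ^ 4)\<close>; the term \<open>1\<close> is
    controlled by \<open>f\<close>, the term \<open>j ^ 4\<close> by \<open>D\<close>.\<close>
  have "norm (fourier_coeff B f k) * (\<Prod>i\<in>insert i I. (1 + (real_of_int (k $ i))\<^sup>2)\<^sup>2) \<le> 2 * (M + M')" for k
  proof -
    let ?j = "real_of_int (k $ i)"
    have "1 * ?j ^ 4 \<le> (2 * pi) ^ 4 * ?j ^ 4"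
      by (intro mult_right_mono one_le_power) (use pi_ge_two in auto)
    then have 1: "?j ^ 4 \<le> (2 * pi * ?j) ^ 4" by (simp add: power_mult_distrib)
    have "0 \<le> (1 - ?j\<^sup>2)\<^sup>2" by simp
    then have "(1 + ?j\<^sup>2)\<^sup>2 \<le> 2 * (1 + ?j ^ 4)" by (simp add: power2_eq_square power4_eq_xxxx algebra_simps)
    also have "\<dots> \<le> 2 * (1 + (2 * pi * ?j) ^ 4)" using 1 by simp
    finally have "(norm (fourier_coeff B f k) * ?P k) * (1 + ?j\<^sup>2)\<^sup>2 \<le> (norm (fourier_coeff B f k) * ?P k) * (2 * (1 + (2 * pi * ?j) ^ 4))"
      by (intro mult_left_mono) (auto intro!: mult_nonneg_nonneg prod_nonneg)
    also have "\<dots> = 2 * (norm (fourier_coeff B f k) * ?P k + norm (fourier_coeff B D k) * ?P k)"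
      unfolding D(3) by (simp add: algebra_simps)
    also have "\<dots> \<le> 2 * (M + M')" using M(2)[of k] M'(2)[of k] by simp
    finally show ?thesis using insert.hyps by (simp add: mult_ac)
  qed
  then show ?case using M(1) M'(1) by (intro exI[of _ "2 * (M + M')"]) auto
qed

section \<open>Absolute summability of the Fourier coefficients\<close>

lemma sum_inverse_square_int_bounded:
  obtains C :: real where "C \<ge> 0" "\<And>J::int set. finite J \<Longrightarrow> (\<Sum>j\<in>J. 1 / (1 + (real_of_int j)\<^sup>2)) \<le> C"
proof -
  let ?g = "\<lambda>n::nat. 1 / (1 + (real n)\<^sup>2)"
  have "summable (\<lambda>n. inverse ((real n)\<^sup>2))" by (rule inverse_power_summable) simp
  then have sg: "summable ?g"
  proof (rule summable_comparison_test_ev[rotated])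
    show "\<forall>\<^sub>F n in sequentially. norm (?g n) \<le> inverse ((real n)\<^sup>2)"
      using eventually_gt_at_top[of 0] by eventually_elim (auto simp: inverse_eq_divide intro!: divide_left_mono mult_pos_pos add_pos_nonneg)
  qed
  have half: "(\<Sum>j\<in>J. 1 / (1 + (real_of_int j)\<^sup>2)) \<le> suminf ?g" if "finite J" "inj_on (nat \<circ> abs) J" for J :: "int set"
  proof -
    have "(\<Sum>j\<in>J. 1 / (1 + (real_of_int j)\<^sup>2)) = (\<Sum>n\<in>(nat \<circ> abs) ` J. ?g n)"
      by (subst sum.reindex[OF that(2)]) (auto intro!: sum.cong)
    also have "\<dots> \<le> suminf ?g" using that by (intro sum_le_suminf sg) auto
    finally show ?thesis .
  qed
  have "(\<Sum>j\<in>J. 1 / (1 + (real_of_int j)\<^sup>2)) \<le> 2 * suminf ?g" if J: "finite J" for J :: "int set"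
  proof -
    have "(\<Sum>j\<in>J. 1 / (1 + (real_of_int j)\<^sup>2)) = (\<Sum>j\<in>(J \<inter> {0..}) \<union> (J \<inter> {..<0}). 1 / (1 + (real_of_int j)\<^sup>2))"
      by (rule sum.cong) auto
    also have "\<dots> = (\<Sum>j\<in>J \<inter> {0..}. 1 / (1 + (real_of_int j)\<^sup>2)) + (\<Sum>j\<in>J \<inter> {..<0}. 1 / (1 + (real_of_int j)\<^sup>2))"
      using J by (intro sum.union_disjoint) auto
    also have "\<dots> \<le> suminf ?g + suminf ?g"
      using J by (intro add_mono half) (auto simp: inj_on_def)
    finally show ?thesis by simp
  qed
  moreover have "2 * suminf ?g \<ge> 0" using suminf_nonneg[OF sg] by simp
  ultimately show ?thesis using that by blast
qed

text \<open>A finite set of lattice points lies in a box with equal sides \<open>J\<close>, and the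
  sum over the box is a power of a one-dimensional sum.\<close>

lemma summable_prod_inverse_square:
  "(\<lambda>k::int^'n. \<Prod>i\<in>UNIV. 1 / (1 + (real_of_int (k $ i))\<^sup>2)) summable_on UNIV"
proof -
  let ?g = "\<lambda>j. 1 / (1 + (real_of_int j)\<^sup>2)"
  have g0: "?g j \<ge> 0" for j by (simp add: add_nonneg_nonneg)
  obtain C :: real where C: "C \<ge> 0" "\<And>J::int set. finite J \<Longrightarrow> sum ?g J \<le> C"
    using sum_inverse_square_int_bounded by metis
  show ?thesis
  proof (rule nonneg_bdd_above_summable_on)
    show "0 \<le> (\<Prod>i\<in>UNIV. ?g (k $ i))" for k :: "int^'n" by (intro prod_nonneg g0)
    show "bdd_above (sum (\<lambda>k::int^'n. \<Prod>i\<in>UNIV. ?g (k $ i)) ` {F. F \<subseteq> UNIV \<and> finite F})"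
    proof (rule bdd_aboveI2)
      fix F :: "(int^'n) set" assume "F \<in> {F. F \<subseteq> UNIV \<and> finite F}"
      then have F: "finite F" by simp
      define J where "J = (\<Union>i. (\<lambda>k. k $ i) ` F)"
      have J: "finite J" unfolding J_def using F by auto
      have "(\<Sum>k\<in>F. \<Prod>i\<in>UNIV. ?g (k $ i)) = (\<Sum>h\<in>vec_nth ` F. \<Prod>i\<in>UNIV. ?g (h i))"
        by (subst sum.reindex) (auto simp: inj_on_def vec_nth_inject)
      also have "\<dots> \<le> (\<Sum>h\<in>(UNIV :: 'n set) \<rightarrow>\<^sub>E J. \<Prod>i\<in>UNIV. ?g (h i))"
      proof (rule sum_mono2)
        show "finite (UNIV \<rightarrow>\<^sub>E J :: ('n \<Rightarrow> int) set)" by (rule finite_PiE) (auto simp: J)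
        show "vec_nth ` F \<subseteq> UNIV \<rightarrow>\<^sub>E J" by (auto simp: J_def)
      qed (intro prod_nonneg g0)
      also have "\<dots> = (\<Prod>i\<in>(UNIV::'n set). sum ?g J)"
        by (rule prod_sum_PiE[symmetric]) (auto simp: J)
      also have "\<dots> \<le> (\<Prod>i\<in>(UNIV::'n set). C)"
        using J by (intro prod_mono) (auto intro!: sum_nonneg C g0)
      finally show "(\<Sum>k\<in>F. \<Prod>i\<in>UNIV. ?g (k $ i)) \<le> C ^ CARD('n)" by simp
    qed
  qed
qed

text \<open>The weight dominates both \<open>1\<close> and the symbol
  \<open>norm (wave_vector B k) powr (2 * \<alpha>)\<close>, so one statement yields both
  summability conditions of the dissipation bound.\<close>

lemma fourier_coeff_summable:
  fixes B :: "real^'n^'n" and f :: "real^'n \<Rightarrow> real"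
  assumes inv: "invertible B" and sm: "smooth_on UNIV f" and per: "lattice_periodic B f"
  shows "(\<lambda>k. (1 + (norm (wave_vector B k))\<^sup>2) * norm (fourier_coeff B f k)) summable_on UNIV"
proof -
  let ?L = "\<lambda>v. (2 * pi) *\<^sub>R (transpose (matrix_inv B) *v v) :: real^'n"
  have "bounded_linear ?L"
    by (intro bounded_linear_scaleR_right matrix_vector_mul_bounded_linear bounded_linear_const_scaleR bounded_linear_compose[OF bounded_linear_scaleR_right])
  then obtain K where K: "\<And>v. norm (?L v) \<le> norm v * K" using bounded_linear.bounded by blast
  obtain M where M: "M \<ge> 0" "\<And>k. norm (fourier_coeff B f k) * (\<Prod>i\<in>UNIV. (1 + (real_of_int (k $ i))\<^sup>2)\<^sup>2) \<le> M"
    using fourier_coeff_decay[OF inv finite sm per, of UNIV] by blast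
  let ?P = "\<lambda>k::int^'n. \<Prod>i\<in>UNIV. 1 + (real_of_int (k $ i))\<^sup>2"
  have P1: "?P k \<ge> 1" for k by (intro prod_ge_1) auto
  \<comment> \<open>Expanding the product produces every single square among its nonnegative
    terms.\<close>
  have sumP: "(\<Sum>i\<in>I. (real_of_int (k $ i))\<^sup>2) \<le> (\<Prod>i\<in>I. 1 + (real_of_int (k $ i))\<^sup>2)" if "finite I" for I and k :: "int^'n"
    using that
  proof induction
    case (insert i I)
    have "1 \<le> (\<Prod>i\<in>I. 1 + (real_of_int (k $ i))\<^sup>2)" by (intro prod_ge_1) auto
    then have "(real_of_int (k $ i))\<^sup>2 * 1 \<le> (real_of_int (k $ i))\<^sup>2 * (\<Prod>i\<in>I. 1 + (real_of_int (k $ i))\<^sup>2)"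
      by (intro mult_left_mono) auto
    then show ?case using insert by (simp add: algebra_simps)
  qed simp
  have wv: "1 + (norm (wave_vector B k))\<^sup>2 \<le> (1 + K\<^sup>2) * ?P k" for k
  proof -
    have "(norm (int_vec k))\<^sup>2 = (\<Sum>i\<in>UNIV. (real_of_int (k $ i))\<^sup>2)"
      unfolding power2_norm_eq_inner inner_vec_def by (simp add: power2_eq_square)
    then have n: "(norm (int_vec k))\<^sup>2 \<le> ?P k" using sumP[of UNIV k] by simp
    have "norm (wave_vector B k) \<le> norm (int_vec k) * K"
      unfolding wave_vector_def by (rule K)
    then have "(norm (wave_vector B k))\<^sup>2 \<le> (norm (int_vec k) * K)\<^sup>2" by (rule power_mono) simp
    also have "\<dots> \<le> K\<^sup>2 * ?P k" using mult_left_mono[OF n, of "K\<^sup>2"] by (simp add: power_mult_distrib mult.commute)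
    finally show ?thesis using P1[of k] by (simp add: algebra_simps)
  qed
  show ?thesis
  proof (rule summable_on_comparison_test[OF summable_on_cmult_right[OF summable_prod_inverse_square, of "(1 + K\<^sup>2) * M"]])
    fix k :: "int^'n"
    let ?c = "norm (fourier_coeff B f k)"
    have "?c * (?P k)\<^sup>2 \<le> M" using M(2)[of k] by (simp add: prod_power_distrib)
    then have "?c * ?P k \<le> M / ?P k" using P1[of k] by (simp add: pos_le_divide_eq power2_eq_square mult.assoc)
    then have "(1 + K\<^sup>2) * (?c * ?P k) \<le> (1 + K\<^sup>2) * (M / ?P k)" by (intro mult_left_mono) auto
    moreover have "(1 + (norm (wave_vector B k))\<^sup>2) * ?c \<le> ((1 + K\<^sup>2) * ?P k) * ?c"
      by (intro mult_right_mono wv) auto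
    moreover have "(\<Prod>i\<in>UNIV. 1 / (1 + (real_of_int (k $ i))\<^sup>2)) = 1 / ?P k" by (simp add: prod_dividef)
    ultimately show "(1 + (norm (wave_vector B k))\<^sup>2) * ?c \<le> (1 + K\<^sup>2) * M * (\<Prod>i\<in>UNIV. 1 / (1 + (real_of_int (k $ i))\<^sup>2))"
      by (simp add: mult_ac)
  qed auto
qed

section \<open>Uniqueness and inversion of Fourier series\<close>

text \<open>The class is closed under multiplication by trigonometric polynomials, which permits
  testing against peaked ones. Periodicity is left out because the closure properties and the peak
  argument take place on a single cube.\<close>

definition zero_coeffs :: "(real^'n \<Rightarrow> complex) \<Rightarrow> bool" where
  "zero_coeffs \<psi> \<longleftrightarrow> continuous_on UNIV \<psi> \<and>
     (\<forall>k. integral unit_cube (\<lambda>s. \<psi> s * cis (2 * pi * (int_vec k \<bullet> s))) = 0)"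

lemma zero_coeffs_integrable:
  "zero_coeffs \<psi> \<Longrightarrow> (\<lambda>s. \<psi> s * cis (2 * pi * (int_vec k \<bullet> s))) integrable_on unit_cube"
  unfolding zero_coeffs_def
  by (intro integrable_continuous continuous_intros) (auto intro: continuous_on_subset)

lemma zero_coeffs_add:
  assumes "zero_coeffs \<psi>" "zero_coeffs \<phi>"
  shows "zero_coeffs (\<lambda>s. \<psi> s + \<phi> s)"
  using assms integral_add[OF zero_coeffs_integrable[OF assms(1)] zero_coeffs_integrable[OF assms(2)]]
  unfolding zero_coeffs_def by (auto intro: continuous_on_add simp: distrib_right)

lemma zero_coeffs_cmult:
  assumes "zero_coeffs \<psi>"
  shows "zero_coeffs (\<lambda>s. \<psi> s * c)"
proof -
  have "integral unit_cube (\<lambda>s. \<psi> s * c * cis (2 * pi * (int_vec k \<bullet> s)))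
      = c * integral unit_cube (\<lambda>s. \<psi> s * cis (2 * pi * (int_vec k \<bullet> s)))" for k
    unfolding integral_mult_right[symmetric] by (simp only: mult_ac)
  then show ?thesis
    using assms unfolding zero_coeffs_def by (auto intro: continuous_on_mult continuous_on_const)
qed

lemma zero_coeffs_shift:
  fixes \<psi> :: "real^'n \<Rightarrow> complex"
  assumes "zero_coeffs \<psi>"
  shows "zero_coeffs (\<lambda>s. \<psi> s * cis (2 * pi * (int_vec j \<bullet> s)))"
proof -
  have eq: "\<psi> s * cis (2 * pi * (int_vec j \<bullet> s)) * cis (2 * pi * (int_vec k \<bullet> s)) = \<psi> s * cis (2 * pi * (int_vec (j + k) \<bullet> s))" for k s
  proof -
    have "int_vec (j + k) = int_vec j + int_vec k" by (simp add: vec_eq_iff)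
    then show ?thesis by (simp only: inner_add_left distrib_left cis_mult[symmetric] mult.assoc)
  qed
  show ?thesis
    unfolding zero_coeffs_def eq
  proof (intro conjI allI)
    show "continuous_on UNIV (\<lambda>s. \<psi> s * cis (2 * pi * (int_vec j \<bullet> s)))"
      using assms by (auto simp: zero_coeffs_def intro!: continuous_intros)
    show "integral unit_cube (\<lambda>s. \<psi> s * cis (2 * pi * (int_vec (j + k) \<bullet> s))) = 0" for k
      using assms unfolding zero_coeffs_def by blast
  qed
qed

text \<open>The cosine is a combination of two characters, and multiplying by a character only
  shifts the index of the vanishing integrals.\<close>

lemma zero_coeffs_cos_factor:
  fixes \<psi> :: "real^'n \<Rightarrow> complex"
  assumes "zero_coeffs \<psi>"
  shows "zero_coeffs (\<lambda>s. \<psi> s * complex_of_real ((1 + cos (2 * pi * (s $ i - a))) / 2))"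
proof -
  let ?e = "axis i 1 :: int^'n"
  have i1: "int_vec ?e \<bullet> s = s $ i" for s
  proof -
    have "int_vec ?e = axis i 1" by (simp add: vec_eq_iff axis_def)
    then show ?thesis by (simp add: inner_axis')
  qed
  have i2: "int_vec (- ?e) \<bullet> s = - (s $ i)" for s
  proof -
    have "int_vec (- ?e) = - axis i 1" by (simp add: vec_eq_iff axis_def)
    then show ?thesis by (simp add: inner_axis')
  qed
  have eq: "complex_of_real ((1 + cos (2 * pi * (s $ i - a))) / 2)
     = 1 / 2 + cis (2 * pi * (int_vec ?e \<bullet> s)) * (cis (- 2 * pi * a) / 4) + cis (2 * pi * (int_vec (- ?e) \<bullet> s)) * (cis (2 * pi * a) / 4)" for s
  proof -
    have e1: "cis (2 * pi * (int_vec ?e \<bullet> s)) * (cis (- 2 * pi * a) / 4) = cis (2 * pi * (s $ i - a)) / 4"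
      unfolding i1 by (simp add: cis_mult algebra_simps)
    have e2: "cis (2 * pi * (int_vec (- ?e) \<bullet> s)) * (cis (2 * pi * a) / 4) = cis (- (2 * pi * (s $ i - a))) / 4"
      unfolding i2 by (simp add: cis_mult algebra_simps)
    show ?thesis unfolding e1 e2 by (simp add: complex_eq_iff)
  qed
  have "zero_coeffs (\<lambda>s. \<psi> s * (1 / 2) + \<psi> s * cis (2 * pi * (int_vec ?e \<bullet> s)) * (cis (- 2 * pi * a) / 4)
       + \<psi> s * cis (2 * pi * (int_vec (- ?e) \<bullet> s)) * (cis (2 * pi * a) / 4))"
    by (intro zero_coeffs_add zero_coeffs_cmult zero_coeffs_shift assms)
  then show ?thesis unfolding eq by (simp only: distrib_left mult.assoc)
qed

lemma zero_coeffs_peak: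
  assumes "zero_coeffs \<psi>"
  shows "zero_coeffs (\<lambda>s. \<psi> s * complex_of_real (((\<Prod>i\<in>UNIV. (1 + cos (2 * pi * (s $ i - a $ i))) / 2) + d) ^ n))"
proof -
  let ?q = "\<lambda>s i. (1 + cos (2 * pi * (s $ i - a $ i))) / 2"
  have Q: "zero_coeffs (\<lambda>s. \<phi> s * complex_of_real (\<Prod>i\<in>I. ?q s i))" if "zero_coeffs \<phi>" "finite I" for \<phi> I
    using that(2)
  proof induction
    case (insert i I)
    have "zero_coeffs (\<lambda>s. \<phi> s * complex_of_real (\<Prod>i\<in>I. ?q s i) * complex_of_real (?q s i))"
      by (rule zero_coeffs_cos_factor[OF insert.IH])
    moreover have "\<phi> s * complex_of_real (\<Prod>i\<in>I. ?q s i) * complex_of_real (?q s i) = \<phi> s * complex_of_real (\<Prod>i\<in>insert i I. ?q s i)" for s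
      using insert.hyps by (simp add: mult_ac)
    ultimately show ?case by (simp only:)
  qed (use that in simp)
  show ?thesis
  proof (induction n)
    case (Suc n)
    have "zero_coeffs (\<lambda>s. \<psi> s * complex_of_real (((\<Prod>i\<in>UNIV. ?q s i) + d) ^ n) * complex_of_real (\<Prod>i\<in>UNIV. ?q s i)
        + \<psi> s * complex_of_real (((\<Prod>i\<in>UNIV. ?q s i) + d) ^ n) * complex_of_real d)"
      by (intro zero_coeffs_add Q zero_coeffs_cmult Suc) simp
    moreover have "\<psi> s * complex_of_real (((\<Prod>i\<in>UNIV. ?q s i) + d) ^ n) * complex_of_real (\<Prod>i\<in>UNIV. ?q s i)
        + \<psi> s * complex_of_real (((\<Prod>i\<in>UNIV. ?q s i) + d) ^ n) * complex_of_real d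
        = \<psi> s * complex_of_real (((\<Prod>i\<in>UNIV. ?q s i) + d) ^ Suc n)" for s
    proof -
      have gen: "p * complex_of_real (z ^ n) * complex_of_real y + p * complex_of_real (z ^ n) * complex_of_real d = p * complex_of_real (z ^ Suc n)"
        if "z = y + d" for p y z using that by (simp add: algebra_simps)
      show ?thesis by (rule gen) simp
    qed
    ultimately show ?case by (simp only:)
  qed (use assms in simp)
qed

lemma cos_2pi_eq_1_small:
  assumes "cos (2 * pi * x) = 1" "\<bar>x\<bar> < 1"
  shows "x = 0"
proof -
  obtain n :: int where "2 * pi * x = of_int n * 2 * pi" using assms(1) cos_one_2pi_int by auto
  then have "x = of_int n" by simp
  then show ?thesis using assms(2) by simp
qed

text \<open>Powers of the trigonometric polynomial \<open>Q + \<delta>/2\<close>, where \<open>Q \<le> 1\<close> peaks at \<open>a\<close> only, are at least \<open>1\<close>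
  near \<open>a\<close> and tend to \<open>0\<close> wherever \<open>Re \<psi>\<close> can be negative.\<close>

lemma zero_coeffs_Re_le:
  fixes \<psi> :: "real^'n \<Rightarrow> complex"
  assumes zc: "zero_coeffs \<psi>" and a: "a \<in> box 0 1"
  shows "Re (\<psi> a) \<le> 0"
proof (rule ccontr)
  assume pos: "\<not> Re (\<psi> a) \<le> 0"
  define m where "m = Re (\<psi> a) / 2"
  have m: "m > 0" "Re (\<psi> a) > m" using pos by (auto simp: m_def)
  define \<phi> where "\<phi> s = Re (\<psi> s)" for s
  have \<phi>c: "continuous_on UNIV \<phi>" unfolding \<phi>_def using zc by (auto simp: zero_coeffs_def intro!: continuous_intros)
  define Q where "Q s = (\<Prod>i\<in>UNIV. (1 + cos (2 * pi * (s $ i - a $ i))) / 2)" for s :: "real^'n"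
  have Qc: "continuous_on UNIV Q" unfolding Q_def by (intro continuous_intros) auto
  have q01: "0 \<le> (1 + cos x) / 2" "(1 + cos x) / 2 \<le> 1" for x :: real
  proof -
    show "0 \<le> (1 + cos x) / 2" using abs_cos_le_one[of x] unfolding abs_le_iff by argo
    show "(1 + cos x) / 2 \<le> 1" using cos_le_one[of x] by argo
  qed
  have Q0: "Q s \<ge> 0" for s unfolding Q_def by (intro prod_nonneg q01)
  have Qa: "Q a = 1" by (simp add: Q_def)
  have Q_lt: "Q s < 1" if s: "s \<in> unit_cube" "s \<noteq> a" for s
  proof -
    obtain i where i: "s $ i \<noteq> a $ i" using s(2) by (auto simp: vec_eq_iff)
    have "0 \<le> s $ i" "s $ i \<le> 1" "0 < a $ i" "a $ i < 1" using s(1) a by (auto simp: mem_box_cart)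
    then have "\<bar>s $ i - a $ i\<bar> < 1" unfolding abs_less_iff by argo
    then have "cos (2 * pi * (s $ i - a $ i)) \<noteq> 1" using cos_2pi_eq_1_small[of "s $ i - a $ i"] i by auto
    then have "cos (2 * pi * (s $ i - a $ i)) < 1" using cos_le_one[of "2 * pi * (s $ i - a $ i)"] by (simp add: order_less_le)
    then have lt: "(1 + cos (2 * pi * (s $ i - a $ i))) / 2 < 1" by argo
    have "Q s = (1 + cos (2 * pi * (s $ i - a $ i))) / 2 * (\<Prod>i\<in>UNIV - {i}. (1 + cos (2 * pi * (s $ i - a $ i))) / 2)"
      unfolding Q_def by (rule prod.remove) auto
    also have "\<dots> \<le> (1 + cos (2 * pi * (s $ i - a $ i))) / 2"
      by (intro mult_right_le_one_le prod_le_1 prod_nonneg conjI q01)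
    finally show ?thesis using lt by simp
  qed
  define K where "K = {s \<in> unit_cube. \<phi> s \<le> m}"
  have "closed {s. \<phi> s \<le> m}" using \<phi>c by (intro closed_Collect_le continuous_intros)
  then have Kc: "compact K" unfolding K_def using compact_Int_closed[of unit_cube "{s. \<phi> s \<le> m}"] by (simp add: Int_def)
  \<comment> \<open>\<open>K\<close> misses \<open>a\<close>, the only point of the closed cube
    where \<open>Q\<close> reaches \<open>1\<close>, so compactness keeps \<open>Q\<close> below
    \<open>1\<close> on \<open>K\<close> by a margin.\<close>
  obtain \<delta> where \<delta>: "0 < \<delta>" "\<delta> \<le> 1" "\<And>s. s \<in> K \<Longrightarrow> Q s \<le> 1 - \<delta>"
  proof (cases "K = {}")
    case False
    then obtain s0 where s0: "s0 \<in> K" "\<And>s. s \<in> K \<Longrightarrow> Q s \<le> Q s0"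
      using continuous_attains_sup[OF Kc False continuous_on_subset[OF Qc]] by auto
    have "s0 \<noteq> a" using s0(1) m(2) by (auto simp: K_def \<phi>_def)
    then have "Q s0 < 1" using s0(1) Q_lt by (auto simp: K_def)
    then show ?thesis using that[of "1 - Q s0"] s0(2) Q0[of s0] by auto
  qed (use that[of 1] in auto)
  \<comment> \<open>Shifting by half the margin puts \<open>p\<close> above \<open>1\<close> near
    \<open>a\<close> while keeping it at most \<open>1 - \<delta> / 2\<close> on
    \<open>K\<close>.\<close>
  define p where "p s = Q s + \<delta> / 2" for s
  have p0: "p s \<ge> 0" for s using Q0[of s] \<delta>(1) by (simp add: p_def)
  have pc: "continuous_on UNIV p" unfolding p_def by (intro continuous_intros Qc)
  define V where "V = box 0 1 \<inter> ({s. m < \<phi> s} \<inter> {s. 1 - \<delta> / 2 < Q s})"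
  have "open V" unfolding V_def
    by (intro open_Int open_box open_Collect_less continuous_on_const \<phi>c Qc)
  moreover have "a \<in> V" using a m(2) \<delta>(1) Qa by (auto simp: V_def \<phi>_def)
  ultimately obtain u v where uv: "a \<in> box u v" "cbox u v \<subseteq> V"
    using open_contains_cbox[of V a] by metis
  define c0 where "c0 = measure lborel (cbox u v)"
  have c0: "c0 > 0" unfolding c0_def using uv(1) content_pos_lt_eq box_ne_empty(2) by (metis empty_iff)
  have "compact (\<phi> ` unit_cube)" by (intro compact_continuous_image continuous_on_subset[OF \<phi>c]) auto
  then obtain C where C: "\<And>s. s \<in> unit_cube \<Longrightarrow> \<bar>\<phi> s\<bar> \<le> C" "C > 0"
    using compact_imp_bounded bounded_pos by (metis image_eqI real_norm_def)
  have uvc: "cbox u v \<subseteq> unit_cube" using uv(2) box_subset_cbox[of 0 1] by (auto simp: V_def)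
  let ?I = "measure lborel (unit_cube :: (real^'n) set)"
  \<comment> \<open>The integral of \<open>\<phi> * p ^ n\<close> is \<open>0\<close>, but the
    integrand is at least \<open>m\<close> on the small box, nonnegative outside \<open>K\<close>,
    and at least \<open>- C * (1 - \<delta> / 2) ^ n\<close> on \<open>K\<close>.\<close>
  have bound: "m * c0 \<le> C * (1 - \<delta> / 2) ^ n * ?I" for n
  proof -
    let ?l = "\<lambda>s. (if s \<in> cbox u v then m else 0) - C * (1 - \<delta> / 2) ^ n"
    have h1: "((\<lambda>s. if s \<in> cbox u v then m else 0) has_integral m * c0) unit_cube"
      using has_integral_const[of m u v] uvc by (simp add: c0_def mult.commute)
    have h2: "((\<lambda>s. C * (1 - \<delta> / 2) ^ n) has_integral ?I * (C * (1 - \<delta> / 2) ^ n)) (unit_cube :: (real^'n) set)"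
      using has_integral_const[of "C * (1 - \<delta> / 2) ^ n" 0 1] by simp
    have "integral unit_cube (\<lambda>s. \<psi> s * complex_of_real (p s ^ n)) = 0"
      using zero_coeffs_peak[OF zc, of a "\<delta> / 2" n] unfolding zero_coeffs_def p_def Q_def
      by (auto dest!: spec[of _ "0 :: int^'n"] simp: zero_vec_def[symmetric] simp del: of_real_power)
    moreover have ci: "(\<lambda>s. \<psi> s * complex_of_real (p s ^ n)) integrable_on unit_cube"
      using zc unfolding zero_coeffs_def
      by (intro integrable_continuous continuous_intros continuous_on_subset[OF pc]) (auto intro: continuous_on_subset)
    ultimately have h3: "((\<lambda>s. \<phi> s * p s ^ n) has_integral 0) unit_cube"
      using has_integral_linear[OF integrable_integral[OF ci] bounded_linear_Re] by (simp add: o_def \<phi>_def)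
    have "m * c0 - ?I * (C * (1 - \<delta> / 2) ^ n) \<le> 0"
    proof (rule has_integral_le[OF has_integral_diff[OF h1 h2] h3])
      fix s :: "real^'n" assume s: "s \<in> unit_cube"
      have C0: "0 \<le> C * (1 - \<delta> / 2) ^ n" using C(2) \<delta>(2) by simp
      show "?l s \<le> \<phi> s * p s ^ n"
      proof (cases "s \<in> cbox u v")
        case True
        then have "m < \<phi> s" "1 \<le> p s" using uv(2) by (auto simp: V_def p_def)
        then have "m * 1 \<le> \<phi> s * p s ^ n" using m(1) by (intro mult_mono one_le_power) auto
        then show ?thesis using True C0 by simp
      next
        case False
        show ?thesis
        proof (cases "s \<in> K")
          case True
          have "p s ^ n \<le> (1 - \<delta> / 2) ^ n"
            using \<delta>(3)[OF True] p0 by (intro power_mono) (auto simp: p_def)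
          then have "\<bar>\<phi> s\<bar> * p s ^ n \<le> C * (1 - \<delta> / 2) ^ n"
            using C(1)[OF s] C(2) p0 by (intro mult_mono) auto
          moreover have "- (\<phi> s * p s ^ n) \<le> \<bar>\<phi> s\<bar> * p s ^ n"
            using mult_right_mono[of "- \<phi> s" "\<bar>\<phi> s\<bar>" "p s ^ n"] p0[of s] by simp
          ultimately show ?thesis using False by simp
        next
          case nK: False
          then have "\<phi> s > 0" using s m(1) by (auto simp: K_def)
          then have "0 \<le> \<phi> s * p s ^ n" using p0[of s] by simp
          then show ?thesis using False C0 by simp
        qed
      qed
    qed
    then show ?thesis by (simp add: mult_ac)
  qed
  have "(\<lambda>n. C * (1 - \<delta> / 2) ^ n * ?I) \<longlonglongrightarrow> C * 0 * ?I"
    using \<delta> by (intro tendsto_intros LIMSEQ_power_zero) auto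
  then have "m * c0 \<le> C * 0 * ?I"
    by (rule LIMSEQ_le_const) (use bound in blast)
  then show False using m(1) c0 by (simp add: mult_le_0_iff)
qed

text \<open>Multiplying by \<open>1\<close>, \<open>- 1\<close>, \<open>\<i>\<close> and
  \<open>- \<i>\<close> turns the one-sided bound into vanishing at interior points. Boundary
  points, where the peak would have a periodic copy in the cube, follow by density, and all others
  by subtracting integer parts.\<close>

lemma zero_coeffs_imp_zero:
  fixes \<psi> :: "real^'n \<Rightarrow> complex"
  assumes zc: "zero_coeffs \<psi>" and per: "\<And>s i. \<psi> (s + axis i 1) = \<psi> s"
  shows "\<psi> s = 0"
proof -
  have Re0: "Re (\<psi> a * c) \<le> 0" if "a \<in> box 0 1" for a c
    by (rule zero_coeffs_Re_le[OF zero_coeffs_cmult[OF zc] that])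
  have "\<psi> a = 0" if "a \<in> box 0 1" for a
    using Re0[OF that, of 1] Re0[OF that, of "- 1"] Re0[OF that, of \<i>] Re0[OF that, of "- \<i>"]
    by (simp add: complex_eq_iff)
  moreover have "closure (box 0 1 :: (real^'n) set) = unit_cube"
    by (rule closure_box) (simp add: box_ne_empty Basis_vec_def inner_axis)
  ultimately have cube: "\<psi> a = 0" if "a \<in> unit_cube" for a
    using continuous_constant_on_closure[of "box 0 1" \<psi> 0 a] zc that
    by (metis UNIV_I continuous_on_subset subsetI zero_coeffs_def)
  have int1: "\<psi> (s + of_int z *\<^sub>R axis i 1) = \<psi> s" for s i z
  proof (induction z rule: int_induct[where k = 0])
    case (step1 z)
    then show ?case using per[of "s + of_int z *\<^sub>R axis i 1" i] by (simp add: algebra_simps)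
  next
    case (step2 z)
    then show ?case using per[of "s + of_int (z - 1) *\<^sub>R axis i 1" i] by (simp add: algebra_simps)
  qed simp
  have "\<psi> (t + (\<Sum>i\<in>I. of_int (z i) *\<^sub>R axis i 1)) = \<psi> t" if "finite I" for I z t
    using that
  proof (induction arbitrary: t)
    case (insert i I)
    then show ?case using int1[of t "z i" i] insert.IH[of "t + of_int (z i) *\<^sub>R axis i 1"] by (simp add: add.assoc)
  qed simp
  from this[of UNIV "\<chi> i. frac (s $ i)" "\<lambda>i. \<lfloor>s $ i\<rfloor>"]
  have "\<psi> ((\<chi> i. frac (s $ i)) + (\<Sum>i\<in>UNIV. of_int \<lfloor>s $ i\<rfloor> *\<^sub>R axis i 1)) = \<psi> (\<chi> i. frac (s $ i))" by simp
  moreover have "(\<chi> i. frac (s $ i)) + (\<Sum>i\<in>UNIV. of_int \<lfloor>s $ i\<rfloor> *\<^sub>R axis i 1) = s"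
  proof -
    have "(\<Sum>i\<in>UNIV. of_int \<lfloor>s $ i\<rfloor> *\<^sub>R (axis i 1 :: real^'n)) $ j = of_int \<lfloor>s $ j\<rfloor>" for j
      by (simp add: axis_def if_distrib sum.delta cong: if_cong)
    then show ?thesis by (simp add: vec_eq_iff frac_def)
  qed
  moreover have "(\<chi> i. frac (s $ i)) \<in> unit_cube"
    by (auto simp: mem_box_cart frac_ge_0 intro: less_imp_le frac_lt_1)
  ultimately show ?thesis using cube by metis
qed

section \<open>Orthogonality of characters and Fourier inversion\<close>

lemma integral_unit_cube_character:
  "integral unit_cube (\<lambda>s::real^'n. cis (2 * pi * (int_vec m \<bullet> s))) = (if m = 0 then 1 else 0)"
proof (cases "m = 0")
  case True
  have "measure lborel (unit_cube :: (real^'n) set) = 1"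
    by (subst content_cbox_cart) (auto simp: interval_ne_empty_cart)
  moreover have "int_vec m = (0 :: real^'n)" using True by (simp add: vec_eq_iff)
  ultimately show ?thesis using True by simp
next
  case False
  then obtain i where i: "m $ i \<noteq> 0" by (auto simp: vec_eq_iff)
  let ?E = "\<lambda>s::real^'n. cis (2 * pi * (int_vec m \<bullet> s))"
  let ?c = "\<i> * complex_of_real (2 * pi * real_of_int (m $ i))"
  have cE: "continuous_on UNIV ?E" by (intro continuous_intros)
  \<comment> \<open>Orthogonality comes from the derivative of the character in a direction where
    its frequency is nonzero.\<close>
  have "integral unit_cube (\<lambda>s. ?c * ?E s) = 0"
  proof (rule integral_unit_cube_derivative[where i = i, OF cE])
    show "continuous_on UNIV (\<lambda>s. ?c * ?E s)" by (intro continuous_intros)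
    show "?E (s + axis i 1) = ?E s" for s by (rule cis_2pi_int_vec_periodic)
    fix s h
    have ph: "2 * pi * (int_vec m \<bullet> (s + h *\<^sub>R axis i 1)) = 2 * pi * (int_vec m \<bullet> s) + h * (2 * pi * real_of_int (m $ i))" for h
      by (simp add: inner_add_right inner_axis algebra_simps)
    show "((\<lambda>h. ?E (s + h *\<^sub>R axis i 1)) has_vector_derivative ?c * ?E (s + h *\<^sub>R axis i 1)) (at h)"
      unfolding ph by (rule has_vector_derivative_cis_affine)
  qed
  then show ?thesis using i False by simp
qed

lemma trig_series_fourier_coeff:
  fixes a :: "int^'n \<Rightarrow> complex"
  assumes a: "(\<lambda>k. norm (a k)) summable_on UNIV"
  shows "integral unit_cube (\<lambda>s. (\<Sum>\<^sub>\<infinity>j. a j * cis (2 * pi * (int_vec j \<bullet> s))) * cis (2 * pi * (int_vec k \<bullet> s))) = a (- k)"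
proof -
  let ?E = "\<lambda>j s. cis (2 * pi * (int_vec j \<bullet> s))"
  let ?F = "\<lambda>X s. \<Sum>j\<in>X. a j * ?E j s * ?E k s"
  have EE: "?E j s * ?E k s = ?E (j + k) s" for j s
  proof -
    have "int_vec (j + k) = int_vec j + int_vec k" by (simp add: vec_eq_iff)
    then show ?thesis by (simp only: inner_add_left distrib_left cis_mult)
  qed
  have "uniform_limit UNIV ?F (\<lambda>s. \<Sum>\<^sub>\<infinity>j. a j * ?E j s * ?E k s) (finite_subsets_at_top UNIV)"
    by (rule Weierstrass_m_test_general[where M = "\<lambda>k. norm (a k)"]) (auto simp: norm_mult a)
  moreover have "(\<Sum>\<^sub>\<infinity>j. a j * ?E j s * ?E k s) = (\<Sum>\<^sub>\<infinity>j. a j * ?E j s) * ?E k s" for s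
  proof (rule infsum_cmult_left)
    show "(\<lambda>j. a j * ?E j s) summable_on UNIV"
      by (rule abs_summable_summable) (use a in \<open>simp add: norm_mult\<close>)
  qed
  ultimately have lim: "uniform_limit unit_cube ?F (\<lambda>s. (\<Sum>\<^sub>\<infinity>j. a j * ?E j s) * ?E k s) (finite_subsets_at_top UNIV)"
    by (auto intro: uniform_limit_on_subset)
  obtain I J where I: "\<And>X. (?F X has_integral I X) unit_cube"
    and J: "((\<lambda>s. (\<Sum>\<^sub>\<infinity>j. a j * ?E j s) * ?E k s) has_integral J) unit_cube" and IJ: "(I \<longlongrightarrow> J) (finite_subsets_at_top UNIV)"
    by (rule uniform_limit_integral_cbox[OF lim]) (auto intro!: continuous_intros)
  have Ieq: "I X = (\<Sum>j\<in>X. if j = - k then a j else 0)" for X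
  proof -
    have h: "((\<lambda>s. a j * ?E j s * ?E k s) has_integral (if j = - k then a j else 0)) unit_cube" for j
    proof -
      have "?E (j + k) integrable_on unit_cube" by (intro integrable_continuous continuous_intros)
      then have "((\<lambda>s. a j * ?E (j + k) s) has_integral a j * (if j + k = 0 then 1 else 0)) unit_cube"
        using has_integral_mult_right[OF integrable_integral, of "?E (j + k)" unit_cube "a j"]
        unfolding integral_unit_cube_character by simp
      moreover have "(\<lambda>s. a j * ?E j s * ?E k s) = (\<lambda>s. a j * ?E (j + k) s)"
        unfolding EE[symmetric] by (rule ext) (rule mult.assoc)
      moreover have "a j * (if j + k = 0 then 1 else 0) = (if j = - k then a j else 0)"
        by (simp add: eq_neg_iff_add_eq_0)
      ultimately show ?thesis by (simp only:)
    qed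
    show ?thesis
    proof (cases "finite X")
      case True
      then show ?thesis using has_integral_unique[OF I has_integral_sum[OF True h]] by simp
    next
      \<comment> \<open>Sums over an infinite set are \<open>0\<close> by convention, so
        \<open>?F X\<close> is the zero function and \<open>I X = 0\<close>.\<close>
      case False
      then show ?thesis using I[of X] by simp
    qed
  qed
  have "\<forall>\<^sub>F X in finite_subsets_at_top UNIV. I X = a (- k)"
    unfolding eventually_finite_subsets_at_top Ieq
    by (rule exI[of _ "{- k}"]) (auto simp: sum.delta)
  then have "(I \<longlongrightarrow> a (- k)) (finite_subsets_at_top UNIV)" by (rule tendsto_eventually)
  then have "J = a (- k)" using tendsto_unique[OF _ IJ] by simp
  then show ?thesis using J by (simp add: integral_unique)
qed

text \<open>In cube coordinates both \<open>f\<close> and its series are continuous, periodic and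
  have the same coefficients; their difference vanishes by uniqueness.\<close>

lemma fourier_inversion:
  fixes B :: "real^'n^'n" and f :: "real^'n \<Rightarrow> real"
  assumes inv: "invertible B" and cont: "continuous_on UNIV f" and per: "lattice_periodic B f"
    and sum: "(\<lambda>k. norm (fourier_coeff B f k)) summable_on UNIV"
  shows "complex_of_real (f x) = trig_series (wave_vector B) (fourier_coeff B f) x"
proof -
  let ?a = "fourier_coeff B f"
  let ?T = "trig_series (wave_vector B) ?a"
  let ?E = "\<lambda>k s. cis (2 * pi * (int_vec k \<bullet> s))"
  define \<psi> where "\<psi> s = complex_of_real (f (B *v s)) - ?T (B *v s)" for s
  have T: "?T (B *v s) = (\<Sum>\<^sub>\<infinity>j. ?a j * ?E j s)" for s
    unfolding trig_series_def wave_vector_inner[OF inv] ..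
  have c1: "continuous_on UNIV (\<lambda>s. complex_of_real (f (B *v s)))"
    by (intro continuous_intros continuous_on_compose2[OF cont continuous_matrix_vector]) auto
  have c2: "continuous_on UNIV (\<lambda>s. ?T (B *v s))"
    by (rule continuous_on_compose2[OF continuous_trig_series[OF sum] continuous_matrix_vector]) auto
  have "zero_coeffs \<psi>"
    unfolding zero_coeffs_def
  proof (intro conjI allI)
    show "continuous_on UNIV \<psi>" unfolding \<psi>_def by (rule continuous_on_diff[OF c1 c2])
    fix k
    have i: "(\<lambda>s. complex_of_real (f (B *v s)) * ?E k s) integrable_on unit_cube"
      "(\<lambda>s. ?T (B *v s) * ?E k s) integrable_on unit_cube"
      by (intro integrable_continuous continuous_on_mult continuous_on_subset[OF c1] continuous_on_subset[OF c2] continuous_intros; simp)+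
    have "integral unit_cube (\<lambda>s. \<psi> s * ?E k s)
        = integral unit_cube (\<lambda>s. complex_of_real (f (B *v s)) * ?E k s) - integral unit_cube (\<lambda>s. ?T (B *v s) * ?E k s)"
      unfolding \<psi>_def left_diff_distrib by (rule integral_diff[OF i])
    also have "integral unit_cube (\<lambda>s. ?T (B *v s) * ?E k s) = ?a (- k)"
      unfolding T by (rule trig_series_fourier_coeff[OF sum])
    also have "integral unit_cube (\<lambda>s. complex_of_real (f (B *v s)) * ?E k s) = ?a (- k)"
    proof -
      have "- (wave_vector B (- k) \<bullet> (B *v s)) = 2 * pi * (int_vec k \<bullet> s)" for s
        unfolding wave_vector_inner[OF inv] by (simp add: inner_vec_def sum_negf)
      then show ?thesis unfolding fourier_coeff_def by simp
    qed
    finally show "integral unit_cube (\<lambda>s. \<psi> s * ?E k s) = 0" by simp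
  qed
  moreover have "\<psi> (s + axis i 1) = \<psi> s" for s i
    unfolding \<psi>_def T lattice_periodic_matrix[OF per] cis_2pi_int_vec_periodic ..
  ultimately have "\<psi> (matrix_inv B *v x) = 0" by (rule zero_coeffs_imp_zero)
  moreover have "B *v (matrix_inv B *v x) = x"
    using someI_ex[OF inv[unfolded invertible_def]] by (simp add: matrix_vector_mul_assoc matrix_inv_def)
  ultimately show ?thesis by (simp add: \<psi>_def)
qed

section \<open>Passage to the contact time and conclusion\<close>

lemma powr_le_one_plus_square:
  assumes "0 \<le> (x::real)" "0 < \<alpha>" "\<alpha> < 1"
  shows "x powr (2 * \<alpha>) \<le> 1 + x\<^sup>2"
proof (cases "x \<le> 1")
  case True
  then have "x powr (2 * \<alpha>) \<le> 1" using assms by (intro powr_le1) auto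
  then show ?thesis by (simp add: add_increasing2)
next
  case False
  then have "x powr (2 * \<alpha>) \<le> x powr 2" using assms by (intro powr_mono) auto
  then show ?thesis using False by simp
qed

text \<open>Continuity in time carries the bound from times below \<open>t1\<close> to
  \<open>t1\<close>, at the price of strictness; the nonstrict bound is compatible with contact at
  \<open>x\<close> and \<open>y\<close>.\<close>

lemma obeys_limit:
  fixes \<theta> :: "'a::real_normed_vector \<Rightarrow> real \<Rightarrow> real" and \<omega> :: "real \<Rightarrow> real \<Rightarrow> real"
  assumes \<theta>: "\<And>z. continuous_on {0..} (\<lambda>t. \<theta> z t)" and \<omega>: "\<And>\<xi>. \<xi> \<ge> 0 \<Longrightarrow> continuous_on {0..} (\<lambda>t. \<omega> \<xi> t)"
    and t1: "t1 > 0" and ob: "\<And>t. 0 \<le> t \<Longrightarrow> t < t1 \<Longrightarrow> obeys (\<lambda>z. \<theta> z t) (\<lambda>\<xi>. \<omega> \<xi> t)"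
    and zz: "z \<noteq> z'"
  shows "\<theta> z t1 - \<theta> z' t1 \<le> \<omega> (norm (z - z')) t1"
proof -
  define T where "T n = t1 * (1 - 1 / real (Suc n))" for n
  have T0: "0 \<le> T n" and T1: "T n < t1" for n using t1 by (auto simp: T_def field_simps)
  have "T \<longlonglongrightarrow> t1 * (1 - 0)"
    unfolding T_def by (intro tendsto_intros LIMSEQ_Suc[OF lim_const_over_n])
  then have lim: "T \<longlonglongrightarrow> t1" by simp
  have c: "(\<lambda>n. g (T n)) \<longlonglongrightarrow> g t1" if "continuous_on {0..} g" for g :: "real \<Rightarrow> real"
    by (rule continuous_on_tendsto_compose[OF that lim]) (use T0 t1 in auto)
  show ?thesis
  proof (rule LIMSEQ_le)
    show "(\<lambda>n. \<theta> z (T n) - \<theta> z' (T n)) \<longlonglongrightarrow> \<theta> z t1 - \<theta> z' t1"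
      by (intro tendsto_diff c \<theta>)
    show "(\<lambda>n. \<omega> (norm (z - z')) (T n)) \<longlonglongrightarrow> \<omega> (norm (z - z')) t1"
      by (intro c \<omega>) simp
    have "\<bar>\<theta> z (T n) - \<theta> z' (T n)\<bar> < \<omega> (norm (z - z')) (T n)" for n
      using ob[OF T0 T1] zz by (simp add: obeys_def)
    then show "\<exists>N. \<forall>n\<ge>N. \<theta> z (T n) - \<theta> z' (T n) \<le> \<omega> (norm (z - z')) (T n)"
      by (meson abs_less_iff less_imp_le)
  qed
qed

theorem lemma2p5:
  fixes \<alpha> c t1 :: real
    and B :: "real^'n^'n"
    and U :: "(real^'n \<Rightarrow> real \<Rightarrow> real) \<Rightarrow> real^'n \<Rightarrow> real \<Rightarrow> real^'n"
    and \<theta> :: "real^'n \<Rightarrow> real \<Rightarrow> real"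
    and \<omega> :: "real \<Rightarrow> real \<Rightarrow> real"
    and x y :: "real^'n"
  assumes "0 < \<alpha>" and "\<alpha> < 1"
    and "heat_kernel_constant \<alpha> c"
    and "invertible B"
    and "smooth_periodic_solution \<alpha> B U \<theta>"
    and "continuous_on ({0..} \<times> {0..}) (\<lambda>(\<xi>, t). \<omega> \<xi> t)"
    and "\<And>\<xi>. \<xi> \<ge> 0 \<Longrightarrow> piecewise_C1_on {0..} (\<lambda>t. \<omega> \<xi> t)"
    and "\<And>t. t \<ge> 0 \<Longrightarrow> modulus_of_continuity (\<lambda>\<xi>. \<omega> \<xi> t)"
    and "\<And>t. t \<ge> 0 \<Longrightarrow> second_deriv_at_0_neg_infinity (\<lambda>\<xi>. \<omega> \<xi> t)"
    and "t1 > 0" and "x \<noteq> y"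
    and "\<And>t. 0 \<le> t \<Longrightarrow> t < t1 \<Longrightarrow> obeys (\<lambda>z. \<theta> z t) (\<lambda>\<xi>. \<omega> \<xi> t)"
    and "\<theta> x t1 - \<theta> y t1 = \<omega> (norm (x - y)) t1"
  shows "ereal (- frac_laplacian B \<alpha> (\<lambda>z. \<theta> z t1) x + frac_laplacian B \<alpha> (\<lambda>z. \<theta> z t1) y)
           \<le> dissipation c \<alpha> (\<lambda>\<xi>. \<omega> \<xi> t1) (norm (x - y))"
proof -
  note \<alpha> = assms(1,2) and hk = assms(3) and inv = assms(4) and sol = assms(5) and t1 = assms(10)
  let ?f = "\<lambda>z. \<theta> z t1"
  let ?w = "\<lambda>\<xi>. \<omega> \<xi> t1"
  let ?\<kappa> = "wave_vector B"
  let ?a = "fourier_coeff B ?f"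
  have w: "modulus_of_continuity ?w" using assms(8) t1 by simp
  have sm2: "smooth_on (UNIV \<times> {0..}) (\<lambda>(x, t). \<theta> x t)" and per: "lattice_periodic B ?f"
    using sol t1 by (auto simp: smooth_periodic_solution_def)
  have sm: "smooth_on UNIV ?f"
    using sm2 t1 Ck_on_slice[of _ "{0..}" "\<lambda>(x, t). \<theta> x t" t1] by (auto simp: smooth_on_def)
  have \<theta>c: "continuous_on {0..} (\<lambda>t. \<theta> z t)" for z
  proof -
    have "continuous_on {0..} (\<lambda>t. (\<lambda>(x, t). \<theta> x t) (z, t))"
      by (rule continuous_on_compose2[OF smooth_on_imp_continuous[OF sm2]])
         (auto intro!: continuous_on_Pair continuous_on_const continuous_on_id)
    then show ?thesis by simp
  qed
  have \<omega>c: "continuous_on {0..} (\<lambda>t. \<omega> \<xi> t)" if "\<xi> \<ge> 0" for \<xi>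
  proof -
    have "continuous_on {0..} (\<lambda>t. (\<lambda>(\<xi>, t). \<omega> \<xi> t) (\<xi>, t))"
      by (rule continuous_on_compose2[OF assms(6)])
         (use that in \<open>auto intro!: continuous_on_Pair continuous_on_const continuous_on_id\<close>)
    then show ?thesis by simp
  qed
  have s: "(\<lambda>k. (1 + (norm (?\<kappa> k))\<^sup>2) * norm (?a k)) summable_on UNIV"
    by (rule fourier_coeff_summable[OF inv sm per])
  have s1: "(\<lambda>k. norm (?a k)) summable_on UNIV"
  proof (rule summable_on_comparison_test[OF s])
    show "norm (?a k) \<le> (1 + (norm (?\<kappa> k))\<^sup>2) * norm (?a k)" for k
      using mult_right_mono[of 1 "1 + (norm (?\<kappa> k))\<^sup>2" "norm (?a k)"] by simp
  qed auto
  have s2: "(\<lambda>k. norm (complex_of_real (norm (?\<kappa> k) powr (2 * \<alpha>)) * ?a k)) summable_on UNIV"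
  proof (rule summable_on_comparison_test[OF s])
    show "norm (complex_of_real (norm (?\<kappa> k) powr (2 * \<alpha>)) * ?a k) \<le> (1 + (norm (?\<kappa> k))\<^sup>2) * norm (?a k)" for k
      using mult_right_mono[OF powr_le_one_plus_square[OF norm_ge_zero \<alpha>, of "?\<kappa> k"], of "norm (?a k)"] by (simp add: norm_mult)
  qed auto
  \<comment> \<open>Inversion transfers the modulus bound and the contact from
    \<open>\<theta>\<close> to the series whose coefficients define
    \<open>frac_laplacian\<close>.\<close>
  have f: "Re (trig_series ?\<kappa> ?a z) = \<theta> z t1" for z
    using fourier_inversion[OF inv smooth_on_imp_continuous[OF sm] per s1, of z] by (metis Re_complex_of_real)
  have mod: "\<theta> z t1 - \<theta> z' t1 \<le> \<omega> (norm (z - z')) t1" for z z'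
  proof (cases "z = z'")
    case True
    then show ?thesis using w by (simp add: modulus_of_continuity_def)
  qed (rule obeys_limit[OF \<theta>c \<omega>c t1 assms(12)])
  have lap: "frac_laplacian B \<alpha> ?f z = Re (trig_series ?\<kappa> (\<lambda>k. complex_of_real (norm (?\<kappa> k) powr (2 * \<alpha>)) * ?a k) z)" for z
    unfolding frac_laplacian_def trig_series_def ..
  show ?thesis
    unfolding lap
    by (rule trig_series_dissipation_bound[OF \<alpha> hk w s1 s2 _ assms(11)]) (use mod assms(13) in \<open>simp_all add: f\<close>)
qed

end
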